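(* Let $n\ge 1$ be an integer such that $n+1$ is a perfect square. Then the remainder polynomial $R_{(n,n)}(x)$ is irreducible in $\mathbb{Z}[x]$.
   Context: $\mathrm{He}_k(x)$ denotes the monic probabilists' Hermite polynomial of degree $k$ (the polynomial solution of $y''-xy'+ky=0$; e.g. $\mathrm{He}_0=1$, $\mathrm{He}_1=x$, $\mathrm{He}_2=x^2-1$). A partition $\lambda=(\lambda_1\ge\lambda_2\ge\dots\ge\lambda_r\ge 0)$ may have zero parts; $|\lambda|=\sum_i\lambda_i$. Its degree sequence is $n_\lambda=(\lambda_r,\lambda_{r-1}+1,\dots,\lambda_1+r-1)$. Let $\Delta(x_1,\dots,x_r)=\prod_{1\le i<j\le r}(x_j-x_i)$. The Wronskian Hermite polynomial is $\mathrm{He}_\lambda(x)=\mathrm{Wr}[\mathrm{He}_{n_1},\dots,\mathrm{He}_{n_r}]/\Delta(n_\lambda)$ where $n_\lambda=(n_1,\dots,n_r)$; it is monic of degree $|\lambda|$ with integer coefficients. Removing a $2$-hook from $\lambda$ means replacing some entry $a$ of $n_\lambda$ by $a-2$, where $a-2\ge 0$ and $a-2\notin n_\lambda$, and taking the partition of the same length with the new set as degree sequence. Removing $2$-hooks until none remain gives the $2$-core $\bar\lambda$ (independent of choices), which is a staircase $(m,m-1,\dots,1)$ padded with zeros, so $|\bar\lambda|=\binom{m+1}{2}$. One has $\mathrm{He}_\lambda(x)=x^{|\bar\lambda|}R_\lambda(x)$ with $R_\lambda\in\mathbb{Z}[x]$, $R_\lambda(0)\ne 0$; $R_\lambda$ is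 called the remainder polynomial. *)

theory Defs
  imports "HOL-Computational_Algebra.Polynomial_Factorial" "Jordan_Normal_Form.Determinant"
begin

fun hermiteHe :: "nat \<Rightarrow> int poly" where
  "hermiteHe 0 = 1"
| "hermiteHe (Suc 0) = [:0, 1:]"
| "hermiteHe (Suc (Suc k)) = [:0, 1:] * hermiteHe (Suc k) - smult (int (k + 1)) (hermiteHe k)"

text \<open>A partition is a list lam = [lam_1, ..., lam_r] (nonincreasing, zero parts allowed).
  Its degree sequence is (lam_r, lam_(r-1) + 1, ..., lam_1 + r - 1).\<close>
definition degseq :: "nat list \<Rightarrow> nat list" where
  "degseq lam = map (\<lambda>i. lam ! (length lam - 1 - i) + i) [0..<length lam]"

definition vandermonde :: "nat list \<Rightarrow> int" where
  "vandermonde ns = (\<Prod>j<length ns. \<Prod>i<j. int (ns ! j) - int (ns ! i))"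

definition wronskian :: "int poly list \<Rightarrow> int poly" where
  "wronskian fs = det (mat (length fs) (length fs) (\<lambda>(i, j). (pderiv ^^ i) (fs ! j)))"

definition wronskianHe :: "nat list \<Rightarrow> int poly" where
  "wronskianHe lam =
     (let ns = degseq lam
      in map_poly (\<lambda>c. c div vandermonde ns) (wronskian (map hermiteHe ns)))"

text \<open>Removing a 2-hook, on the level of degree sets: replace a by a-2.\<close>
definition remove_2hook :: "nat set \<Rightarrow> nat set \<Rightarrow> bool" where
  "remove_2hook S T \<longleftrightarrow> (\<exists>a\<in>S. 2 \<le> a \<and> a - 2 \<notin> S \<and> T = insert (a - 2) (S - {a}))"

text \<open>Size |lam| of the partition with degree set S (of cardinality r).\<close>
definition size_of_degset :: "nat set \<Rightarrow> nat" where
  "size_of_degset S = \<Sum>S - (card S * (card S - 1)) div 2"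

definition core2_size :: "nat list \<Rightarrow> nat" where
  "core2_size lam =
     (THE k. \<exists>T. remove_2hook\<^sup>*\<^sup>* (set (degseq lam)) T \<and> (\<nexists>U. remove_2hook T U)
                 \<and> k = size_of_degset T)"

text \<open>Remainder polynomial: He_lam = x^|core| * R_lam.\<close>
definition remainderR :: "nat list \<Rightarrow> int poly" where
  "remainderR lam = wronskianHe lam div monom 1 (core2_size lam)"

end

theory Submission
  imports Defs Complex_Main "HOL-Computational_Algebra.Squarefree" "HOL-Number_Theory.Totient"
begin

text \<open>Here \<open>f = He\<^sub>n He\<^sub>n\<^sub>+\<^sub>1' - He\<^sub>n' He\<^sub>n\<^sub>+\<^sub>1\<close> is even, monic of degree \<open>2n\<close>, and \<open>f(0) > 0\<close>. So a reducible
  \<open>f\<close> is either \<open>\<plusminus>g(x) g(-x)\<close> or has an even factor \<open>A\<close> of degree \<open>2k\<close> with \<open>1 \<le> k \<le> n/2\<close>.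

  In the first case \<open>n\<close> is even, so \<open>4\<close> divides \<open>n = m\<^sup>2 - 1\<close>, and there is a prime \<open>q\<close> that is \<open>3\<close> modulo \<open>4\<close> and divides
  \<open>n - 1\<close>; modulo \<open>q\<close> the polynomial \<open>f\<close> is \<open>x\<^sup>2\<^sup>n\<^sup>-\<^sup>2 (x\<^sup>2 + 1)\<close>, and \<open>-1\<close> would be a square modulo \<open>q\<close>.

  In the second case let \<open>p\<close> be an odd prime with \<open>n mod p < k\<close>. The low coefficients of \<open>f\<close> vanish modulo \<open>p\<close>,
  which forces \<open>p\<close> to divide \<open>A(0)\<close>. If \<open>p > 2k\<close>, this contradicts the bound on the slopes of the Newton
  polygon of \<open>f\<close> at \<open>p\<close>, which holds because \<open>f(0)\<close> divides \<open>i! f\<^sub>i\<close> up to units at \<open>p\<close>. If only \<open>p > k\<close> but \<open>n < p\<^sup>2\<close>, the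
  steepest edge of the Newton polygon is known and is too long and without usable lattice points. A prime
  of one of these two kinds exists by an Erdos-style argument: otherwise the binomial coefficient \<open>n\<close> over
  \<open>k\<close> would have too few prime factors. The exception \<open>n = 8\<close>, \<open>k = 1\<close> is settled modulo \<open>13\<close>.\<close>

section \<open>Prime powers dividing factorials and binomial coefficients\<close>

text \<open>The 2-core of \<open>(n, n)\<close> is empty and the Vandermonde factor is 1, so the
  remainder polynomial is the bare Wronskian \<open>wr n\<close>. Modulo \<open>p\<close> it is
  divisible by x^(2Kp) with K = n div p, and \<open>n mod p < k\<close> says exactly that the
  cofactor of A, of degree 2n - 2k, is too short to absorb this power. Counting prime factors of the
  binomial coefficient yields a prime divisor p > k, whereas the factorial slope bound needs p > 2k.
  This gap shapes the proof: for k < p <= 2k a finer Newton polygon takes over, which depends on the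
  parity of K and is computed for n < p^2. The prime divisors above k that remain unusable satisfy
  both p <= 2k and p^2 <= n, and there are too few of them. For k <= 4 there are exactly k primes up
  to 2k, so counting gives nothing; there the hypothesis that n + 1 is a square supplies prime
  divisors of n, n - 1 or n - 2. Its other arithmetic use is that 4 divides n when n is
  even.\<close>

lemma multiplicity_eq_sum_dvd:
  fixes p m :: nat
  assumes "prime p" "m > 0" "m < p ^ Suc E"
  shows "multiplicity p m = (\<Sum>e=1..E. if p ^ e dvd m then 1 else 0)"
proof -
  have p: "p \<ge> 2" using assms(1) prime_ge_2_nat by blast
  have dvd_iff: "p ^ e dvd m \<longleftrightarrow> e \<le> multiplicity p m" for e
    using assms p by (intro power_dvd_iff_le_multiplicity) (auto simp: prime_elem_not_unit)
  have "p ^ multiplicity p m \<le> m"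
    using multiplicity_dvd[of p m] assms(2) by (auto dest: dvd_imp_le)
  hence "p ^ multiplicity p m < p ^ Suc E" using assms(3) by linarith
  hence le: "multiplicity p m \<le> E" using p by (subst (asm) power_strict_increasing_iff) auto
  have "(\<Sum>e=1..E. if p ^ e dvd m then 1 else 0::nat) = card {e\<in>{1..E}. e \<le> multiplicity p m}"
    by (subst sum.If_cases) (auto simp: dvd_iff Int_def)
  also have "{e\<in>{1..E}. e \<le> multiplicity p m} = {1..multiplicity p m}" using le by auto
  finally show ?thesis by simp
qed

lemma legendre_multiplicity_fact:
  fixes p n :: nat
  assumes "prime p" "n < p ^ Suc E"
  shows "multiplicity p (fact n) = (\<Sum>e=1..E. n div p ^ e)"
  using assms(2)
proof (induction n)
  case 0
  show ?case by simp
next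
  case (Suc n)
  have "multiplicity p (fact (Suc n)) = multiplicity p (Suc n) + multiplicity p (fact n)"
    using assms(1) by (simp only: fact_Suc of_nat_id)
      (rule prime_elem_multiplicity_mult_distrib, auto)
  also have "\<dots> = (\<Sum>e=1..E. (if p ^ e dvd Suc n then 1 else 0) + n div p ^ e)"
    using Suc assms(1) by (subst multiplicity_eq_sum_dvd[of p _ E]) (auto simp: sum.distrib)
  also have "\<dots> = (\<Sum>e=1..E. Suc n div p ^ e)"
    by (intro sum.cong) (auto simp: div_Suc dvd_eq_mod_eq_0)
  finally show ?case .
qed

text \<open>By Legendre, \<open>(p - 1)\<close> times the multiplicity is \<open>i\<close> minus the
  base-\<open>p\<close> digit sum of \<open>i\<close>, which is positive. The strictness later makes
  the constant coefficient the unique maximiser of \<open>gauss_term\<close>.\<close>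

lemma multiplicity_fact_less:
  fixes p i :: nat
  assumes "prime p" "i \<ge> 1"
  shows "(p - 1) * multiplicity p (fact i) < i"
proof -
  have p: "p \<ge> 2" using assms(1) prime_ge_2_nat by blast
  obtain E where E': "p ^ E \<le> i" and E: "i < p ^ Suc E"
    using ex_power_ivl1[OF p assms(2)] by auto
  have step: "(p - 1) * (\<Sum>e=1..F. i div p ^ e) + i div p ^ F \<le> i" for F
  proof (induction F)
    case (Suc F)
    have "p * (i div p ^ Suc F) \<le> i div p ^ F"
      by (metis div_mult2_eq power_Suc2 times_div_less_eq_dividend)
    hence "(p - 1) * (i div p ^ Suc F) + i div p ^ Suc F \<le> i div p ^ F"
      using p by (cases p) (simp_all add: add.commute)
    thus ?case using Suc by (simp add: algebra_simps)
  qed auto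
  have "i div p ^ E \<ge> 1" using E' p by (simp add: Suc_le_eq div_greater_zero_iff)
  hence "(p - 1) * (\<Sum>e=1..E. i div p ^ e) + 1 \<le> i"
    by (rule order_trans[OF add_left_mono step])
  thus ?thesis unfolding legendre_multiplicity_fact[OF assms(1) E] by (simp only: Suc_eq_plus1 Suc_le_eq[symmetric])
qed

lemma multiplicity_binomial:
  fixes p n k :: nat
  assumes "prime p" "k \<le> n" "n < p ^ Suc E"
  shows "multiplicity p (n choose k) = (\<Sum>e=1..E. n div p ^ e - k div p ^ e - (n - k) div p ^ e)"
proof -
  have "multiplicity p (fact n) = multiplicity p ((fact k * fact (n - k)) * (n choose k) :: nat)"
    using binomial_fact_lemma[OF assms(2)] by simp
  also have "\<dots> = multiplicity p (fact k) + multiplicity p (fact (n - k)) + multiplicity p (n choose k)"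
    using assms by (simp add: prime_elem_multiplicity_mult_distrib)
  finally have "multiplicity p (n choose k) =
    (\<Sum>e=1..E. n div p ^ e) - ((\<Sum>e=1..E. k div p ^ e) + (\<Sum>e=1..E. (n - k) div p ^ e))"
    using assms by (simp add: legendre_multiplicity_fact[where E = E])
  also have "\<dots> = (\<Sum>e=1..E. n div p ^ e - (k div p ^ e + (n - k) div p ^ e))"
    unfolding sum.distrib[symmetric]
  proof (rule sum_subtractf_nat[symmetric])
    fix e
    show "k div p ^ e + (n - k) div p ^ e \<le> n div p ^ e"
      using div_add1_eq[of k "n - k" "p ^ e"] assms(2) by simp
  qed
  finally show ?thesis by simp
qed

lemma binomial_carry_le_1: "n div q - k div q - (n - k) div q \<le> (1::nat)" if "k \<le> n" for n k q :: nat
proof (cases "q = 0")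
  case False
  have "(k mod q + (n - k) mod q) div q \<le> 1"
    using False by (intro less_Suc_eq_le[THEN iffD1]) (simp add: div_less_iff_less_mult, meson add_strict_mono mod_less_divisor not_gr_zero mult_2 less_le_trans le_refl)
  thus ?thesis using div_add1_eq[of k "n - k" q] that by simp
qed auto

text \<open>Kummer: the multiplicity is a number of carries, each exponent \<open>e\<close>
  contributes at most one, and only those with \<open>p ^ e \<le> n\<close> count.\<close>

lemma prime_power_binomial_le:
  fixes p n k :: nat
  assumes "prime p" "k \<le> n" "n > 0"
  shows "p ^ multiplicity p (n choose k) \<le> n"
proof -
  have p: "p \<ge> 2" using assms(1) prime_ge_2_nat by blast
  obtain E where E': "p ^ E \<le> n" and E: "n < p ^ Suc E"
    using ex_power_ivl1[OF p, of n] assms(3) by auto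
  have "multiplicity p (n choose k) \<le> (\<Sum>e=1..E. 1)"
    unfolding multiplicity_binomial[OF assms(1,2) E]
    by (intro sum_mono binomial_carry_le_1 assms)
  hence "p ^ multiplicity p (n choose k) \<le> p ^ E"
    using p by (intro power_increasing) auto
  thus ?thesis using E' by linarith
qed

lemma multiplicity_binomial_le_1:
  fixes p n k :: nat
  assumes "prime p" "k \<le> n" "n < p ^ 2"
  shows "multiplicity p (n choose k) \<le> 1"
  using multiplicity_binomial[of p k n 1] assms binomial_carry_le_1[of k n p] by (simp add: numeral_2_eq_2)

text \<open>For n/3 < p <= k <= n/2 the at most two multiples of \<open>p\<close> in the factorial
  of \<open>n\<close> are cancelled by one in each of the factorials of \<open>k\<close> and
  \<open>n - k\<close>.\<close>

lemma multiplicity_binomial_eq_0: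
  fixes p n k :: nat
  assumes "prime p" "n < p ^ 2" "n < 3 * p" "p \<le> k" "2 * k \<le> n"
  shows "multiplicity p (n choose k) = 0"
proof -
  have p: "p > 0" using assms(1) prime_gt_0_nat by blast
  have "n div p \<le> 2" using assms p by (simp add: less_Suc_eq_le[symmetric] div_less_iff_less_mult)
  moreover have "k div p \<ge> 1" using assms p by (simp add: Suc_le_eq div_greater_zero_iff)
  moreover have "(n - k) div p \<ge> 1" using assms p by (simp add: Suc_le_eq div_greater_zero_iff)
  ultimately show ?thesis
    using multiplicity_binomial[of p k n 1] assms by (simp add: numeral_2_eq_2)
qed

section \<open>Explicit bounds for primes\<close>

lemma prod_primes_dvd:
  fixes x :: nat
  assumes "finite S" "\<And>p. p \<in> S \<Longrightarrow> prime p" "\<And>p. p \<in> S \<Longrightarrow> p dvd x"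
  shows "\<Prod>S dvd x"
  using assms
proof (induction S rule: finite_induct)
  case (insert p S)
  have "coprime p (\<Prod>S)"
    using insert by (intro prod_coprime_right) (metis insertCI primes_coprime)
  thus ?case using insert by (simp add: divides_mult)
qed simp

section \<open>A Chebyshev bound for the product of the primes up to n\<close>

definition primorial :: "nat \<Rightarrow> nat" where
  "primorial n = \<Prod>{p. prime p \<and> p \<le> n}"

lemma finite_primes_le [simp]: "finite {p::nat. prime p \<and> p \<le> n}" "finite {p::nat. prime p \<and> m < p \<and> p \<le> n}"
  by (auto intro: finite_subset[of _ "{..n}"])

lemma central_binomial_odd_le: "(2 * m + 1) choose m \<le> (4::nat) ^ m"
proof -
  have "((2 * m + 1) choose m) + ((2 * m + 1) choose (m + 1)) = (\<Sum>k\<in>{m, m + 1}. (2 * m + 1) choose k)"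
    by simp
  also have "\<dots> \<le> (\<Sum>k\<le>2 * m + 1. (2 * m + 1) choose k)"
    by (intro sum_mono2) auto
  also have "\<dots> = 2 ^ (2 * m + 1)"
    by (rule choose_row_sum)
  also have "(2::nat) ^ (2 * m + 1) = 2 * 4 ^ m"
    by (simp add: power_mult)
  also have "(2 * m + 1) choose (m + 1) = (2 * m + 1) choose m"
    by (subst binomial_symmetric) auto
  finally show ?thesis by simp
qed

text \<open>Erdos's induction: for n = 2m + 1 the primes above m + 1 all divide the middle binomial
  coefficient, which is at most 4^m, and the others are covered by the induction hypothesis at m +
  1.\<close>

lemma primorial_le: "primorial n \<le> 4 ^ n"
proof (induction n rule: less_induct)
  case (less n)
  consider "n \<le> 2" | "n > 2" "even n" | m where "n = 2 * m + 1" "m \<ge> 1"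
  proof (cases "n \<le> 2 \<or> even n")
    case False
    then obtain m where "n = 2 * m + 1" by (auto elim: oddE)
    with False show ?thesis using that(3)[of m] by (cases m) auto
  qed (use that in force)
  thus ?case
  proof cases
    case 1
    have "{p::nat. prime p \<and> p \<le> n} \<subseteq> {2}"
      using 1 prime_ge_2_nat by (auto intro: antisym)
    then consider "{p::nat. prime p \<and> p \<le> n} = {}" | "{p::nat. prime p \<and> p \<le> n} = {2}"
      by (auto simp only: subset_singleton_iff)
    thus ?thesis
    proof cases
      case 2
      hence "2 \<in> {p::nat. prime p \<and> p \<le> n}" by blast
      hence "n = 2" using 1 by simp
      thus ?thesis unfolding primorial_def 2 by simp
    qed (simp only: primorial_def, simp)
  next
    case 2
    have "\<not> prime n" using 2 prime_odd_nat by blast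
    hence "{p. prime p \<and> p \<le> n} = {p. prime p \<and> p \<le> n - 1}"
      using 2 by (auto simp: le_less)
    hence "primorial n = primorial (n - 1)" by (simp add: primorial_def)
    also have "\<dots> \<le> 4 ^ (n - 1)" using 2 by (intro less) auto
    also have "\<dots> \<le> 4 ^ n" by (intro power_increasing) auto
    finally show ?thesis .
  next
    case 3
    let ?S = "{p. prime p \<and> m + 1 < p \<and> p \<le> n}"
    have "\<Prod>?S dvd (n choose m)"
    proof (intro prod_primes_dvd)
      fix p assume p: "p \<in> ?S"
      hence "p dvd fact n" by (auto simp: prime_dvd_fact_iff)
      hence "p dvd fact m * fact (n - m) * (n choose m)"
        using binomial_fact_lemma[of m n] 3 by simp
      moreover have "\<not> p dvd fact m" "\<not> p dvd fact (n - m)"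
        using p 3 by (auto simp: prime_dvd_fact_iff simp del: fact_Suc)
      ultimately show "p dvd (n choose m)"
        using p by (auto simp only: prime_dvd_mult_iff mem_Collect_eq)
    qed auto
    hence "\<Prod>?S \<le> n choose m" using 3 by (intro dvd_imp_le) auto
    also have "\<dots> \<le> 4 ^ m" using central_binomial_odd_le[of m] 3 by simp
    finally have 1: "\<Prod>?S \<le> 4 ^ m" .
    have "{p. prime p \<and> p \<le> n} = {p. prime p \<and> p \<le> m + 1} \<union> ?S" using 3 by auto
    hence "primorial n = primorial (m + 1) * \<Prod>?S"
      unfolding primorial_def by (simp only:) (subst prod.union_disjoint, auto)
    also have "\<dots> \<le> 4 ^ (m + 1) * 4 ^ m" using 3 by (intro mult_mono 1 less) auto
    also have "\<dots> = 4 ^ n" using 3 by (simp flip: power_add)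
    finally show ?thesis .
  qed
qed

section \<open>A linear bound for the number of primes, by sieving modulo 210\<close>

definition prime_count :: "nat \<Rightarrow> nat" where
  "prime_count n = card {p. prime p \<and> p \<le> n}"

lemma totient_210: "totient 210 = 48"
proof -
  have "totient 210 = totient (2 * (3 * (5 * 7)))" by simp
  also have "\<dots> = totient 2 * (totient 3 * (totient 5 * totient 7))"
    by (subst totient_mult_coprime, simp add: coprime_iff_gcd_eq_1 gcd_non_0_nat)+ simp
  also have "\<dots> = 48" by (simp add: totient_prime)
  finally show ?thesis .
qed

lemma card_coprime_210: "card {r\<in>{..<210}. coprime r (210::nat)} \<le> 48"
proof -
  have "{r\<in>{..<210}. coprime r (210::nat)} \<subseteq> totatives 210"
    by (auto simp: totatives_def intro!: Nat.gr0I)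
  hence "card {r\<in>{..<210}. coprime r (210::nat)} \<le> totient 210"
    unfolding totient_def by (intro card_mono) auto
  thus ?thesis by (simp add: totient_210)
qed

text \<open>Primes above 7 are coprime to 210 = 2 * 3 * 5 * 7, so a window of length 210 holds at
  most \<open>totient 210 = 48\<close> of them. Since 4 * 48 <= 210, a bound of slope 1/4 propagates
  from window to window.\<close>

lemma prime_count_add_210:
  assumes "x \<ge> 7"
  shows "prime_count (x + 210) \<le> prime_count x + 48"
proof -
  let ?S = "{p. prime p \<and> x < p \<and> p \<le> x + 210}"
  have "card ?S \<le> card {r\<in>{..<210}. coprime r (210::nat)}"
  proof (rule card_inj_on_le)
    show "inj_on (\<lambda>p. p mod 210) ?S"
    proof (rule linorder_inj_onI)
      fix p q :: nat assume "p < q" "p \<in> ?S" "q \<in> ?S"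
      hence "\<not> 210 dvd q - p" by (auto dest: dvd_imp_le)
      thus "p mod 210 \<noteq> q mod 210"
        using mod_eq_dvd_iff_nat[of p q 210] \<open>p < q\<close> by simp
    qed auto
    show "(\<lambda>p. p mod 210) ` ?S \<subseteq> {r\<in>{..<210}. coprime r (210::nat)}"
    proof safe
      fix p :: nat assume p: "prime p" "x < p"
      have "\<not> p dvd q" if "q \<in> {2, 3, 5, 7}" for q
        using that p assms by (auto dest: dvd_imp_le)
      hence "\<not> p dvd 2 * 3 * 5 * 7"
        using p(1) by (simp only: prime_dvd_mult_iff insert_iff) blast
      hence "coprime p 210" using p(1) prime_imp_coprime_nat[of p 210] by simp
      thus "coprime (p mod 210) 210" by simp
    qed simp_all
  qed simp
  moreover have "{p. prime p \<and> p \<le> x + 210} = {p. prime p \<and> p \<le> x} \<union> ?S" by auto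
  hence "prime_count (x + 210) \<le> prime_count x + card ?S"
    unfolding prime_count_def using card_Un_le by metis
  ultimately show ?thesis using card_coprime_210 by simp
qed

definition primes_below_120 :: "nat list" where
  "primes_below_120 = [2,3,5,7,11,13,17,19,23,29,31,37,41,43,47,53,59,61,67,71,73,79,83,89,97,
    101,103,107,109,113]"

definition primes_120_331 :: "nat list" where
  "primes_120_331 = [127,131,137,139,149,151,157,163,167,173,179,181,191,193,197,199,
    211,223,227,229,233,239,241,251,257,263,269,271,277,281,283,293,307,311,313,317]"

lemmas primes_below_331_defs = primes_below_120_def primes_120_331_def

lemma coprime_210_iff:
  "coprime r (210::nat) \<longleftrightarrow> \<not> 2 dvd r \<and> \<not> 3 dvd r \<and> \<not> 5 dvd r \<and> \<not> 7 dvd r"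
proof -
  have prime_case: "coprime r q \<longleftrightarrow> \<not> q dvd r" if "prime q" for q :: nat
    using that by (metis coprime_absorb_right coprime_commute not_prime_unit prime_imp_coprime)
  have "coprime r 210 \<longleftrightarrow> coprime r (2 * (3 * (5 * 7)))" by simp
  also have "\<dots> \<longleftrightarrow> coprime r 2 \<and> coprime r 3 \<and> coprime r 5 \<and> coprime r 7"
    unfolding coprime_mult_right_iff ..
  finally show ?thesis
    using prime_case[of 2] prime_case[of 3] prime_case[of 5] prime_case[of 7] by simp
qed

lemma totatives_210:
  "totatives 210 = set [1, 11, 13, 17, 19, 23, 29, 31, 37, 41, 43, 47, 53, 59, 61, 67, 71, 73, 79, 83, 89, 97,
    101, 103, 107, 109, 113, 121, 127, 131, 137, 139, 143, 149, 151, 157, 163, 167, 169,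
    173, 179, 181, 187, 191, 193, 197, 199, 209]"
  (is "_ = set ?R")
proof (rule card_subset_eq[symmetric])
  show "set ?R \<subseteq> totatives 210"
    by (simp only: list.set insert_subset empty_subsetI simp_thms totatives_def mem_Collect_eq coprime_210_iff)
      simp
  have "card (set ?R) = length ?R" by (intro distinct_card) simp
  thus "card (set ?R) = card (totatives 210)"
    unfolding totient_def[symmetric] totient_210 by simp
qed simp

lemma prime_in_primes_below_331:
  assumes "prime p" "p < 331"
  shows "p \<in> set (primes_below_120 @ primes_120_331)"
proof (cases "p \<in> {2, 3, 5, 7}")
  case True
  thus ?thesis by (auto simp: primes_below_331_defs)
next
  case False
  hence "\<not> p dvd q" if "q \<in> {2, 3, 5, 7}" for q
    using that by (auto dest!: primes_dvd_imp_eq[OF assms(1), rotated])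
  hence "\<not> p dvd 2 * 3 * 5 * 7"
    using assms(1) by (simp only: prime_dvd_mult_iff insert_iff) blast
  hence "coprime p 210" using assms(1) prime_imp_coprime_nat[of p 210] by simp
  hence "coprime (p mod 210) 210" by simp
  hence r: "p mod 210 \<in> totatives 210" by (auto simp: totatives_def intro!: Nat.gr0I)
  let ?L = "primes_below_120 @ primes_120_331"
  \<comment> \<open>Besides 1, the extra numbers in \<open>r1\<close> and \<open>r2\<close> are the
    composites below 331 coprime to 210. Each is divisible by 11, 13 or 17 because 19^2 >
    331.\<close>
  have r1: "\<forall>r\<in>totatives 210. r \<in> set ?L \<or> r \<in> {1, 121, 143, 169, 187, 209}"
    unfolding totatives_210 by (simp add: primes_below_331_defs)
  have r2: "\<forall>r\<in>totatives 210. r + 210 \<in> set ?L \<or> r + 210 \<in> {221, 247, 253, 289, 299, 319, 323} \<or> 331 \<le> r + 210"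
    unfolding totatives_210 by (simp add: primes_below_331_defs)
  have "p \<in> set ?L \<or> p \<in> {1, 121, 143, 169, 187, 209, 221, 247, 253, 289, 299, 319, 323}"
  proof (cases "p < 210")
    case True
    hence "p mod 210 = p" by simp
    thus ?thesis using bspec[OF r1 r] by auto
  next
    case False
    hence "p mod 210 + 210 = p" using assms(2) by (simp add: le_mod_geq)
    thus ?thesis using bspec[OF r2 r] assms(2) by auto
  qed
  moreover have "p \<notin> {1, 121, 143, 169, 187, 209, 221, 247, 253, 289, 299, 319, 323}"
  proof
    assume mem: "p \<in> {1, 121, 143, 169, 187, 209, 221, 247, 253, 289, 299, 319, 323}"
    hence "p = 1 \<or> 11 dvd p \<and> p \<noteq> 11 \<or> 13 dvd p \<and> p \<noteq> 13 \<or> 17 dvd p \<and> p \<noteq> 17"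
      by (elim insertE emptyE) simp_all
    thus False using assms(1) by (auto simp only: prime_nat_iff)
  qed
  ultimately show ?thesis by blast
qed

lemma prime_count_le_length:
  assumes "x < 331"
  shows "prime_count x \<le> length (filter (\<lambda>p. p \<le> x) (primes_below_120 @ primes_120_331))"
proof -
  let ?L = "filter (\<lambda>p. p \<le> x) (primes_below_120 @ primes_120_331)"
  have "{p. prime p \<and> p \<le> x} \<subseteq> set ?L"
    unfolding set_filter using prime_in_primes_below_331 assms by (auto simp del: set_append)
  hence "prime_count x \<le> card (set ?L)"
    unfolding prime_count_def by (intro card_mono) auto
  thus ?thesis using card_length le_trans by blast
qed

text \<open>The counter \<open>i\<close> is the number of entries already passed: entry number i + 1
  has to be at least 4(i + 1) - c. For an increasing list this one pass bounds the number of entries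
  up to any \<open>x\<close>.\<close>

fun entries_ge_linear :: "nat \<Rightarrow> nat \<Rightarrow> nat list \<Rightarrow> bool" where
  "entries_ge_linear c i [] \<longleftrightarrow> True"
| "entries_ge_linear c i (p # ps) \<longleftrightarrow> 4 * i + 4 \<le> p + c \<and> entries_ge_linear c (i + 1) ps"

lemma length_filter_le_of_entries_ge_linear:
  assumes "sorted ps" "entries_ge_linear c i ps" "4 * i \<le> x + c"
  shows "4 * (i + length (filter (\<lambda>p. p \<le> x) ps)) \<le> x + c"
  using assms
proof (induction ps arbitrary: i)
  case (Cons p ps)
  show ?case
  proof (cases "p \<le> x")
    case True
    hence "4 * (i + 1 + length (filter (\<lambda>p. p \<le> x) ps)) \<le> x + c"
      using Cons.prems by (intro Cons.IH) auto
    thus ?thesis using True by simp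
  next
    case False
    hence "filter (\<lambda>p. p \<le> x) (p # ps) = []"
      using Cons.prems(1) by (auto simp: filter_empty_conv)
    thus ?thesis using Cons.prems(3) by simp
  qed
qed simp

text \<open>The constant 13 is attained at x = 31, 43 and 47. The table is consulted below 217 = 7 +
  210, where the window argument takes over.\<close>

lemma prime_count_le: "4 * prime_count x \<le> x + 13"
proof (induction x rule: less_induct)
  case (less x)
  show ?case
  proof (cases "x < 217")
    case True
    let ?l = "length (filter (\<lambda>p. p \<le> x) (primes_below_120 @ primes_120_331))"
    have "4 * (0 + ?l) \<le> x + 13"
      by (rule length_filter_le_of_entries_ge_linear) (simp_all add: primes_below_331_defs)
    hence "4 * ?l \<le> x + 13" by (simp only: add_0)
    moreover have "prime_count x \<le> ?l"
      using True by (intro prime_count_le_length) simp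
    hence "4 * prime_count x \<le> 4 * ?l" by (rule mult_le_mono2)
    ultimately show ?thesis by (rule le_trans[rotated])
  next
    case False
    hence "4 * prime_count (x - 210) \<le> (x - 210) + 13" by (intro less) auto
    moreover have "prime_count x \<le> prime_count (x - 210) + 48"
      using prime_count_add_210[of "x - 210"] False by simp
    ultimately show ?thesis using False by linarith
  qed
qed

text \<open>There are 30 primes below 120 = 4 * 30, so the additive constant disappears from there
  on; this is why the table of primes is split at 120.\<close>

lemma prime_count_le_quarter: "x \<ge> 120 \<Longrightarrow> 4 * prime_count x \<le> x"
proof (induction x rule: less_induct)
  case (less x)
  show ?case
  proof (cases "x < 330")
    case True
    let ?a = "length (filter (\<lambda>p. p \<le> x) primes_below_120)"
      and ?b = "length (filter (\<lambda>p. p \<le> x) primes_120_331)"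
    have 1: "4 * (30 + ?b) \<le> x + 0"
      using less.prems
      by (intro length_filter_le_of_entries_ge_linear) (simp_all add: primes_120_331_def)
    have 2: "?a \<le> 30"
      by (rule order_trans[OF length_filter_le]) (simp add: primes_below_120_def)
    have "prime_count x \<le> length (filter (\<lambda>p. p \<le> x) (primes_below_120 @ primes_120_331))"
      using True by (intro prime_count_le_length) simp
    also have "\<dots> = ?a + ?b" by (simp only: filter_append length_append)
    also have "\<dots> \<le> 30 + ?b" by (rule add_le_mono1[OF 2])
    finally have "4 * prime_count x \<le> 4 * (30 + ?b)" by (rule mult_le_mono2)
    thus ?thesis using 1 unfolding add_0_right by (rule le_trans)
  next
    case False
    hence "4 * prime_count (x - 210) \<le> x - 210" by (intro less.IH) auto
    moreover have "prime_count x \<le> prime_count (x - 210) + 48"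
      using prime_count_add_210[of "x - 210"] False by simp
    ultimately show ?thesis using False by linarith
  qed
qed

section \<open>Lower and upper bounds for binomial coefficients\<close>

lemma binomial_over_power_mono:
  fixes k m n :: nat
  assumes "k \<le> m" "m \<le> n" "m \<ge> 1"
  shows "real (m choose k) * real n ^ k \<le> real (n choose k) * real m ^ k"
  using assms(2)
proof (induction n rule: dec_induct)
  case (step n)
  have n: "n \<ge> 1" "k \<le> n" using step assms by auto
  have absorb: "real (Suc n - k) * real (Suc n choose k) = real (Suc n) * real (n choose k)"
    using binomial_absorb_comp[of "Suc n" k] by (metis diff_Suc_1 of_nat_mult)
  \<comment> \<open>From n to n + 1 the binomial grows by the factor (n+1)/(n+1-k) and the power by
    ((n+1)/n)^k; Bernoulli's inequality says that the first factor is at least the second.\<close>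
  have "1 + real k * (- 1 / real (Suc n)) \<le> (1 + (- 1 / real (Suc n))) ^ k"
    by (rule Bernoulli_inequality) simp
  also have "1 + (- 1 / real (Suc n)) = real n / real (Suc n)"
    by (simp add: field_simps)
  also have "1 + real k * (- 1 / real (Suc n)) = real (Suc n - k) / real (Suc n)"
    using n by (simp add: field_simps of_nat_diff)
  finally have bern: "real (Suc n - k) / real (Suc n) \<le> (real n / real (Suc n)) ^ k" .
  have "real (n choose k) * real (Suc n) ^ k * (real (Suc n - k) / real (Suc n)) \<le>
        real (n choose k) * real (Suc n) ^ k * ((real n / real (Suc n)) ^ k)"
    by (intro mult_left_mono bern) auto
  also have "\<dots> = real (n choose k) * real n ^ k"
    by (simp add: power_divide)
  also have "\<dots> = real (Suc n choose k) * real n ^ k * (real (Suc n - k) / real (Suc n))"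
    using absorb by (simp add: field_simps)
  finally have le: "real (n choose k) * real (Suc n) ^ k \<le> real (Suc n choose k) * real n ^ k"
    using n by (subst (asm) mult_le_cancel_right_pos) auto
  have "real n ^ k * (real (m choose k) * real (Suc n) ^ k) \<le> real (Suc n) ^ k * (real (n choose k) * real m ^ k)"
    using mult_left_mono[OF step.IH, of "real (Suc n) ^ k"] by (simp add: mult_ac)
  also have "\<dots> \<le> real n ^ k * (real (Suc n choose k) * real m ^ k)"
    using mult_right_mono[OF le, of "real m ^ k"] by (simp add: mult_ac)
  finally show ?case using n by (subst (asm) mult_le_cancel_left_pos) auto
qed simp

text \<open>The ratio of the binomial coefficient to \<open>n ^ k\<close> is nondecreasing in
  \<open>n\<close>, so it is estimated at \<open>n = 2 * k\<close>, where the central binomial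
  coefficient is at least 4^k / (2k).\<close>

lemma binomial_lower_bound:
  fixes k n :: nat
  assumes "k \<ge> 1" "2 * k \<le> n"
  shows "(2 * real n) ^ k \<le> 2 * real k * real (n choose k) * real k ^ k"
proof -
  have "4 ^ k \<le> 2 * real k * real ((2 * k) choose k)"
    using central_binomial_lower_bound[of k] assms by (simp only: pos_divide_le_eq mult.commute[of "2 * real k"])
  hence "4 ^ k * real n ^ k \<le> 2 * real k * (real ((2 * k) choose k) * real n ^ k)"
    unfolding mult.assoc[symmetric] by (rule mult_right_mono) simp
  also have "\<dots> \<le> 2 * real k * (real (n choose k) * real (2 * k) ^ k)"
    using assms by (intro mult_left_mono binomial_over_power_mono) auto
  also have "real (2 * k) ^ k = 2 ^ k * real k ^ k"
    by (simp add: power_mult_distrib)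
  also have "2 * real k * (real (n choose k) * (2 ^ k * real k ^ k)) =
      2 ^ k * (2 * real k * real (n choose k) * real k ^ k)"
    by (simp only: mult_ac)
  also have "4 ^ k * real n ^ k = 2 ^ k * (2 * real n) ^ k"
    unfolding power_mult_distrib[symmetric] by simp
  finally show ?thesis by (subst (asm) mult_le_cancel_left_pos) auto
qed

lemma binomial_eq_prod_prime_powers:
  fixes n k :: nat
  assumes "k \<le> n"
  shows "(n choose k) = (\<Prod>p\<in>prime_factors (n choose k). p ^ multiplicity p (n choose k))"
  using prod_prime_factors[of "n choose k"] assms by simp

lemma binomial_le_power_prime_count:
  fixes n k z :: nat
  assumes "k \<le> n" "n > 0" and small: "\<And>p. prime p \<Longrightarrow> p dvd (n choose k) \<Longrightarrow> p \<le> z"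
  shows "(n choose k) \<le> n ^ prime_count z"
proof -
  have "(n choose k) = (\<Prod>p\<in>prime_factors (n choose k). p ^ multiplicity p (n choose k))"
    by (rule binomial_eq_prod_prime_powers) fact
  also have "\<dots> \<le> (\<Prod>p\<in>prime_factors (n choose k). n)"
    using assms by (intro prod_mono) (auto intro!: prime_power_binomial_le)
  also have "\<dots> = n ^ card (prime_factors (n choose k))" by simp
  also have "\<dots> \<le> n ^ prime_count z"
    unfolding prime_count_def using assms
    by (intro power_increasing card_mono) (auto intro: small)
  finally show ?thesis .
qed

text \<open>Primes up to \<open>w\<close> contribute at most \<open>n\<close> each. A larger prime
  has square above \<open>n\<close>, so it occurs at most once, and those in (n/3, k] cancel; the
  survivors divide the primorial.\<close>

lemma binomial_le_primorial:
  fixes n k w :: nat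
  assumes "2 * k \<le> n" "n < (w + 1) ^ 2" "n > 0"
    and small: "\<And>p. prime p \<Longrightarrow> p dvd (n choose k) \<Longrightarrow> p \<le> k"
  shows "(n choose k) \<le> n ^ prime_count w * primorial (min k (n div 3))"
proof -
  let ?P = "prime_factors (n choose k)" and ?f = "\<lambda>p. p ^ multiplicity p (n choose k)"
  let ?A = "{p. prime p \<and> p \<le> w}" and ?B = "{p. prime p \<and> p \<le> min k (n div 3)}"
  have B: "?P - ?A \<subseteq> ?B"
  proof
    fix p assume p: "p \<in> ?P - ?A"
    hence p': "prime p" "p dvd (n choose k)" "p \<ge> w + 1" by auto
    have "n < p ^ 2"
      using assms(2) p'(3) power_mono[of "w + 1" p 2] by linarith
    have "p \<le> k" using small p' by auto
    moreover have "multiplicity p (n choose k) > 0"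
      using p' assms(1) by (simp add: prime_multiplicity_gt_zero_iff)
    hence "\<not> n < 3 * p"
      using multiplicity_binomial_eq_0[of p n k] \<open>n < p ^ 2\<close> \<open>p \<le> k\<close> p' assms(1) by auto
    ultimately show "p \<in> ?B" using p' by (simp add: less_eq_div_iff_mult_less_eq)
  qed
  have "(n choose k) = (\<Prod>p\<in>?P. ?f p)"
    using assms by (intro binomial_eq_prod_prime_powers) auto
  also have "\<dots> = (\<Prod>p\<in>?P \<inter> ?A. ?f p) * (\<Prod>p\<in>?P - ?A. ?f p)"
    by (subst prod.union_disjoint[symmetric]) (auto simp: Int_Un_distrib Un_Diff_Int intro!: prod.cong)
  also have "\<dots> \<le> (\<Prod>p\<in>?P \<inter> ?A. n) * (\<Prod>p\<in>?P - ?A. p)"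
  proof (intro mult_mono prod_mono conjI)
    fix p assume p: "p \<in> ?P - ?A"
    hence "w + 1 \<le> p" by (auto simp: not_le)
    hence "n < p ^ 2"
      using assms(2) power_mono[of "w + 1" p 2] by linarith
    hence "multiplicity p (n choose k) \<le> 1"
      using p assms(1) by (intro multiplicity_binomial_le_1) auto
    moreover have "p > 0" using p by (auto intro: prime_gt_0_nat)
    ultimately show "?f p \<le> p" using power_increasing[of "multiplicity p (n choose k)" 1 p] by simp
  qed (use assms in \<open>auto intro!: prime_power_binomial_le\<close>)
  also have "(\<Prod>p\<in>?P \<inter> ?A. n) \<le> n ^ prime_count w"
    unfolding prime_count_def prod_constant using assms
    by (intro power_increasing card_mono) auto
  also have "(\<Prod>p\<in>?P - ?A. p) \<le> primorial (min k (n div 3))"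
    unfolding primorial_def
    by (rule dvd_imp_le[OF prod_dvd_prod_subset[OF _ B]]) (auto intro!: prod_pos prime_gt_0_nat)
  finally show ?thesis by simp
qed

text \<open>Some j among n - k + 1, ..., n is divisible by \<open>p\<close>, and n - j < k < p is
  then the remainder of \<open>n\<close>.\<close>

lemma mod_less_of_dvd_binomial:
  fixes p n k :: nat
  assumes "prime p" "k \<le> n" "k < p" "p dvd (n choose k)"
  shows "n mod p < k"
proof -
  have "p dvd fact k * (n choose k)" using assms by simp
  also have "fact k * (n choose k) * fact (n - k) = (fact n :: nat)"
    using binomial_fact_lemma[OF assms(2)] by (simp add: mult_ac)
  hence "fact k * (n choose k) = fact n div (fact (n - k) :: nat)"
    by (metis fact_nonzero nonzero_mult_div_cancel_right)
  also have "\<dots> = \<Prod>{n - k + 1..n}" by (rule fact_div_fact) simp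
  finally obtain j where j: "j \<in> {n - k + 1..n}" "p dvd j"
    using assms(1) by (auto simp: prime_dvd_prod_iff)
  then obtain c where c: "j = p * c" by auto
  have "n = p * c + (n - j)" "n - j < k" using j c by auto
  hence "n mod p = n - j" using assms(3) by (metis mod_mult_self2 mod_less less_trans add.commute)
  thus ?thesis using \<open>n - j < k\<close> by simp
qed

section \<open>Elementary estimates for logarithms\<close>

lemma ln_lower: "x > 0 \<Longrightarrow> ln (x::real) \<ge> 1 - 1 / x"
  using ln_le_minus_one[of "1 / x"] by (simp add: ln_div)

text \<open>The function b ln(N/b) increases up to b = N/e; the hypothesis
  \<open>4 * b \<le> N\<close> stays inside this range because ln 4 >= 1.\<close>

lemma mult_ln_div_mono:
  fixes a b N :: real
  assumes "0 < a" "a \<le> b" "4 * b \<le> N"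
  shows "a * ln (N / a) \<le> b * ln (N / b)"
proof -
  have "ln (N / b) \<ge> ln 4" using assms by (subst ln_le_cancel_iff) (auto simp: field_simps)
  moreover have "ln (4::real) = 2 * ln 2" using ln_realpow[of 2 2] by simp
  moreover have "ln (2::real) \<ge> 1 - 1 / 2" using ln_lower[of 2] by simp
  ultimately have 1: "ln (N / b) \<ge> 1" by linarith
  have "a * ln (b / a) \<le> a * (b / a - 1)"
    using assms by (intro mult_left_mono ln_le_minus_one) auto
  also have "\<dots> = b - a" using assms by (simp add: field_simps)
  finally have 2: "a * ln (b / a) \<le> b - a" .
  have "(b - a) * ln (N / b) \<ge> b - a" using mult_left_mono[OF 1, of "b - a"] assms by simp
  moreover have "ln (N / a) = ln (N / b) + ln (b / a)"
    using assms by (simp add: ln_div)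
  ultimately show ?thesis using 2 by (simp add: algebra_simps)
qed

lemma ln_2_le: "ln (2::real) \<le> 709 / 1000"
proof -
  have "ln (2::real) \<le> ln ((1 + 709 / 16000) ^ 16)"
    by (subst ln_le_cancel_iff) (simp_all add: power_divide)
  also have "\<dots> = 16 * ln (1 + 709 / 16000)" by (subst ln_realpow) auto
  also have "\<dots> \<le> 16 * (709 / 16000)" by (intro mult_left_mono ln_add_one_self_le_self) auto
  finally show ?thesis by simp
qed

text \<open>This is the tangent of the logarithm at 64 = 2^6, a point near the smallest relevant
  value 72; the constant is 6 * 0.709 - 1.\<close>

lemma ln_le_linear: "x > 0 \<Longrightarrow> ln (x::real) \<le> x / 64 + 3254 / 1000"
proof -
  assume x: "x > 0"
  have "ln x = ln (x / 64) + 6 * ln 2"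
    using x ln_realpow[of "2::real" 6] by (simp add: ln_div)
  thus ?thesis using ln_le_minus_one[of "x / 64"] ln_2_le x by simp
qed

text \<open>Compares the logarithms of the lower bound \<open>(2n/k)\<^sup>k / (2k)\<close> of the binomial coefficient
  and of its upper bound when it has no prime factor above \<open>k\<close>.\<close>
lemma log_binomial_bounds_incompatible:
  fixes m k n :: real
  assumes m: "m \<ge> 72" and n: "n = m ^ 2 - 1" and k: "m \<le> k" "2 * k \<le> n"
  shows "(m / 2 + 8) * ln m + min k (n / 3) * ln 4 < k * ln (2 * n / k)"
proof -
  have n0: "n > 0" "n \<ge> 0.98 * m ^ 2"
    using m n mult_mono[of 72 m 72 m] by (auto simp: power2_eq_square)
  have k0: "k > 0" using m k by simp
  have ln4: "ln (4::real) \<ge> 1"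
    using ln_lower[of 2] ln_realpow[of "2::real" 2] by simp
  have lnm: "0 \<le> ln m" using m by simp
  have quad: "(m / 2 + 8) * ln m < n / 24"
  proof -
    have "(m / 2 + 8) * ln m \<le> (m / 2 + 8) * (m / 64 + 3254 / 1000)"
      using m by (intro mult_left_mono ln_le_linear) auto
    also have "\<dots> < n / 24"
    proof -
      have "72 * m \<le> m * m" using m by (intro mult_right_mono) auto
      moreover have "(m / 2 + 8) * (m / 64 + 3254 / 1000) = m * m / 128 + 1752 / 1000 * m + 3254 / 125"
        by (simp add: field_simps)
      moreover have "n = m * m - 1" unfolding n power2_eq_square ..
      ultimately show ?thesis using m by linarith
    qed
    finally show ?thesis .
  qed
  have ln32: "ln (3 / 2 :: real) \<ge> 1 / 3" using ln_lower[of "3/2"] by simp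
  have ln_split: "ln (n / 2 / k) = ln (2 * n / k) - ln 4"
    using ln_mult_pos[of 4 "n / 2 / k"] n0 k0 by simp
  \<comment> \<open>Taking k ln 4 away leaves k ln(n/(2k)). Up to n/8 this is increasing in k and
    compared with its value at m; between n/8 and n/3 it is at least k/3 > n/24. Beyond n/3 the
    minimum is n/3, and k ln(2n/k) is compared with its value there.\<close>
  consider "k \<le> n / 8" | "n / 8 < k" "k \<le> n / 3" | "n / 3 < k" by linarith
  thus ?thesis
  proof cases
    case 1
    have "49 / 100 * m \<le> n / 2 / m" using n0 m by (simp add: field_simps power2_eq_square)
    hence "ln (49 / 100 * m) \<le> ln (n / 2 / m)" using m n0 by (subst ln_le_cancel_iff) auto
    moreover have "ln (49 / 100 * m) = ln (49 / 100) + ln m" using m by (subst ln_mult) auto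
    moreover have "ln (49 / 100 :: real) \<ge> - 105 / 100" using ln_lower[of "49/100"] by simp
    ultimately have "m * (ln m - 105 / 100) \<le> m * ln (n / 2 / m)"
      using m by (intro mult_left_mono) auto
    also have "\<dots> \<le> k * ln (n / 2 / k)"
      using m k 1 by (intro mult_ln_div_mono) auto
    also note ln_split
    finally have "m * (ln m - 105 / 100) + k * ln 4 \<le> k * ln (2 * n / k)"
      by (simp add: algebra_simps)
    moreover have "(m / 2 + 8) * ln m < m * (ln m - 105 / 100)"
    proof -
      have "ln 64 \<le> ln m" using m by simp
      hence "3 \<le> ln m" using ln_lower[of 2] ln_realpow[of "2::real" 6] by simp
      hence "(m / 2 - 8) * 3 \<le> (m / 2 - 8) * ln m" using m by (intro mult_left_mono) auto
      thus ?thesis using m by (simp add: algebra_simps)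
    qed
    moreover have "min k (n / 3) * ln 4 \<le> k * ln 4" using ln4 by (intro mult_right_mono) auto
    ultimately show ?thesis by linarith
  next
    case 2
    have "ln (3 / 2) \<le> ln (n / 2 / k)"
      using 2 n0 k0 by (subst ln_le_cancel_iff) (auto simp: field_simps)
    hence "k * (1 / 3) \<le> k * ln (n / 2 / k)" using ln32 k0 by (intro mult_left_mono) auto
    also note ln_split
    finally have "k / 3 + k * ln 4 \<le> k * ln (2 * n / k)"
      by (simp add: algebra_simps)
    moreover have "min k (n / 3) * ln 4 \<le> k * ln 4" using ln4 by (intro mult_right_mono) auto
    ultimately show ?thesis using quad 2 by linarith
  next
    case 3
    have "n / 3 * ln (2 * n / (n / 3)) \<le> k * ln (2 * n / k)"
      using 3 k n0 by (intro mult_ln_div_mono) auto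
    also have "2 * n / (n / 3) = 4 * (3 / 2)" using n0 by simp
    also have "ln (4 * (3 / 2 :: real)) = ln 4 + ln (3 / 2)" by (rule ln_mult_pos) auto
    finally have "n / 3 * ln 4 + n / 3 * ln (3 / 2) \<le> k * ln (2 * n / k)"
      by (simp add: algebra_simps)
    moreover have "n / 3 * (1 / 3) \<le> n / 3 * ln (3 / 2)" using ln32 n0 by (intro mult_left_mono) auto
    moreover have "min k (n / 3) * ln 4 \<le> n / 3 * ln 4" using ln4 by (intro mult_right_mono) auto
    ultimately show ?thesis using quad n0 by linarith
  qed
qed

section \<open>A suitable prime for every pair \<open>n\<close>, \<open>k\<close>\<close>

definition good_prime :: "nat \<Rightarrow> nat \<Rightarrow> nat \<Rightarrow> bool" where
  "good_prime n k p \<longleftrightarrow> prime p \<and> 3 \<le> p \<and> n mod p < k \<and> (2 * k < p \<or> k < p \<and> n < p ^ 2)"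

text \<open>Trial division by the primes up to 71 certifies primality below 73^2 = 5329, which
  exceeds every prime in \<open>covering_primes\<close>.\<close>

definition no_prime_divisor_below_73 :: "nat \<Rightarrow> bool" where
  "no_prime_divisor_below_73 p \<longleftrightarrow> 1 < p \<and> p < 5329 \<and>
     list_all (\<lambda>d. d = p \<or> \<not> d dvd p)
       [2,3,5,7,11,13,17,19,23,29,31,37,41,43,47,53,59,61,67,71]"

lemma prime_of_no_prime_divisor_below_73:
  assumes "no_prime_divisor_below_73 p"
  shows "prime p"
proof (rule ccontr)
  assume np: "\<not> prime p"
  have p: "1 < p" "p < 5329" using assms by (simp_all add: no_prime_divisor_below_73_def)
  then obtain d where d: "d dvd p" "d \<noteq> 1" "d \<noteq> p"
    using np by (auto simp: prime_nat_iff)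
  then obtain e where e: "p = d * e" by (auto elim: dvdE)
  have e1: "e \<noteq> 1" using d e by auto
  have e2: "e \<noteq> p"
  proof
    assume "e = p"
    hence "p = d * p" using e by simp
    hence "d = 1" using p(1) by simp
    thus False using d by simp
  qed
  have "d < 73 \<or> e < 73" using e p mult_mono[of 73 d 73 e] by linarith
  then obtain c where c: "c dvd p" "c \<noteq> 1" "c \<noteq> p" "c < 73"
    using d e e1 e2 by (metis dvd_triv_left dvd_triv_right)
  obtain q where q: "prime q" "q dvd c" using prime_factor_nat[OF c(2)] by blast
  have "c > 0" using c(1) p by (intro Nat.gr0I) auto
  hence q_le: "q \<le> c" using q(2) by (rule dvd_imp_le[rotated])
  hence "q \<in> set (primes_below_120 @ primes_120_331)"
    using q(1) c(4) by (intro prime_in_primes_below_331) auto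
  hence "q \<in> set [2,3,5,7,11,13,17,19,23,29,31,37,41,43,47,53,59,61,67,71]"
    using q_le c(4) by (auto simp: primes_below_331_defs)
  hence "q = p \<or> \<not> q dvd p"
    using assms unfolding no_prime_divisor_below_73_def list_all_iff by blast
  moreover have "q dvd p" using q(2) c(1) by (rule dvd_trans)
  moreover have "c < p" using c(1,3) p by (auto dest: dvd_imp_le)
  ultimately show False using q_le by simp
qed

text \<open>The primes in the list are meant to cover, one after the other, consecutive ranges of \<open>k\<close>
  starting at \<open>lo\<close>.\<close>
fun covered_by_primes :: "nat \<Rightarrow> nat \<Rightarrow> nat list \<Rightarrow> bool" where
  "covered_by_primes m lo [] \<longleftrightarrow> m ^ 2 - 1 < 2 * lo"
| "covered_by_primes m lo (p # ps) \<longleftrightarrow> no_prime_divisor_below_73 p \<and> 3 \<le> p \<and> (m ^ 2 - 1) mod p < lo \<and>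
     covered_by_primes m (if m \<le> p then p else (p + 1) div 2) ps"

lemma good_prime_of_covered_by_primes:
  assumes "covered_by_primes m lo ps" "n + 1 = m ^ 2" "lo \<le> k" "2 * k \<le> n"
  shows "\<exists>p. good_prime n k p"
  using assms(1,3)
proof (induction ps arbitrary: lo)
  case Nil
  thus ?case using assms by simp
next
  case (Cons p ps)
  have n: "m ^ 2 - 1 = n" using assms(2) by simp
  \<comment> \<open>A prime \<open>p \<ge> m\<close> satisfies \<open>n < p ^ 2\<close> and serves
    every \<open>k < p\<close>; a smaller one serves only \<open>2 * k < p\<close>, which for odd
    \<open>p\<close> is \<open>k < (p + 1) div 2\<close>.\<close>
  let ?hi = "if m \<le> p then p else (p + 1) div 2"
  show ?case
  proof (cases "k < ?hi")
    case True
    have "n < p ^ 2" if "m \<le> p"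
      using power_mono[OF that, of 2] assms(2) by linarith
    moreover have "n mod p < lo"
      using Cons.prems(1) unfolding covered_by_primes.simps n by blast
    moreover have "prime p"
      using Cons.prems by (auto intro: prime_of_no_prime_divisor_below_73)
    ultimately have "good_prime n k p"
      using True Cons.prems unfolding good_prime_def by (auto split: if_splits)
    thus ?thesis by blast
  next
    case False
    thus ?thesis using Cons.prems by (intro Cons.IH[of ?hi]) auto
  qed
qed

definition covering_primes :: "(nat \<times> nat list) list" where
  "covering_primes = [
    (2, [3]), (3, [7]), (4, [5, 13]), (5, [3, 23]), (6, [7, 31]), (7, [3, 47]), (8, [7, 61]),
    (9, [5, 79]), (10, [11, 97]), (11, [5, 59, 113]), (12, [13, 139]), (13, [7, 167]),
    (14, [13, 193]), (15, [7, 223]), (16, [17, 251]), (17, [3, 41, 283]), (18, [19, 317]),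
    (19, [5, 359]), (20, [19, 397]), (21, [11, 439]), (22, [23, 479]), (23, [11, 523]),
    (24, [23, 571]), (25, [13, 619]), (26, [5, 673]), (27, [13, 727]), (28, [29, 773]),
    (29, [7, 839]), (30, [31, 887]), (31, [5, 479, 953]), (32, [31, 1021]), (33, [17, 1087]),
    (34, [11, 1153]), (35, [17, 1223]), (36, [37, 1291]), (37, [19, 1367]), (38, [37, 1439]),
    (39, [19, 1511]), (40, [41, 1597]), (41, [7, 839, 1669]), (42, [43, 1759]), (43, [11, 1847]),
    (44, [43, 1933]), (45, [23, 2017]), (46, [47, 2113]), (47, [23, 2207]), (48, [47, 2297]),
    (49, [5, 2399]), (50, [17, 1249, 2477]), (51, [13, 1297, 2593]), (52, [53, 2699]),
    (53, [13, 2803]), (54, [53, 2909]), (55, [7, 3023]), (56, [19, 1567, 3121]),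
    (57, [29, 1621, 3229]), (58, [59, 3361]), (59, [29, 3469]), (60, [61, 3593]),
    (61, [31, 3719]), (62, [61, 3833]), (63, [31, 3967]), (64, [13, 4093]), (65, [11, 4219]),
    (66, [67, 4349]), (67, [17, 4483]), (68, [67, 4621]), (69, [17, 4759]), (70, [71, 4889]),
    (71, [7, 5039])]"

text \<open>The start 2 for \<open>m = 3\<close> reflects the exception n = 8, k = 1: a good prime
  for k = 1 is an odd prime divisor of n, and 8 has none.\<close>

lemma covering_primes_correct:
  "list_all (\<lambda>(m, ps). covered_by_primes m (if m = 3 then 2 else 1) ps) covering_primes"
  by (simp add: covering_primes_def no_prime_divisor_below_73_def)

lemma good_prime_small:
  assumes "n + 1 = m ^ 2" "2 \<le> m" "m < 72" "1 \<le> k" "2 * k \<le> n" "\<not> (n = 8 \<and> k = 1)"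
  shows "\<exists>p. good_prime n k p"
proof -
  have "map fst covering_primes = [2..<72]" by (simp add: covering_primes_def)
  moreover have "m \<in> set [2..<72]" using assms by (simp only: set_upt atLeastLessThan_iff)
  ultimately have "m \<in> fst ` set covering_primes" by (metis set_map)
  then obtain ps where "(m, ps) \<in> set covering_primes" by auto
  hence "covered_by_primes m (if m = 3 then 2 else 1) ps"
    using covering_primes_correct by (auto simp: list_all_iff)
  moreover have "(if m = 3 then 2 else 1) \<le> k" using assms by auto
  ultimately show ?thesis using assms by (intro good_prime_of_covered_by_primes) auto
qed

section \<open>Small k: prime divisors of n, n - 1 and n - 2\<close>

lemma odd_prime_divisor:
  fixes x :: nat
  assumes "odd x" "x > 1"
  obtains p where "prime p" "p dvd x" "p \<ge> 3"
proof -
  obtain p where p: "prime p" "p dvd x" using assms prime_factor_nat[of x] by auto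
  moreover have "p \<noteq> 2" using p assms by auto
  moreover have "p \<ge> 2" using p prime_ge_2_nat by blast
  ultimately show ?thesis by (intro that) auto
qed

text \<open>Any odd prime divisor of \<open>n\<close> works. For m = 2j + 1 one comes from the odd
  number among j and j + 1, both above 1 because m >= 4.\<close>

lemma good_prime_k1:
  assumes "n + 1 = m ^ 2" "m \<ge> 4"
  shows "\<exists>p. good_prime n 1 p"
proof -
  have "\<exists>x. odd x \<and> x > 1 \<and> x dvd n"
  proof (cases "even m")
    case True
    hence "even (n + 1)" using assms by simp
    moreover have "n + 1 \<ge> 4 ^ 2" unfolding assms(1) using assms(2) by (rule power_mono) simp
    ultimately show ?thesis by (intro exI[of _ n]) auto
  next
    case False
    then obtain j where j: "m = 2 * j + 1" by (auto elim: oddE)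
    have n: "n = 4 * (j * (j + 1))" using assms(1) unfolding j by (simp add: power2_eq_square algebra_simps)
    have "j dvd n" unfolding n by simp
    moreover have "j + 1 dvd n" unfolding n by (simp only: dvd_triv_right dvd_mult)
    moreover have "odd j \<or> odd (j + 1)" "j > 1" using j assms(2) by auto
    ultimately show ?thesis by (metis less_add_one less_trans)
  qed
  then obtain x where x: "odd x" "x > 1" "x dvd n" by blast
  then obtain p where "prime p" "p dvd x" "p \<ge> 3" using odd_prime_divisor by blast
  moreover from this have "n mod p = 0" using x(3) by (meson dvd_trans dvd_imp_mod_0)
  ultimately show ?thesis unfolding good_prime_def by auto
qed

text \<open>An odd prime divisor of n - 1 = m^2 - 2 is wanted above 4; it is not 3 because 2 is not
  a square modulo 3. For even m half of n - 1 is odd.\<close>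

lemma good_prime_k2:
  assumes "n + 1 = m ^ 2" "m \<ge> 4"
  shows "\<exists>p. good_prime n 2 p"
proof -
  have m4: "m * m \<ge> 4 * 4" using assms(2) by (intro mult_mono) auto
  have n: "n = m * m - 1" using assms(1) by (simp add: power2_eq_square)
  have "\<exists>x. odd x \<and> x > 1 \<and> x dvd n - 1"
  proof (cases "even m")
    case True
    then obtain j where j: "m = 2 * j" by auto
    have jj: "j * j \<ge> 2 * 2" using j assms(2) by (intro mult_mono) auto
    then obtain i where i: "j * j = Suc i" by (cases "j * j") auto
    have "n = 4 * (j * j) - 1" using n j by simp
    hence "n - 1 = 2 * Suc (2 * i)" unfolding i by simp
    hence "Suc (2 * i) dvd n - 1" by (simp only: dvd_triv_right)
    thus ?thesis using i jj by (intro exI[of _ "Suc (2 * i)"] conjI) auto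
  next
    case False
    thus ?thesis using n m4 by (intro exI[of _ "n - 1"]) auto
  qed
  then obtain x where x: "odd x" "x > 1" "x dvd n - 1" by blast
  then obtain p where p: "prime p" "p dvd x" "p \<ge> 3" using odd_prime_divisor by blast
  have "p dvd n - 1" using p x dvd_trans by blast
  then obtain c where "n - 1 = p * c" by (rule dvdE)
  hence c: "n = p * c + 1" using n m4 by linarith
  have "p \<noteq> 3"
  proof
    assume "p = 3"
    hence "m * m = 3 * c + 2" using c assms(1) by (simp add: power2_eq_square)
    hence "((m mod 3) * (m mod 3)) mod 3 = 2 mod 3" unfolding mod_mult_eq by (simp only: mod_mult_self4)
    moreover have "m mod 3 = 0 \<or> m mod 3 = 1 \<or> m mod 3 = 2" by linarith
    ultimately show False by auto
  qed
  moreover have "p \<noteq> 4" using p(1) by auto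
  moreover have "n mod p = 1 mod p" unfolding c by (simp only: mod_mult_self4)
  ultimately show ?thesis using p(1,3) unfolding good_prime_def by (intro exI[of _ p]) simp
qed

text \<open>A prime divisor of n - 2 = m^2 - 3 is wanted above 10 = 2 * 5. Residues of squares
  modulo 5, 7, 4 and 9 exclude 5 and 7 and allow 2 and 3 at most once, so after division by
  \<open>gcd x 6\<close> only primes from 11 on are left.\<close>

lemma good_prime_k345:
  assumes "n + 1 = m ^ 2" "m \<ge> 4" "3 \<le> k" "k \<le> 5"
  shows "\<exists>p. good_prime n k p"
proof -
  have m4: "m * m \<ge> 4 * 4" using assms(2) by (intro mult_mono) auto
  have n: "n = m * m - 1" using assms(1) by (simp add: power2_eq_square)
  define x where "x = n - 2"
  have x: "m * m = x + 3" "x \<ge> 13" using n m4 by (auto simp: x_def)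
  have sq: "(x + 3) mod q = ((m mod q) * (m mod q)) mod q" for q
    unfolding x(1)[symmetric] by (rule mod_mult_eq[symmetric])
  have "m mod 4 \<in> {0, 1, 2, 3}" by auto
  hence "(x + 3) mod 4 = 0 \<or> (x + 3) mod 4 = 1" unfolding sq by auto
  hence n4: "\<not> 4 dvd x" by presburger
  have "m mod 9 \<in> {0, 1, 2, 3, 4, 5, 6, 7, 8}" by auto
  hence "(x + 3) mod 9 = 0 \<or> (x + 3) mod 9 = 1 \<or> (x + 3) mod 9 = 4 \<or> (x + 3) mod 9 = 7" unfolding sq by auto
  hence n9: "\<not> 9 dvd x" by presburger
  have "m mod 5 \<in> {0, 1, 2, 3, 4}" by auto
  hence "(x + 3) mod 5 = 0 \<or> (x + 3) mod 5 = 1 \<or> (x + 3) mod 5 = 4" unfolding sq by auto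
  hence n5: "\<not> 5 dvd x" by presburger
  have "m mod 7 \<in> {0, 1, 2, 3, 4, 5, 6}" by auto
  hence "(x + 3) mod 7 = 0 \<or> (x + 3) mod 7 = 1 \<or> (x + 3) mod 7 = 2 \<or> (x + 3) mod 7 = 4" unfolding sq by auto
  hence n7: "\<not> 7 dvd x" by presburger
  obtain y where y: "x = gcd x 6 * y" using gcd_dvd1 by (rule dvdE)
  have "gcd x 6 \<le> 6" by (rule dvd_imp_le) auto
  have "y \<noteq> 1"
  proof
    assume "y = 1"
    hence "x = gcd x 6" using y by simp
    thus False using \<open>gcd x 6 \<le> 6\<close> x(2) by linarith
  qed
  then obtain p where p: "prime p" "p dvd y" using prime_factor_nat by blast
  have px: "p dvd x" using p y by (metis dvd_mult)
  have "p \<noteq> 2"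
  proof
    assume "p = 2"
    hence "2 dvd gcd x 6" "2 dvd y" using px p by auto
    hence "2 * 2 dvd gcd x 6 * y" by (rule mult_dvd_mono)
    thus False using n4 y by simp
  qed
  moreover have "p \<noteq> 3"
  proof
    assume "p = 3"
    hence "3 dvd gcd x 6" "3 dvd y" using px p by auto
    hence "3 * 3 dvd gcd x 6 * y" by (rule mult_dvd_mono)
    thus False using n9 y by simp
  qed
  moreover have "p \<notin> {0, 1, 4, 6, 8, 9, 10}" using p(1) by auto
  moreover have "p \<noteq> 5" "p \<noteq> 7" using n5 n7 px by auto
  ultimately have "p \<ge> 11" by (simp add: numeral_eq_Suc) presburger
  moreover obtain c where "x = p * c" using px by (rule dvdE)
  hence "n = p * c + 2" using x_def x(2) by simp
  hence "n mod p = 2 mod p" by (simp only: mod_mult_self4)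
  hence "n mod p = 2" using \<open>p \<ge> 11\<close> by simp
  ultimately show ?thesis using p(1) assms(3,4) unfolding good_prime_def by (intro exI[of _ p]) auto
qed

section \<open>Large n: counting the prime factors of the binomial coefficient\<close>

lemma fact_mult_binomial_ge:
  fixes n k :: nat
  assumes "k \<le> n"
  shows "(n - k + 1) ^ k \<le> fact k * (n choose k)"
proof -
  have "fact k * (n choose k) * fact (n - k) = (fact n :: nat)"
    using binomial_fact_lemma[OF assms] by (simp add: mult_ac)
  hence "fact k * (n choose k) = fact n div (fact (n - k) :: nat)"
    by (metis fact_nonzero nonzero_mult_div_cancel_right)
  also have "\<dots> = \<Prod>{n - k + 1..n}" by (rule fact_div_fact) simp
  also have "\<dots> \<ge> (\<Prod>i\<in>{n - k + 1..n}. n - k + 1)" by (rule prod_mono) auto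
  finally show ?thesis using assms by simp
qed

text \<open>Here 5183 = 72^2 - 1 and 5125 = 5184 - 59, a lower bound of 5184 - k. The induction goes
  in steps of two, for which the exponent \<open>(2 * k + 13) div 4\<close> grows by exactly
  one.\<close>

lemma fact_mult_power_less:
  "9 \<le> k \<Longrightarrow> k < 60 \<Longrightarrow> fact k * 5183 ^ ((2 * k + 13) div 4) < (5125 :: nat) ^ k"
proof (induction k rule: less_induct)
  case (less k)
  show ?case
  proof (cases "k \<le> 10")
    case True
    hence "k = 9 \<or> k = 10" using less.prems by linarith
    thus ?thesis by (auto simp: fact_numeral)
  next
    case False
    then obtain j where j: "k = Suc (Suc j)" "9 \<le> j"
      using less.prems by (intro that[of "k - 2"]) auto
    have "(fact k :: nat) = (Suc (Suc j) * Suc j) * fact j"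
      unfolding j by (simp only: fact_Suc of_nat_id mult.assoc)
    moreover have "(2 * k + 13) div 4 = Suc ((2 * j + 13) div 4)" unfolding j by simp
    ultimately have "fact k * (5183::nat) ^ ((2 * k + 13) div 4) =
        (Suc (Suc j) * Suc j * 5183) * (fact j * 5183 ^ ((2 * j + 13) div 4))"
      by (simp only: power_Suc mult_ac)
    also have "\<dots> \<le> (59 * 59 * 5183) * (fact j * 5183 ^ ((2 * j + 13) div 4))"
      using j less.prems by (intro mult_right_mono mult_mono) auto
    also have "\<dots> < (59 * 59 * 5183) * 5125 ^ j"
      using j less.prems by (intro mult_strict_left_mono less.IH) auto
    also have "\<dots> \<le> (5125 * 5125) * 5125 ^ j" by (intro mult_right_mono) auto
    also have "\<dots> = 5125 ^ k" unfolding j by simp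
    finally show ?thesis .
  qed
qed

text \<open>The general bound for \<open>prime_count\<close> is one too large at k = 6 and k = 8, so
  the exact counts 5 and 6 of the primes up to 12 and 16 are used there.\<close>

lemma power_prime_count_lt_binomial_5183:
  assumes "6 \<le> k" "k < 60"
  shows "5183 ^ prime_count (2 * k) < (5183 choose k)"
proof -
  have "fact k * 5183 ^ prime_count (2 * k) < (5184 - k) ^ k"
  proof (cases "k = 6 \<or> k = 8")
    case True
    have "prime_count 12 \<le> 5"
      using prime_count_le_length[of 12] by (simp add: primes_below_331_defs)
    hence 1: "(5183::nat) ^ prime_count 12 \<le> 5183 ^ 5"
      by (rule power_increasing) simp
    have "prime_count 16 \<le> 6"
      using prime_count_le_length[of 16] by (simp add: primes_below_331_defs)
    hence 2: "(5183::nat) ^ prime_count 16 \<le> 5183 ^ 6"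
      by (rule power_increasing) simp
    show ?thesis using True 1 2 by (auto simp: fact_numeral)
  next
    case False
    have "fact k * 5183 ^ ((2 * k + 13) div 4) < (5184 - k) ^ k"
    proof (cases "k = 7")
      case True
      thus ?thesis by (simp add: fact_numeral)
    next
      case False
      hence "fact k * 5183 ^ ((2 * k + 13) div 4) < (5125 :: nat) ^ k"
        using assms \<open>\<not> (k = 6 \<or> k = 8)\<close> by (intro fact_mult_power_less) auto
      also have "5125 ^ k \<le> (5184 - k) ^ k" using assms by (intro power_mono) auto
      finally show ?thesis .
    qed
    moreover have "prime_count (2 * k) \<le> (2 * k + 13) div 4"
      using prime_count_le[of "2 * k"] by linarith
    hence "(5183::nat) ^ prime_count (2 * k) \<le> 5183 ^ ((2 * k + 13) div 4)"
      by (intro power_increasing) auto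
    ultimately show ?thesis by (meson le_less_trans mult_le_mono2)
  qed
  also have "(5184 - k) ^ k \<le> fact k * (5183 choose k)"
  proof -
    have "5184 - k = 5183 - k + 1" using assms by simp
    thus ?thesis using fact_mult_binomial_ge[of k 5183] assms by (simp only:)
  qed
  finally show ?thesis by (simp only: mult_less_cancel1)
qed

lemma good_prime_large:
  assumes nm: "n + 1 = m ^ 2" and m: "72 \<le> m" and k: "6 \<le> k" "2 * k \<le> n"
  shows "\<exists>p. good_prime n k p"
proof (rule ccontr)
  assume "\<nexists>p. good_prime n k p"
  hence notgood: "\<not> good_prime n k p" for p by blast
  have "m ^ 2 \<ge> 72 ^ 2" using m by (rule power_mono) simp
  hence n: "n \<ge> 5183" using nm by simp
  \<comment> \<open>A prime above \<open>k\<close> dividing the binomial coefficient has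
    \<open>n mod p < k\<close>, so it can only fail to be good by violating both
    alternatives.\<close>
  have div: "p \<le> 2 * k \<and> p ^ 2 \<le> n" if "prime p" "p dvd (n choose k)" "k < p" for p
    using notgood[of p] mod_less_of_dvd_binomial[OF that(1) _ that(3,2)] that(1,3) k
    unfolding good_prime_def by auto
  have lower: "(2 * real n) ^ k \<le> 2 * real k * real (n choose k) * real k ^ k"
    using k by (intro binomial_lower_bound) auto
  show False
  proof (cases "m \<le> k")
    case True
    have small: "p \<le> k" if p: "prime p" "p dvd (n choose k)" for p
    proof (rule ccontr)
      assume "\<not> p \<le> k"
      hence "p ^ 2 \<le> n" "m \<le> p" using div p True by auto
      thus False using nm power_mono[of m p 2] by linarith
    qed
    let ?M = "min k (n div 3)" and ?c = "prime_count (m - 1)"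
    have "(n choose k) \<le> n ^ ?c * primorial ?M"
      using k m nm n small by (intro binomial_le_primorial) auto
    also have "\<dots> \<le> n ^ ?c * 4 ^ ?M" by (rule mult_left_mono[OF primorial_le]) simp
    finally have "real (n choose k) \<le> real (n ^ ?c * 4 ^ ?M)" by (simp only: of_nat_le_iff)
    hence "2 * real k * real (n choose k) * real k ^ k \<le> 2 * real k * (real n ^ ?c * 4 ^ ?M) * real k ^ k"
      by (intro mult_right_mono mult_left_mono) auto
    with lower have "(2 * real n) ^ k \<le> 2 * real k * (real n ^ ?c * 4 ^ ?M) * real k ^ k" by linarith
    hence "(2 * real n / real k) ^ k \<le> 2 * real k * (real n ^ ?c * 4 ^ ?M)"
      using k by (simp add: power_divide pos_divide_le_eq)
    hence "ln ((2 * real n / real k) ^ k) \<le> ln (2 * real k * (real n ^ ?c * 4 ^ ?M))"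
      using k n by (subst ln_le_cancel_iff) auto
    also have "\<dots> = ln (2 * real k) + (?c * ln (real n) + ?M * ln 4)"
      using k n by (simp add: ln_mult ln_realpow)
    also have "ln ((2 * real n / real k) ^ k) = k * ln (2 * real n / real k)"
      using k n by (subst ln_realpow) auto
    finally have upper: "k * ln (2 * real n / real k) \<le> ln (2 * real k) + (?c * ln (real n) + ?M * ln 4)" .
    have "real n \<le> real m ^ 2" using nm by (metis le_add1 of_nat_le_iff of_nat_power)
    hence "ln (real n) \<le> ln (real m ^ 2)" using n m by (subst ln_le_cancel_iff) auto
    hence lnn: "ln (real n) \<le> 2 * ln (real m)" using m by (simp add: ln_realpow)
    have "ln (2 * real k) \<le> ln (real n)" using k by (subst ln_le_cancel_iff) auto
    hence lnk: "ln (2 * real k) \<le> 2 * ln (real m)" using lnn by linarith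
    have "4 * ?c \<le> m - 1 + 13" by (rule prime_count_le)
    hence "real (4 * ?c) \<le> real (m - 1 + 13)" by (simp only: of_nat_le_iff)
    hence "real ?c \<le> (real m + 12) / 4" using m by (simp add: of_nat_diff)
    hence "?c * ln (real n) \<le> (real m + 12) / 4 * (2 * ln (real m))"
      using lnn n by (intro mult_mono) auto
    moreover have "real ?M * ln 4 \<le> min (real k) (real n / 3) * ln 4"
    proof (intro mult_right_mono)
      have "real (n div 3) \<le> real n / 3" using of_nat_div_le_of_nat[of n 3, where 'a = real] by simp
      thus "real ?M \<le> min (real k) (real n / 3)" by (simp add: min_le_iff_disj)
    qed simp
    \<comment> \<open>The 8 consists of 6 from the bound (m + 12)/4 for the number of primes below
      m, and of 2 from ln(2k) <= ln n <= 2 ln m.\<close>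
    moreover have "(real m + 12) / 4 * (2 * ln (real m)) + 2 * ln (real m) = (real m / 2 + 8) * ln (real m)"
      by (simp add: field_simps)
    ultimately have "k * ln (2 * real n / real k) \<le> (real m / 2 + 8) * ln (real m) + min (real k) (real n / 3) * ln 4"
      using upper lnk by linarith
    moreover have "real n = real m ^ 2 - 1" using nm by (metis add_diff_cancel_right' of_nat_1 of_nat_add of_nat_power)
    hence "(real m / 2 + 8) * ln (real m) + min (real k) (real n / 3) * ln 4 < k * ln (2 * real n / real k)"
    proof (rule log_binomial_bounds_incompatible[rotated])
      have "real (2 * k) \<le> real n" using k(2) by (simp only: of_nat_le_iff)
      thus "2 * real k \<le> real n" by simp
    qed (use m True in auto)
    ultimately show False by linarith
  next
    case False
    have small: "p \<le> 2 * k" if "prime p" "p dvd (n choose k)" for p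
      using div[OF that] by linarith
    have upper: "(n choose k) \<le> n ^ prime_count (2 * k)"
      using k n small by (intro binomial_le_power_prime_count) auto
    show False
    proof (cases "k \<ge> 60")
      case True
      \<comment> \<open>With at most k/2 primes available the binomial coefficient is at most
        n^(k/2). Squaring the comparison with the lower bound and using k^2 <= n leaves 2^k <=
        2k.\<close>
      have "4 * prime_count (2 * k) \<le> 2 * k" using True by (intro prime_count_le_quarter) auto
      hence pc: "prime_count (2 * k) * 2 \<le> k" by simp
      have "(k + 1) ^ 2 \<le> m ^ 2" using False by (intro power_mono) auto
      hence kn: "k ^ 2 \<le> n" unfolding nm[symmetric] by (simp add: power2_eq_square)
      let ?c = "prime_count (2 * k)"
      have "real (n choose k) \<le> real n ^ ?c"
        using upper by (metis of_nat_le_iff of_nat_power)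
      hence "2 * real k * real (n choose k) * real k ^ k \<le> 2 * real k * real n ^ ?c * real k ^ k"
        by (intro mult_right_mono mult_left_mono) auto
      with lower have "(2 * real n) ^ k \<le> 2 * real k * real n ^ ?c * real k ^ k" by linarith
      hence "((2 * real n) ^ k) ^ 2 \<le> (2 * real k * real n ^ ?c * real k ^ k) ^ 2"
        by (rule power_mono) simp
      also have "\<dots> = (2 * real k) ^ 2 * real n ^ (?c * 2) * (real k ^ 2) ^ k"
        by (simp only: power_mult_distrib power_mult[symmetric] mult.commute[of 2 k])
      also have "\<dots> \<le> (2 * real k) ^ 2 * real n ^ k * real n ^ k"
        using pc n kn by (intro mult_mono power_increasing power_mono) (auto simp flip: of_nat_power)
      finally have "(2 ^ k) ^ 2 * (real n ^ k * real n ^ k) \<le> (2 * real k) ^ 2 * (real n ^ k * real n ^ k)"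
        by (simp only: power2_eq_square power_mult_distrib mult_ac)
      hence "(2 ^ k) ^ 2 \<le> (2 * real k) ^ 2" using n by (subst (asm) mult_le_cancel_right_pos) auto
      hence "2 ^ k \<le> 2 * real k" by (rule power2_le_imp_le) simp
      hence "real (2 ^ k) \<le> real (2 * k)" by simp
      hence "2 ^ k \<le> 2 * k" by (simp only: of_nat_le_iff)
      moreover have "2 * k < 2 ^ k" using k(1) by (induction k rule: dec_induct) auto
      ultimately show False by simp
    next
      case False
      \<comment> \<open>Since the binomial coefficient divided by n^k is nondecreasing and
        \<open>?c \<le> k\<close>, its excess over n^?c is already decided at the smallest value n =
        5183.\<close>
      let ?c = "prime_count (2 * k)"
      have gt: "5183 ^ ?c < (5183 choose k)"
        using False k by (intro power_prime_count_lt_binomial_5183) auto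
      have ck: "?c \<le> k"
        using prime_count_le[of "2 * k"] k by linarith
      have "real (5183 choose k) * real n ^ k \<le> real (n choose k) * real 5183 ^ k"
        using n False by (intro binomial_over_power_mono) auto
      also have "\<dots> \<le> real (n ^ ?c) * real 5183 ^ k"
        using upper by (intro mult_right_mono) (auto simp del: of_nat_power)
      also have "\<dots> = real n ^ ?c * (5183 ^ ?c * 5183 ^ (k - ?c))"
        using ck by (simp flip: power_add)
      also have "\<dots> \<le> real n ^ ?c * (5183 ^ ?c * real n ^ (k - ?c))"
        using n by (intro mult_left_mono power_mono) auto
      also have "\<dots> = 5183 ^ ?c * real n ^ k"
        using ck by (simp flip: power_add)
      finally have "real (5183 choose k) \<le> 5183 ^ ?c" using n by simp
      also have "\<dots> = real (5183 ^ ?c)" by simp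
      finally show False using gt by (simp only: of_nat_le_iff)
    qed
  qed
qed

theorem exists_good_prime:
  assumes "n + 1 = m ^ 2" "1 \<le> k" "2 * k \<le> n" "\<not> (n = 8 \<and> k = 1)"
  shows "\<exists>p. good_prime n k p"
proof (cases "m < 72")
  case True
  have "m \<noteq> 0" using assms(1) by (intro notI) simp
  moreover have "m \<noteq> 1" using assms(1-3) by (intro notI) simp
  ultimately have "2 \<le> m" by simp
  thus ?thesis using True assms by (intro good_prime_small[of n m k]) auto
next
  case False
  consider "k = 1" | "k = 2" | "3 \<le> k" "k \<le> 5" | "6 \<le> k" using assms(2) by linarith
  thus ?thesis
    using good_prime_k1[OF assms(1)] good_prime_k2[OF assms(1)] good_prime_k345[OF assms(1)]
      good_prime_large[OF assms(1)] False assms(3) by cases auto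
qed

section \<open>Newton polygons of factors\<close>

text \<open>A p-adic absolute value with base 1/2 in place of 1/p. The variable gets size 1/2 in
  \<open>gauss_term\<close> too, so comparing terms amounts to comparing integer exponents.\<close>

definition pabs :: "nat \<Rightarrow> int \<Rightarrow> real" where
  "pabs p a = (if a = 0 then 0 else (1 / 2) ^ multiplicity (int p) a)"

lemma pabs_nonneg [simp]: "0 \<le> pabs p a"
  by (simp add: pabs_def)

lemma pabs_le_1 [simp]: "pabs p a \<le> 1"
  by (simp add: pabs_def power_le_one)

lemma pabs_eq_0_iff [simp]: "pabs p a = 0 \<longleftrightarrow> a = 0"
  by (simp add: pabs_def)

lemma pabs_0 [simp]: "pabs p 0 = 0"
  by (simp add: pabs_def)

lemma pabs_pos_iff [simp]: "0 < pabs p a \<longleftrightarrow> a \<noteq> 0"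
  by (simp add: pabs_def)

lemma half_power_le_iff: "(1 / 2 :: real) ^ m \<le> (1 / 2) ^ k \<longleftrightarrow> k \<le> m"
  by (simp add: power_decreasing_iff)

lemma pabs_uminus [simp]: "pabs p (- a) = pabs p a"
  by (simp add: pabs_def multiplicity_uminus_right)

context
  fixes p :: nat
  assumes prime_p: "prime p"
begin

lemma prime_int_p: "prime (int p)"
  using prime_p by simp

lemma pabs_le_power_iff: "pabs p a \<le> (1 / 2) ^ k \<longleftrightarrow> int p ^ k dvd a"
proof (cases "a = 0")
  case False
  have "\<not> is_unit (int p)" using prime_int_p not_prime_unit by blast
  thus ?thesis using False
    by (simp add: pabs_def half_power_le_iff power_dvd_iff_le_multiplicity)
qed (simp add: pabs_def)

lemma pabs_mult: "pabs p (a * b) = pabs p a * pabs p b"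
  using prime_int_p by (simp add: pabs_def prime_elem_multiplicity_mult_distrib power_add)

lemma pabs_1 [simp]: "pabs p 1 = 1"
  by (simp add: pabs_def)

lemma pabs_p: "pabs p (int p) = 1 / 2"
proof -
  have "multiplicity (int p) (int p) = 1"
    using prime_int_p by (intro multiplicity_self) auto
  thus ?thesis using prime_p by (auto simp: pabs_def)
qed

lemma pabs_dvd_le: "a dvd b \<Longrightarrow> pabs p b \<le> pabs p a"
  by (auto simp: pabs_mult mult_left_le elim!: dvdE)

lemma pabs_le_half_iff: "pabs p a \<le> 1 / 2 \<longleftrightarrow> int p dvd a"
  using pabs_le_power_iff[of a 1] by simp

lemma pabs_eq_1_iff: "pabs p a = 1 \<longleftrightarrow> \<not> int p dvd a"
proof
  assume "\<not> int p dvd a"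
  thus "pabs p a = 1" by (auto simp: pabs_def not_dvd_imp_multiplicity_0)
qed (use pabs_le_half_iff[of a] in auto)

lemma pabs_add_le: "pabs p (a + b) \<le> max (pabs p a) (pabs p b)"
proof (cases "a = 0 \<or> b = 0")
  case False
  hence "\<exists>k. max (pabs p a) (pabs p b) = (1 / 2) ^ k"
    unfolding pabs_def by (auto simp: max_def)
  then obtain k where k: "max (pabs p a) (pabs p b) = (1 / 2) ^ k" by blast
  hence "pabs p a \<le> (1 / 2) ^ k" "pabs p b \<le> (1 / 2) ^ k" by linarith+
  thus ?thesis unfolding k pabs_le_power_iff by simp
qed auto

lemma pabs_add_eq:
  assumes "pabs p b < pabs p a"
  shows "pabs p (a + b) = pabs p a"
proof (rule antisym)
  show "pabs p (a + b) \<le> pabs p a" using pabs_add_le[of a b] assms by simp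
  have "pabs p a \<le> max (pabs p (a + b)) (pabs p b)"
    using pabs_add_le[of "a + b" "- b"] by simp
  thus "pabs p a \<le> pabs p (a + b)" using assms by linarith
qed

lemma pabs_sum_le_term:
  assumes "finite I" "I \<noteq> {}"
  shows "\<exists>i\<in>I. pabs p (sum f I) \<le> pabs p (f i)"
  using assms
proof (induction I rule: finite_ne_induct)
  case (insert i I)
  then obtain j where "j \<in> I" "pabs p (sum f I) \<le> pabs p (f j)" by blast
  moreover have "pabs p (sum f (insert i I)) \<le> max (pabs p (f i)) (pabs p (sum f I))"
    using pabs_add_le[of "f i" "sum f I"] insert by simp
  ultimately show ?case by (cases "pabs p (f i) \<le> pabs p (sum f I)") (auto intro: order_trans)
qed auto

lemma pabs_sum_le:
  assumes "\<And>i. i \<in> I \<Longrightarrow> pabs p (f i) \<le> C" "0 \<le> C"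
  shows "pabs p (sum f I) \<le> C"
proof (cases "finite I \<and> I \<noteq> {}")
  case True
  then obtain i where "i \<in> I" "pabs p (sum f I) \<le> pabs p (f i)" using pabs_sum_le_term by blast
  thus ?thesis using assms(1) by fastforce
qed (use assms(2) in \<open>auto simp: sum.infinite\<close>)

lemma pabs_sum_eq_term:
  assumes "finite I" "i \<in> I" "\<And>j. j \<in> I \<Longrightarrow> j \<noteq> i \<Longrightarrow> pabs p (f j) < pabs p (f i)"
  shows "pabs p (sum f I) = pabs p (f i)"
proof (cases "I - {i} = {}")
  case True
  hence "I = {i}" using assms by auto
  thus ?thesis by simp
next
  case False
  then obtain j where "j \<in> I - {i}" "pabs p (sum f (I - {i})) \<le> pabs p (f j)"
    using pabs_sum_le_term[of "I - {i}"] assms(1) by auto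
  hence "pabs p (sum f (I - {i})) < pabs p (f i)" using assms(3) by fastforce
  thus ?thesis using pabs_add_eq sum.remove[OF assms(1,2), of f] by simp
qed

text \<open>The term of index \<open>i\<close> of a Gauss norm for which the variable has size \<open>(1/2)\<close> and \<open>p\<close>
  has size \<open>(1/2)\<^sup>N\<close>: its maximisers are the edge of slope \<open>- 1 / N\<close> of the Newton polygon.\<close>
definition gauss_term :: "nat \<Rightarrow> int poly \<Rightarrow> nat \<Rightarrow> real" where
  "gauss_term N A i = pabs p (coeff A i) ^ N * (1 / 2) ^ i"

definition gauss_norm :: "nat \<Rightarrow> int poly \<Rightarrow> real" where
  "gauss_norm N A = Max (gauss_term N A ` {..degree A})"

definition gauss_argmax :: "nat \<Rightarrow> int poly \<Rightarrow> nat set" where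
  "gauss_argmax N A = {i\<in>{..degree A}. gauss_term N A i = gauss_norm N A}"

lemma gauss_term_nonneg [simp]: "0 \<le> gauss_term N A i"
  by (simp add: gauss_term_def)

lemma gauss_term_pos: "coeff A i \<noteq> 0 \<Longrightarrow> 0 < gauss_term N A i"
  by (simp add: gauss_term_def)

context
  fixes N :: nat
  assumes N: "N > 0"
begin

lemma gauss_term_beyond: "i > degree A \<Longrightarrow> gauss_term N A i = 0"
  using N by (simp add: gauss_term_def coeff_eq_0 zero_power)

lemma gauss_term_le_norm: "gauss_term N A i \<le> gauss_norm N A"
proof (cases "i \<le> degree A")
  case True
  thus ?thesis unfolding gauss_norm_def by (intro Max_ge) auto
next
  case False
  have "0 \<le> gauss_term N A 0" by simp
  also have "\<dots> \<le> gauss_norm N A" unfolding gauss_norm_def by (intro Max_ge) auto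
  finally show ?thesis using False by (simp add: gauss_term_beyond)
qed

lemma gauss_norm_pos:
  assumes "A \<noteq> 0"
  shows "0 < gauss_norm N A"
proof -
  have "0 < gauss_term N A (degree A)" using assms by (intro gauss_term_pos) auto
  thus ?thesis using gauss_term_le_norm[of A "degree A"] by linarith
qed

lemma gauss_argmax_iff:
  assumes "A \<noteq> 0"
  shows "i \<in> gauss_argmax N A \<longleftrightarrow> gauss_term N A i = gauss_norm N A"
  using gauss_norm_pos[OF assms] gauss_term_beyond[of A i] unfolding gauss_argmax_def
  by (cases "i \<le> degree A") auto

lemma finite_gauss_argmax: "finite (gauss_argmax N A)"
  by (simp add: gauss_argmax_def)

lemma gauss_argmax_nonempty: "gauss_argmax N A \<noteq> {}"
proof -
  have "gauss_norm N A \<in> gauss_term N A ` {..degree A}"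
    unfolding gauss_norm_def by (intro Max_in) auto
  thus ?thesis by (auto simp: gauss_argmax_def)
qed

lemma gauss_term_less_norm:
  "A \<noteq> 0 \<Longrightarrow> i \<notin> gauss_argmax N A \<Longrightarrow> gauss_term N A i < gauss_norm N A"
  using gauss_term_le_norm[of A i] by (simp add: gauss_argmax_iff less_le)

lemma gauss_term_mult_le:
  "gauss_term N (A * B) l \<le> gauss_norm N A * gauss_norm N B"
proof -
  obtain i where i: "i \<le> l" "pabs p (coeff (A * B) l) \<le> pabs p (coeff A i * coeff B (l - i))"
    using pabs_sum_le_term[of "{..l}" "\<lambda>i. coeff A i * coeff B (l - i)"] by (auto simp: coeff_mult)
  have "gauss_term N (A * B) l \<le> pabs p (coeff A i * coeff B (l - i)) ^ N * (1 / 2) ^ l"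
    unfolding gauss_term_def using i by (intro mult_right_mono power_mono) auto
  also have "\<dots> = gauss_term N A i * gauss_term N B (l - i)"
    using i(1) by (simp add: gauss_term_def pabs_mult power_mult_distrib flip: power_add)
  also have "\<dots> \<le> gauss_norm N A * gauss_norm N B"
    using gauss_term_le_norm by (intro mult_mono) (auto intro: order_trans[OF gauss_term_nonneg])
  finally show ?thesis .
qed

text \<open>By \<open>unique\<close> exactly one product in the convolution has maximal size, and
  the ultrametric inequality then rules out cancellation.\<close>

lemma gauss_term_mult_eq:
  assumes A: "A \<noteq> 0" and B: "B \<noteq> 0"
    and i0: "i0 \<in> gauss_argmax N A" and j0: "j0 \<in> gauss_argmax N B"
    and unique: "\<And>i j. i + j = i0 + j0 \<Longrightarrow> i \<in> gauss_argmax N A \<Longrightarrow> j \<in> gauss_argmax N B \<Longrightarrow> i = i0"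
  shows "gauss_term N (A * B) (i0 + j0) = gauss_norm N A * gauss_norm N B"
proof -
  let ?f = "\<lambda>i. coeff A i * coeff B (i0 + j0 - i)"
  have term_eq: "pabs p (?f i) ^ N * (1 / 2) ^ (i0 + j0) = gauss_term N A i * gauss_term N B (i0 + j0 - i)"
    if "i \<le> i0 + j0" for i
    using that by (simp add: gauss_term_def pabs_mult power_mult_distrib flip: power_add)
  have max_eq: "gauss_term N A i0 * gauss_term N B j0 = gauss_norm N A * gauss_norm N B"
    using i0 j0 by (simp add: gauss_argmax_iff A B)
  have pos: "0 < gauss_norm N A" "0 < gauss_norm N B" using gauss_norm_pos A B by auto
  have "pabs p (?f i) < pabs p (?f i0)" if i: "i \<in> {..i0 + j0}" "i \<noteq> i0" for i
  proof -
    have not_both: "\<not> (i \<in> gauss_argmax N A \<and> i0 + j0 - i \<in> gauss_argmax N B)"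
      using unique[of i "i0 + j0 - i"] i by auto
    hence "gauss_term N A i * gauss_term N B (i0 + j0 - i) < gauss_norm N A * gauss_norm N B"
    proof (cases "i \<in> gauss_argmax N A")
      case True
      hence "gauss_term N B (i0 + j0 - i) < gauss_norm N B"
        using not_both gauss_term_less_norm[OF B] by blast
      thus ?thesis using gauss_term_le_norm[of A i] pos
        by (meson gauss_term_nonneg mult_right_mono mult_strict_left_mono order_le_less_trans)
    next
      case False
      thus ?thesis using gauss_term_less_norm[OF A] gauss_term_le_norm[of B] pos
        by (meson gauss_term_nonneg mult_left_mono mult_strict_right_mono order_le_less_trans)
    qed
    hence "pabs p (?f i) ^ N * (1 / 2) ^ (i0 + j0) < pabs p (?f i0) ^ N * (1 / 2) ^ (i0 + j0)"
      using term_eq[of i] term_eq[of i0] i max_eq by simp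
    hence "pabs p (?f i) ^ N < pabs p (?f i0) ^ N" by simp
    thus ?thesis by (rule power_less_imp_less_base) simp
  qed
  hence "pabs p (sum ?f {..i0 + j0}) = pabs p (?f i0)"
    by (intro pabs_sum_eq_term) auto
  thus ?thesis using term_eq[of i0] max_eq by (simp add: gauss_term_def[of N "A * B"] coeff_mult)
qed

text \<open>The two extreme pairs of maximisers give uncancelled coefficients of the product, which is why
  a unique maximiser of the product forces unique maximisers of the factors.\<close>
lemma gauss_unique_max_factors:
  assumes AB: "A * B \<noteq> 0" and max: "\<And>i. i \<noteq> t \<Longrightarrow> gauss_term N (A * B) i < gauss_term N (A * B) t"
  shows "\<exists>l l'. l + l' = t \<and> (\<forall>i. i \<noteq> l \<longrightarrow> gauss_term N A i < gauss_term N A l) \<and>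
    (\<forall>i. i \<noteq> l' \<longrightarrow> gauss_term N B i < gauss_term N B l') \<and>
    gauss_term N (A * B) t = gauss_term N A l * gauss_term N B l'"
proof -
  have A: "A \<noteq> 0" and B: "B \<noteq> 0" using AB by auto
  let ?SA = "gauss_argmax N A" and ?SB = "gauss_argmax N B"
  note fin = finite_gauss_argmax[of A] finite_gauss_argmax[of B]
  note ne = gauss_argmax_nonempty[of A] gauss_argmax_nonempty[of B]
  have at_t: "s = t" if "gauss_term N (A * B) s = gauss_norm N A * gauss_norm N B" for s
    using max[of s] gauss_term_mult_le[of A B t] that by (cases "s = t") auto
  have minA: "Min ?SA \<in> ?SA" "\<And>i. i \<in> ?SA \<Longrightarrow> Min ?SA \<le> i"
    and minB: "Min ?SB \<in> ?SB" "\<And>i. i \<in> ?SB \<Longrightarrow> Min ?SB \<le> i"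
    and maxA: "Max ?SA \<in> ?SA" "\<And>i. i \<in> ?SA \<Longrightarrow> i \<le> Max ?SA"
    and maxB: "Max ?SB \<in> ?SB" "\<And>i. i \<in> ?SB \<Longrightarrow> i \<le> Max ?SB"
    using fin ne by auto
  have "gauss_term N (A * B) (Min ?SA + Min ?SB) = gauss_norm N A * gauss_norm N B"
  proof (rule gauss_term_mult_eq[OF A B minA(1) minB(1)])
    fix i j assume "i + j = Min ?SA + Min ?SB" "i \<in> ?SA" "j \<in> ?SB"
    thus "i = Min ?SA" using minA(2)[of i] minB(2)[of j] by linarith
  qed
  hence min_t: "Min ?SA + Min ?SB = t" by (rule at_t)
  have "gauss_term N (A * B) (Max ?SA + Max ?SB) = gauss_norm N A * gauss_norm N B"
  proof (rule gauss_term_mult_eq[OF A B maxA(1) maxB(1)])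
    fix i j assume "i + j = Max ?SA + Max ?SB" "i \<in> ?SA" "j \<in> ?SB"
    thus "i = Max ?SA" using maxA(2)[of i] maxB(2)[of j] by linarith
  qed
  hence eq: "gauss_term N (A * B) t = gauss_norm N A * gauss_norm N B"
    and max_t: "Max ?SA + Max ?SB = t" using at_t by auto
  have "Min ?SA \<le> Max ?SA" "Min ?SB \<le> Max ?SB" using minA maxA minB maxB by blast+
  hence mm: "Min ?SA = Max ?SA" "Min ?SB = Max ?SB" using min_t max_t by auto
  have onlyA: "i = Min ?SA" if "i \<in> ?SA" for i
    using minA(2)[OF that] maxA(2)[OF that] mm by linarith
  have onlyB: "i = Min ?SB" if "i \<in> ?SB" for i
    using minB(2)[OF that] maxB(2)[OF that] mm by linarith
  show ?thesis
  proof (intro exI conjI allI impI)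
    show "Min ?SA + Min ?SB = t" by (rule min_t)
  next
    fix i assume "i \<noteq> Min ?SA"
    hence "i \<notin> ?SA" using onlyA by blast
    hence "gauss_term N A i < gauss_norm N A" by (rule gauss_term_less_norm[OF A])
    also have "gauss_norm N A = gauss_term N A (Min ?SA)"
      using minA(1) unfolding gauss_argmax_iff[OF A] by (rule sym)
    finally show "gauss_term N A i < gauss_term N A (Min ?SA)" .
  next
    fix i assume "i \<noteq> Min ?SB"
    hence "i \<notin> ?SB" using onlyB by blast
    hence "gauss_term N B i < gauss_norm N B" by (rule gauss_term_less_norm[OF B])
    also have "gauss_norm N B = gauss_term N B (Min ?SB)"
      using minB(1) unfolding gauss_argmax_iff[OF B] by (rule sym)
    finally show "gauss_term N B i < gauss_term N B (Min ?SB)" .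
  next
    show "gauss_term N (A * B) t = gauss_term N A (Min ?SA) * gauss_term N B (Min ?SB)"
      using eq minA(1) minB(1) unfolding gauss_argmax_iff[OF A] gauss_argmax_iff[OF B] by (simp only:)
  qed
qed

lemma gauss_term_mult_0: "gauss_term N (A * B) 0 = gauss_term N A 0 * gauss_term N B 0"
  by (simp add: gauss_term_def coeff_mult_0 pabs_mult power_mult_distrib)

text \<open>The product attains the product of the norms at the sum of the largest maximisers, hence
  also at 0 by \<open>max\<close>. Terms at 0 multiply, so each factor attains its norm at 0: a
  factor is nowhere steeper than the product.\<close>

lemma gauss_max_at_0_factor:
  assumes "coeff (A * B) 0 \<noteq> 0" and max: "\<And>i. gauss_term N (A * B) i \<le> gauss_term N (A * B) 0"
  shows "gauss_term N A i \<le> gauss_term N A 0"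
proof -
  have A: "A \<noteq> 0" and B: "B \<noteq> 0" using assms(1) by auto
  let ?SA = "gauss_argmax N A" and ?SB = "gauss_argmax N B"
  note fin = finite_gauss_argmax[of A] finite_gauss_argmax[of B]
  note ne = gauss_argmax_nonempty[of A] gauss_argmax_nonempty[of B]
  have maxA: "Max ?SA \<in> ?SA" "\<And>i. i \<in> ?SA \<Longrightarrow> i \<le> Max ?SA"
    and maxB: "Max ?SB \<in> ?SB" "\<And>i. i \<in> ?SB \<Longrightarrow> i \<le> Max ?SB"
    using fin ne by auto
  have "gauss_term N (A * B) (Max ?SA + Max ?SB) = gauss_norm N A * gauss_norm N B"
  proof (rule gauss_term_mult_eq[OF A B maxA(1) maxB(1)])
    fix i j assume "i + j = Max ?SA + Max ?SB" "i \<in> ?SA" "j \<in> ?SB"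
    thus "i = Max ?SA" using maxA(2)[of i] maxB(2)[of j] by linarith
  qed
  hence "gauss_norm N A * gauss_norm N B \<le> gauss_term N A 0 * gauss_term N B 0"
    using max by (metis gauss_term_mult_0)
  also have "\<dots> \<le> gauss_term N A 0 * gauss_norm N B"
    by (intro mult_left_mono gauss_term_le_norm) auto
  finally have "gauss_norm N A \<le> gauss_term N A 0"
    using gauss_norm_pos[OF B] by simp
  thus ?thesis using gauss_term_le_norm[of A i] by linarith
qed

end

text \<open>All slopes are flatter than 1/N, so the descent from height at least 1 at index 0 to
  height 0 at the leading coefficient takes more than N steps.\<close>

lemma degree_gt_of_unique_max_at_0:
  assumes N: "N > 0" and A: "lead_coeff A = 1" "degree A > 0" "int p dvd coeff A 0"
    and max: "\<And>i. i \<noteq> 0 \<Longrightarrow> gauss_term N A i < gauss_term N A 0"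
  shows "N < degree A"
proof -
  have "(1 / 2) ^ degree A = gauss_term N A (degree A)" using A(1) by (simp add: gauss_term_def)
  also have "\<dots> < gauss_term N A 0" using max A(2) by simp
  also have "\<dots> = pabs p (coeff A 0) ^ N" by (simp add: gauss_term_def)
  also have "\<dots> \<le> (1 / 2) ^ N" using A(3) by (intro power_mono) (simp_all only: pabs_le_half_iff pabs_nonneg)
  finally show ?thesis using half_power_le_iff[of N "degree A"] by linarith
qed

text \<open>Modulo \<open>p\<close>, the lowest nonzero coefficient of \<open>B\<close> contributes
  to the product at its own index only through the constant coefficient of \<open>A\<close>, and
  that index is below \<open>I\<close>.\<close>

lemma dvd_coeff_0_of_low_coeffs:
  fixes A B :: "int poly"
  assumes low: "\<And>i. i < I \<Longrightarrow> int p dvd coeff (A * B) i"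
    and B: "lead_coeff B = 1" "degree B < I"
  shows "int p dvd coeff A 0"
proof (rule ccontr)
  assume A0: "\<not> int p dvd coeff A 0"
  have "\<not> int p dvd coeff B (degree B)" using B prime_int_p not_prime_unit by auto
  define j where "j = (LEAST j. \<not> int p dvd coeff B j)"
  have j: "\<not> int p dvd coeff B j" unfolding j_def
    using \<open>\<not> int p dvd coeff B (degree B)\<close> by (rule LeastI)
  have "j \<le> degree B" unfolding j_def
    using \<open>\<not> int p dvd coeff B (degree B)\<close> by (rule Least_le)
  hence "int p dvd coeff (A * B) j" using low B(2) by simp
  also have "coeff (A * B) j = coeff A 0 * coeff B j + (\<Sum>i\<in>{..j} - {0}. coeff A i * coeff B (j - i))"
    unfolding coeff_mult by (subst sum.remove[of _ 0]) auto
  finally have "int p dvd coeff A 0 * coeff B j + (\<Sum>i\<in>{..j} - {0}. coeff A i * coeff B (j - i))" .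
  moreover have "int p dvd coeff B i" if "i < j" for i
    using that not_less_Least unfolding j_def by blast
  hence "int p dvd (\<Sum>i\<in>{..j} - {0}. coeff A i * coeff B (j - i))"
    by (intro dvd_sum dvd_mult) auto
  ultimately have "int p dvd coeff A 0 * coeff B j" by (simp add: dvd_add_left_iff)
  thus False using A0 j prime_int_p by (simp add: prime_dvd_mult_iff)
qed

lemma no_small_factor_unique_max_at_0:
  assumes AB: "coeff (A * B) 0 \<noteq> 0" and N: "N > 0"
    and max: "\<And>i. i \<noteq> 0 \<Longrightarrow> gauss_term N (A * B) i < gauss_term N (A * B) 0"
    and A: "lead_coeff A = 1" "degree A > 0" "int p dvd coeff A 0"
  shows "N < degree A"
proof -
  have AB0: "A * B \<noteq> 0" using AB by auto
  obtain l l' where "l + l' = 0" and maxA: "\<forall>i. i \<noteq> l \<longrightarrow> gauss_term N A i < gauss_term N A l"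
    using gauss_unique_max_factors[OF N AB0 max] by blast
  from this(1) have "l = 0" by simp
  show ?thesis
    by (rule degree_gt_of_unique_max_at_0[OF N A]) (use maxA \<open>l = 0\<close> in blast)
qed

text \<open>Here the Newton polygon of the product starts with an edge from \<open>0\<close> to \<open>2p\<close> of height \<open>2\<close>; by
  parity no lattice point on it can be used by an even factor of degree below \<open>2p\<close>.\<close>
lemma no_small_factor_first_edge_2p:
  assumes AB: "coeff (A * B) 0 \<noteq> 0" and p3: "odd p"
    and edge: "\<And>i. gauss_term p (A * B) i \<le> gauss_term p (A * B) 0"
    and max: "\<And>i. i \<noteq> 2 * p \<Longrightarrow> gauss_term (2 * (p - 1)) (A * B) i < gauss_term (2 * (p - 1)) (A * B) (2 * p)"
    and height: "pabs p (coeff (A * B) (2 * p)) = 4 * pabs p (coeff (A * B) 0)"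
    and A: "lead_coeff A = 1" "degree A > 0" "int p dvd coeff A 0"
    and even: "\<And>i. odd i \<Longrightarrow> coeff A i = 0"
  shows "2 * p \<le> degree A"
proof (rule ccontr)
  assume small: "\<not> 2 * p \<le> degree A"
  have p: "p > 1" using prime_p prime_gt_1_nat by blast
  let ?N = "2 * (p - 1)"
  have N: "?N > 0" and p0: "p > 0" using p by auto
  have AB0: "A * B \<noteq> 0" using AB by auto
  obtain l l' where l: "l + l' = 2 * p"
    and maxA: "\<forall>i. i \<noteq> l \<longrightarrow> gauss_term ?N A i < gauss_term ?N A l"
    and eq: "gauss_term ?N (A * B) (2 * p) = gauss_term ?N A l * gauss_term ?N B l'"
    using gauss_unique_max_factors[OF N AB0 max] by blast
  have "0 < gauss_term ?N A l"
    using maxA gauss_term_nonneg[of ?N A "Suc l"] by (metis n_not_Suc_n order_le_less_trans)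
  hence al: "coeff A l \<noteq> 0" using N by (intro notI) (simp add: gauss_term_def zero_power)
  have ll: "(1 / 2 :: real) ^ (2 * p) = (1 / 2) ^ l * (1 / 2) ^ l'"
    unfolding l[symmetric] by (rule power_add)
  have "pabs p (coeff (A * B) (2 * p)) ^ ?N = (pabs p (coeff A l) * pabs p (coeff B l')) ^ ?N"
    using eq unfolding gauss_term_def ll by (simp add: power_mult_distrib)
  hence prod: "pabs p (coeff (A * B) (2 * p)) = pabs p (coeff A l) * pabs p (coeff B l')"
    using N by (subst (asm) power_eq_iff_eq_base) auto
  \<comment> \<open>By \<open>edge\<close> no factor is steeper than -1/p, and by
    \<open>height\<close> the vertices \<open>l\<close> and \<open>l'\<close> together realise this
    slope, so each lies on the steepest edge of its factor.\<close>
  have leA: "gauss_term p A l \<le> gauss_term p A 0"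
    using AB edge by (intro gauss_max_at_0_factor[OF p0, of A B]) auto
  have leB: "gauss_term p B l' \<le> gauss_term p B 0"
    using AB edge by (intro gauss_max_at_0_factor[OF p0, of B A]) (auto simp: mult.commute)
  have "gauss_term p A l * gauss_term p B l' = (pabs p (coeff A l) * pabs p (coeff B l')) ^ p * (1 / 2) ^ (2 * p)"
    unfolding gauss_term_def ll by (simp add: power_mult_distrib)
  also have "\<dots> = (4 * pabs p (coeff (A * B) 0)) ^ p * (1 / 2) ^ (2 * p)"
    unfolding prod[symmetric] height ..
  also have "\<dots> = pabs p (coeff (A * B) 0) ^ p"
    unfolding power_mult power_mult_distrib[symmetric] by (simp add: power2_eq_square)
  also have "\<dots> = gauss_term p A 0 * gauss_term p B 0"
    unfolding gauss_term_mult_0[OF p0, symmetric] by (simp add: gauss_term_def)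
  finally have prod_eq: "gauss_term p A l * gauss_term p B l' = gauss_term p A 0 * gauss_term p B 0" .
  have "0 < gauss_term p B 0" "0 < gauss_term p A 0"
    using AB by (auto intro!: gauss_term_pos simp: coeff_mult_0)
  hence "gauss_term p A l = gauss_term p A 0"
    using prod_eq leA leB
    by (metis antisym_conv2 gauss_term_nonneg mult_left_mono mult_strict_right_mono not_le order_le_less_trans less_irrefl)
  moreover have "coeff A 0 \<noteq> 0" using AB by (auto simp: coeff_mult_0)
  ultimately have "(1 / 2 :: real) ^ (multiplicity (int p) (coeff A l) * p + l) = (1 / 2) ^ (multiplicity (int p) (coeff A 0) * p)"
    using al by (simp add: gauss_term_def pabs_def power_add power_mult)
  hence "multiplicity (int p) (coeff A l) * p + l = multiplicity (int p) (coeff A 0) * p"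
    by (metis half_power_le_iff order_antisym order_refl)
  \<comment> \<open>An edge of slope -1/p drops by an integer, so its length is a multiple of
    \<open>p\<close>.\<close>
  hence "p dvd l" by (metis dvd_add_right_iff dvd_triv_right)
  moreover have "even l" using even al by blast
  hence "2 dvd l" .
  ultimately have "2 * p dvd l" using p3 by (intro divides_mult) auto
  moreover have "l < 2 * p" using al small le_degree[of A l] by linarith
  ultimately have "l = 0" by (auto dest: dvd_imp_le)
  \<comment> \<open>With no part of the steep edge, \<open>A\<close> has only slopes flatter than
    1/(2p - 2); its even degree therefore exceeds 2p - 2 and reaches 2p.\<close>
  hence "?N < degree A"
    by (intro degree_gt_of_unique_max_at_0[OF N A]) (use maxA \<open>l = 0\<close> in blast)
  moreover have "even (degree A)"
    using even[of "degree A"] A(1) by auto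
  ultimately show False using small by auto
qed

end

section \<open>The coefficients of Hermite polynomials and of their Wronskians\<close>

text \<open>This is the quotient (2b - 1)!! / (2a - 1)!! of double factorials, kept as an
  integer.\<close>

definition odd_prod :: "nat \<Rightarrow> nat \<Rightarrow> int" where
  "odd_prod a b = (\<Prod>i\<in>{a..<b}. int (2 * i + 1))"

lemma odd_prod_same [simp]: "odd_prod a a = 1"
  by (simp add: odd_prod_def)

lemma odd_prod_pos [simp]: "odd_prod a b > 0"
  unfolding odd_prod_def by (intro prod_pos) auto

lemma odd_prod_nonzero [simp]: "odd_prod a b \<noteq> 0"
  using odd_prod_pos[of a b] by (intro notI) (simp del: odd_prod_pos)

lemma odd_prod_Suc: "a \<le> b \<Longrightarrow> odd_prod a (Suc b) = odd_prod a b * int (2 * b + 1)"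
  by (simp add: odd_prod_def)

lemma odd_prod_Suc_left: "a < b \<Longrightarrow> odd_prod a b = int (2 * a + 1) * odd_prod (Suc a) b"
  unfolding odd_prod_def by (subst prod.atLeast_Suc_lessThan) auto

lemma odd_prod_mult: "a \<le> b \<Longrightarrow> b \<le> c \<Longrightarrow> odd_prod a b * odd_prod b c = odd_prod a c"
  unfolding odd_prod_def by (rule prod.atLeastLessThan_concat)

lemma odd_prod_Suc_0: "odd_prod (Suc 0) (Suc b) = odd_prod 0 (Suc b)"
  using odd_prod_Suc_left[of 0 "Suc b"] by simp

lemma dvd_odd_prod: "a \<le> i \<Longrightarrow> i < b \<Longrightarrow> q dvd int (2 * i + 1) \<Longrightarrow> q dvd odd_prod a b"
  unfolding odd_prod_def by (rule dvd_trans, assumption, rule dvd_prodI) auto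

lemma odd_prod_dvd_fact: "odd_prod 0 l dvd fact (2 * l)" "odd_prod 0 (Suc l) dvd fact (2 * l + 1)"
proof -
  show "odd_prod 0 l dvd fact (2 * l)" for l
  proof (induction l)
    case (Suc l)
    have "(fact (2 * Suc l) :: int) = fact (2 * l) * int (2 * l + 1) * int (2 * l + 2)"
      by (simp add: algebra_simps)
    thus ?case using Suc by (simp add: odd_prod_Suc mult_dvd_mono dvd_mult2)
  qed simp
  hence "odd_prod 0 l * int (2 * l + 1) dvd fact (2 * l) * int (2 * l + 1)"
    by (intro mult_dvd_mono) auto
  thus "odd_prod 0 (Suc l) dvd fact (2 * l + 1)"
    by (simp add: odd_prod_Suc mult.commute)
qed

text \<open>Closed form for the coefficient of x^(2l) in \<open>hermiteHe (2 * M)\<close>;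
  \<open>odd_coeff\<close> is the one of x^(2l+1) in \<open>hermiteHe (2 * M + 1)\<close>. The sign
  uses M + l in place of M - l to avoid truncated subtraction.\<close>

definition even_coeff :: "nat \<Rightarrow> nat \<Rightarrow> int" where
  "even_coeff M l = (-1) ^ (M + l) * int (M choose l) * odd_prod l M"

definition odd_coeff :: "nat \<Rightarrow> nat \<Rightarrow> int" where
  "odd_coeff M l = (-1) ^ (M + l) * int (M choose l) * odd_prod (Suc l) (Suc M)"

lemma coeff_hermiteHe_Suc_Suc_0:
  "coeff (hermiteHe (Suc (Suc k))) 0 = - int (k + 1) * coeff (hermiteHe k) 0"
  by (simp add: algebra_simps)

lemma coeff_hermiteHe_Suc_Suc_Suc:
  "coeff (hermiteHe (Suc (Suc k))) (Suc a) =
     coeff (hermiteHe (Suc k)) a - int (k + 1) * coeff (hermiteHe k) (Suc a)"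
  by simp

lemma even_coeff_Suc_0: "even_coeff (Suc M) 0 = - int (2 * M + 1) * even_coeff M 0"
  by (simp add: even_coeff_def odd_prod_Suc algebra_simps)

lemma even_coeff_Suc_Suc:
  "even_coeff (Suc M) (Suc l) = odd_coeff M l - int (2 * M + 1) * even_coeff M (Suc l)"
proof (cases "Suc l \<le> M")
  case True
  thus ?thesis by (simp add: even_coeff_def odd_coeff_def odd_prod_Suc algebra_simps)
next
  case False
  thus ?thesis by (cases "l = M") (simp_all add: even_coeff_def odd_coeff_def binomial_eq_0)
qed

lemma odd_coeff_Suc:
  "odd_coeff (Suc M) l = even_coeff (Suc M) l - int (2 * M + 2) * odd_coeff M l"
proof (cases "l \<le> M")
  case True
  have "(Suc M - l) * (Suc M choose l) = Suc M * (M choose l)"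
    using binomial_absorb_comp[of "Suc M" l] by simp
  hence "int (Suc M - l) * int (Suc M choose l) = int (Suc M) * int (M choose l)"
    by (metis of_nat_mult)
  hence absorb: "(int M + 1 - int l) * int (Suc M choose l) = (int M + 1) * int (M choose l)"
    using True by (simp add: of_nat_diff add.commute[of 1] del: binomial_Suc_Suc)
  have 1: "odd_prod (Suc l) (Suc (Suc M)) = odd_prod (Suc l) (Suc M) * (2 * int M + 3)"
    using True odd_prod_Suc[of "Suc l" "Suc M"] by simp
  have 2: "odd_prod l (Suc M) = (2 * int l + 1) * odd_prod (Suc l) (Suc M)"
    using True odd_prod_Suc_left[of l "Suc M"] by simp
  have "odd_coeff (Suc M) l = - ((-1) ^ (M + l) * odd_prod (Suc l) (Suc M) * ((2 * int M + 3) * int (Suc M choose l)))"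
    unfolding odd_coeff_def 1 by simp
  also have "(2 * int M + 3) * int (Suc M choose l) =
      (2 * int l + 1) * int (Suc M choose l) + 2 * ((int M + 1 - int l) * int (Suc M choose l))"
    by (simp add: algebra_simps)
  also have "\<dots> = (2 * int l + 1) * int (Suc M choose l) + 2 * ((int M + 1) * int (M choose l))"
    unfolding absorb ..
  also have "- ((-1) ^ (M + l) * odd_prod (Suc l) (Suc M) * \<dots>) = even_coeff (Suc M) l - int (2 * M + 2) * odd_coeff M l"
    unfolding even_coeff_def odd_coeff_def 2 by (simp add: algebra_simps del: binomial_Suc_Suc)
  finally show ?thesis .
next
  case False
  thus ?thesis by (cases "l = Suc M") (simp_all add: even_coeff_def odd_coeff_def binomial_eq_0)
qed

lemma coeff_hermiteHe_even_odd:
  "(\<forall>l. coeff (hermiteHe (2 * M)) (2 * l) = even_coeff M l) \<and>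
   (\<forall>l. coeff (hermiteHe (2 * M + 1)) (2 * l + 1) = odd_coeff M l)"
proof (induction M)
  case 0
  have "coeff (hermiteHe (2 * 0)) (2 * l) = even_coeff 0 l" for l
    by (cases l) (auto simp: even_coeff_def binomial_eq_0)
  moreover have "coeff (hermiteHe (2 * 0 + 1)) (2 * l + 1) = odd_coeff 0 l" for l
    by (cases l) (auto simp: odd_coeff_def binomial_eq_0)
  ultimately show ?case by blast
next
  case (Suc M)
  have even: "coeff (hermiteHe (2 * Suc M)) (2 * l) = even_coeff (Suc M) l" for l
  proof (cases l)
    case 0
    thus ?thesis
      using Suc.IH coeff_hermiteHe_Suc_Suc_0[of "2 * M"] by (metis even_coeff_Suc_0 mult_0_right mult_Suc_right add_2_eq_Suc)
  next
    case (Suc l')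
    have "coeff (hermiteHe (2 * Suc M)) (2 * l) =
        coeff (hermiteHe (2 * M + 1)) (2 * l' + 1) - int (2 * M + 1) * coeff (hermiteHe (2 * M)) (2 * Suc l')"
      using coeff_hermiteHe_Suc_Suc_Suc[of "2 * M" "2 * l' + 1"] Suc by simp
    also have "\<dots> = even_coeff (Suc M) l"
      using Suc.IH unfolding Suc even_coeff_Suc_Suc by (simp only:)
    finally show ?thesis .
  qed
  have "coeff (hermiteHe (2 * Suc M + 1)) (2 * l + 1) = odd_coeff (Suc M) l" for l
  proof -
    have "coeff (hermiteHe (2 * Suc M + 1)) (2 * l + 1) =
        coeff (hermiteHe (2 * Suc M)) (2 * l) - int (2 * M + 2) * coeff (hermiteHe (2 * M + 1)) (2 * l + 1)"
      using coeff_hermiteHe_Suc_Suc_Suc[of "2 * M + 1" "2 * l"] by simp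
    thus ?thesis unfolding even odd_coeff_Suc using Suc.IH by (simp only:)
  qed
  thus ?case using even by blast
qed

lemmas coeff_hermiteHe_even = conjunct1[OF coeff_hermiteHe_even_odd, rule_format]
lemmas coeff_hermiteHe_odd = conjunct2[OF coeff_hermiteHe_even_odd, rule_format]

lemma coeff_hermiteHe_parity: "odd (n + a) \<Longrightarrow> coeff (hermiteHe n) a = 0"
proof (induction n arbitrary: a rule: hermiteHe.induct)
  case (2 a)
  thus ?case by (cases a rule: hermiteHe.cases) (auto simp: coeff_pCons split: nat.splits)
next
  case (3 k a)
  thus ?case by (cases a) auto
qed (auto simp: coeff_eq_0 odd_pos)

lemma coeff_wronskian:
  fixes u v :: "int poly"
  shows "coeff (u * pderiv v - pderiv u * v) m =
    (\<Sum>a\<le>Suc m. (int (Suc m) - 2 * int a) * (coeff u a * coeff v (Suc m - a)))"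
proof -
  have "coeff (u * pderiv v) m = (\<Sum>a\<le>m. int (Suc m - a) * (coeff u a * coeff v (Suc m - a)))"
    unfolding coeff_mult coeff_pderiv by (intro sum.cong) (auto simp: Suc_diff_le)
  also have "\<dots> = (\<Sum>a\<le>Suc m. int (Suc m - a) * (coeff u a * coeff v (Suc m - a)))"
    by simp
  finally have 1: "coeff (u * pderiv v) m = \<dots>" .
  have "coeff (pderiv u * v) m = (\<Sum>a\<le>m. int (Suc a) * (coeff u (Suc a) * coeff v (Suc m - Suc a)))"
    unfolding coeff_mult coeff_pderiv by (intro sum.cong) auto
  also have "\<dots> = (\<Sum>a\<le>Suc m. int a * (coeff u a * coeff v (Suc m - a)))"
    by (subst sum.atMost_Suc_shift) simp
  finally have 2: "coeff (pderiv u * v) m = \<dots>" .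
  show ?thesis
    unfolding coeff_diff 1 2 sum_subtractf[symmetric]
    by (intro sum.cong) (auto simp: of_nat_diff algebra_simps)
qed

text \<open>Fixing the even index first treats both parities of n at once: M' = M for even n, and M
  = M' + 1 up to sign for odd n.\<close>

definition hermite_wr :: "nat \<Rightarrow> nat \<Rightarrow> int poly" where
  "hermite_wr M M' = hermiteHe (2 * M) * pderiv (hermiteHe (2 * M' + 1)) -
     pderiv (hermiteHe (2 * M)) * hermiteHe (2 * M' + 1)"

lemma coeff_hermite_wr_odd: "odd i \<Longrightarrow> coeff (hermite_wr M M') i = 0"
  unfolding hermite_wr_def coeff_wronskian
proof (rule sum.neutral, rule ballI)
  fix a assume "odd i" "a \<in> {..Suc i}"
  hence "odd (2 * M + a) \<or> odd (2 * M' + 1 + (Suc i - a))" by auto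
  thus "(int (Suc i) - 2 * int a) * (coeff (hermiteHe (2 * M)) a * coeff (hermiteHe (2 * M' + 1)) (Suc i - a)) = 0"
    using coeff_hermiteHe_parity by fastforce
qed

lemma coeff_hermite_wr_even:
  "coeff (hermite_wr M M') (2 * i) =
     (\<Sum>l\<le>i. (2 * int i + 1 - 4 * int l) * (even_coeff M l * odd_coeff M' (i - l)))"
proof -
  let ?g = "\<lambda>a. (int (Suc (2 * i)) - 2 * int a) *
    (coeff (hermiteHe (2 * M)) a * coeff (hermiteHe (2 * M' + 1)) (Suc (2 * i) - a))"
  have "coeff (hermite_wr M M') (2 * i) = sum ?g {..Suc (2 * i)}"
    unfolding hermite_wr_def coeff_wronskian ..
  also have "\<dots> = sum ?g ((\<lambda>l. 2 * l) ` {..i})"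
  proof (rule sum.mono_neutral_right)
    show "\<forall>a\<in>{..Suc (2 * i)} - (\<lambda>l. 2 * l) ` {..i}. ?g a = 0"
    proof
      fix a assume a: "a \<in> {..Suc (2 * i)} - (\<lambda>l. 2 * l) ` {..i}"
      have "odd a"
      proof
        assume "even a"
        then obtain l where "a = 2 * l" by auto
        thus False using a by auto
      qed
      thus "?g a = 0" using coeff_hermiteHe_parity[of "2 * M" a] by simp
    qed
  qed auto
  also have "\<dots> = (\<Sum>l\<le>i. ?g (2 * l))"
    by (subst sum.reindex) (auto simp: inj_on_def)
  also have "\<dots> = (\<Sum>l\<le>i. (2 * int i + 1 - 4 * int l) * (even_coeff M l * odd_coeff M' (i - l)))"
  proof (rule sum.cong)
    fix l assume "l \<in> {..i}"
    hence "Suc (2 * i) - 2 * l = 2 * (i - l) + 1" by auto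
    thus "?g (2 * l) = (2 * int i + 1 - 4 * int l) * (even_coeff M l * odd_coeff M' (i - l))"
      by (simp only: coeff_hermiteHe_even coeff_hermiteHe_odd) simp
  qed simp
  finally show ?thesis .
qed

lemma coeff_hermite_wr_0: "coeff (hermite_wr M M') 0 = even_coeff M 0 * odd_coeff M' 0"
  using coeff_hermite_wr_even[of M M' 0] by simp

lemma even_coeff_0_nonzero [simp]: "even_coeff M 0 \<noteq> 0" and odd_coeff_0_nonzero [simp]: "odd_coeff M 0 \<noteq> 0"
  by (auto simp: even_coeff_def odd_coeff_def)

text \<open>The last-digit case of Lucas's theorem, by Pascal's rule down to an upper index
  divisible by \<open>p\<close>.\<close>

lemma prime_dvd_binomial_of_mod_less:
  fixes p M l :: nat
  assumes "prime p" "M mod p < l mod p"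
  shows "p dvd (M choose l)"
proof -
  have "p dvd ((p * A + t) choose l)" if "t < l mod p" for A t
    using that
  proof (induction t arbitrary: l)
    case 0
    then obtain l' where l': "l = Suc l'" by (cases l) auto
    have "\<not> p dvd l" using 0 by (auto simp: dvd_eq_mod_eq_0)
    have "l * ((p * A) choose l) = p * A * ((p * A - 1) choose l')"
      unfolding l' by (rule binomial_absorption)
    hence "p dvd l * ((p * A) choose l)" by simp
    thus ?case using assms(1) \<open>\<not> p dvd l\<close> by (simp add: prime_dvd_mult_iff)
  next
    case (Suc t)
    then obtain l' where l': "l = Suc l'" by (cases l) auto
    have "l mod p = Suc (l' mod p)" using Suc.prems unfolding l' by (simp add: mod_Suc split: if_splits)
    hence "t < l' mod p" "t < l mod p" using Suc.prems by auto
    hence "p dvd ((p * A + t) choose l')" "p dvd ((p * A + t) choose l)" using Suc.IH by auto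
    thus ?case unfolding l' by simp
  qed
  from this[of "M mod p" "M div p"] show ?thesis using assms(2) by simp
qed

lemma prime_not_dvd_binomial:
  fixes p M l :: nat
  assumes "prime p" "l \<le> M mod p"
  shows "\<not> p dvd (M choose l)"
proof -
  have "p > 0" using assms(1) prime_gt_0_nat by blast
  hence "l < p" "l \<le> M" using assms(2) mod_less_divisor[of p M] mod_le_divisor[of p M] mod_less_eq_dividend[of M p] by linarith+
  thus ?thesis using mod_less_of_dvd_binomial[OF assms(1), of l M] assms(2) by auto
qed

lemma div_add_div_le: "a div p + b div p \<le> (a + b) div (p::nat)"
  using div_add1_eq[of a b p] by simp

section \<open>The p-adic sizes of the coefficients of the Wronskian\<close>

lemma pabs_sign_mult: "pabs p ((-1) ^ k * a) = pabs p a"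
  by (cases "even k") auto

context
  fixes p h :: nat
  assumes prime_p: "prime p" and p_eq: "p = 2 * h + 1"
begin

lemma h_pos: "h > 0"
  using prime_p p_eq by (intro Nat.gr0I) auto

lemma p_pos: "p > 0"
  using p_eq by simp

text \<open>The exponent counts the odd multiples of p = 2h + 1 below 2l; the bound by
  \<open>p ^ 2\<close> ensures that each contributes a single factor \<open>p\<close>.\<close>

lemma pabs_odd_prod:
  assumes "2 * l \<le> p ^ 2"
  shows "pabs p (odd_prod 0 l) = (1 / 2) ^ ((l + h) div p)"
  using assms
proof (induction l)
  case 0
  show ?case using pabs_1[OF prime_p] by (simp add: p_eq)
next
  case (Suc l)
  have IH: "pabs p (odd_prod 0 l) = (1 / 2) ^ ((l + h) div p)"
    using Suc by simp
  have eq: "pabs p (odd_prod 0 (Suc l)) = pabs p (odd_prod 0 l) * pabs p (int (2 * l + 1))"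
    unfolding odd_prod_Suc[OF le0] by (rule pabs_mult[OF prime_p])
  have "p dvd 2 * l + 1 \<longleftrightarrow> p dvd (2 * l + 1) + p" by (rule dvd_add_triv_right_iff[symmetric])
  also have "(2 * l + 1) + p = 2 * Suc (l + h)" unfolding p_eq by simp
  also have "p dvd 2 * Suc (l + h) \<longleftrightarrow> p dvd Suc (l + h)"
  proof -
    have "coprime p 2" using p_eq by (simp only: coprime_right_2_iff_odd) simp
    thus ?thesis by (rule coprime_dvd_mult_right_iff)
  qed
  finally have dvd_iff: "p dvd 2 * l + 1 \<longleftrightarrow> p dvd Suc (l + h)" .
  show ?case
  proof (cases "p dvd 2 * l + 1")
    case True
    then obtain c where c: "2 * l + 1 = p * c" by (rule dvdE)
    have "p * c < p * p" unfolding c[symmetric] using Suc.prems by (simp add: power2_eq_square)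
    hence "c < p" by (simp only: mult_less_cancel1)
    moreover have "c \<noteq> 0" using c by (intro notI) simp
    ultimately have "\<not> p dvd c" by (auto dest: dvd_imp_le)
    hence "pabs p (int c) = 1" by (simp add: pabs_eq_1_iff[OF prime_p])
    hence "pabs p (int (2 * l + 1)) = 1 / 2"
      unfolding c by (simp add: pabs_mult[OF prime_p] pabs_p[OF prime_p])
    moreover have "(Suc l + h) div p = Suc ((l + h) div p)"
      using True dvd_iff by (simp add: div_Suc dvd_eq_mod_eq_0)
    ultimately show ?thesis unfolding eq IH by simp
  next
    case False
    hence "\<not> int p dvd int (2 * l + 1)" by (subst int_dvd_int_iff)
    hence "pabs p (int (2 * l + 1)) = 1" by (simp only: pabs_eq_1_iff[OF prime_p] not_False_eq_True)
    moreover have "(Suc l + h) div p = (l + h) div p"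
      using False dvd_iff by (simp add: div_Suc dvd_eq_mod_eq_0)
    ultimately show ?thesis unfolding eq IH by simp
  qed
qed

lemma pabs_even_coeff_odd_prod:
  "pabs p (even_coeff M l) * pabs p (odd_prod 0 l) = pabs p (int (M choose l)) * pabs p (even_coeff M 0)"
proof (cases "l \<le> M")
  case True
  hence "odd_prod 0 M = odd_prod 0 l * odd_prod l M"
    using odd_prod_mult[of 0 l M] by simp
  thus ?thesis
    by (simp add: even_coeff_def pabs_sign_mult mult.assoc pabs_mult[OF prime_p])
qed (simp add: even_coeff_def binomial_eq_0)

lemma pabs_odd_coeff_odd_prod:
  "pabs p (odd_coeff M l) * pabs p (odd_prod 0 (Suc l)) = pabs p (int (M choose l)) * pabs p (odd_coeff M 0)"
proof (cases "l \<le> M")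
  case True
  have "odd_prod (Suc 0) (Suc M) = odd_prod 0 (Suc l) * odd_prod (Suc l) (Suc M)"
    using odd_prod_mult[of "Suc 0" "Suc l" "Suc M"] True by (simp add: odd_prod_Suc_0)
  thus ?thesis
    by (simp add: odd_coeff_def pabs_sign_mult mult.assoc pabs_mult[OF prime_p])
qed (simp add: odd_coeff_def binomial_eq_0)

lemma pabs_even_coeff:
  assumes "2 * M \<le> p ^ 2"
  shows "pabs p (even_coeff M l) = pabs p (int (M choose l)) * pabs p (even_coeff M 0) * 2 ^ ((l + h) div p)"
proof (cases "l \<le> M")
  case True
  hence "2 * l \<le> p ^ 2" using assms by linarith
  hence "pabs p (even_coeff M l) * (1 / 2) ^ ((l + h) div p) = pabs p (int (M choose l)) * pabs p (even_coeff M 0)"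
    using pabs_even_coeff_odd_prod[of M l] pabs_odd_prod by simp
  thus ?thesis by (simp add: field_simps power_divide)
qed (simp add: even_coeff_def binomial_eq_0)

lemma pabs_odd_coeff:
  assumes "2 * M + 2 \<le> p ^ 2"
  shows "pabs p (odd_coeff M l) = pabs p (int (M choose l)) * pabs p (odd_coeff M 0) * 2 ^ ((l + 1 + h) div p)"
proof (cases "l \<le> M")
  case True
  hence "2 * Suc l \<le> 2 * M + 2" by simp
  hence "2 * Suc l \<le> p ^ 2" using assms by (rule order_trans)
  hence "pabs p (odd_coeff M l) * (1 / 2) ^ ((l + 1 + h) div p) = pabs p (int (M choose l)) * pabs p (odd_coeff M 0)"
    using pabs_odd_coeff_odd_prod[of M l] pabs_odd_prod[of "Suc l"] by simp
  thus ?thesis by (simp add: field_simps power_divide)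
qed (simp add: odd_coeff_def binomial_eq_0)

lemma div_add_carry:
  assumes "c < p"
  shows "(l + c) div p = (if l mod p < p - c then l div p else l div p + 1)"
proof -
  have "(l + c) div p = l div p + (l mod p + c) div p"
    using div_add1_eq[of l c p] assms by simp
  moreover have "(l mod p + c) div p = (if l mod p < p - c then 0 else 1)"
  proof (cases "l mod p < p - c")
    case False
    have "l mod p < p" using p_pos by simp
    hence "l mod p + c < p * Suc 1" using add_strict_mono[OF _ assms] by simp
    moreover have "p * 1 \<le> l mod p + c" using False by simp
    ultimately have "(l mod p + c) div p = 1" by (intro div_nat_eqI)
    thus ?thesis using False by simp
  qed (use assms in auto)
  ultimately show ?thesis by simp
qed

lemma pabs_hermite_wr_term:
  "pabs p (w * (even_coeff M l * odd_coeff M' j)) = pabs p w * (pabs p (even_coeff M l) * pabs p (odd_coeff M' j))"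
  by (simp add: pabs_mult[OF prime_p])

lemma pabs_coeff_hermite_wr_le:
  assumes "\<And>l j. l + j = i \<Longrightarrow> pabs p (2 * int j + 1 - 2 * int l) * (pabs p (even_coeff M l) * pabs p (odd_coeff M' j)) \<le> C"
    and "0 \<le> C"
  shows "pabs p (coeff (hermite_wr M M') (2 * i)) \<le> C"
  unfolding coeff_hermite_wr_even
proof (rule pabs_sum_le[OF prime_p])
  fix l assume l: "l \<in> {..i}"
  hence w: "2 * int i + 1 - 4 * int l = 2 * int (i - l) + 1 - 2 * int l" by (simp add: of_nat_diff)
  have "l + (i - l) = i" using l by simp
  thus "pabs p ((2 * int i + 1 - 4 * int l) * (even_coeff M l * odd_coeff M' (i - l))) \<le> C"
    unfolding w pabs_hermite_wr_term by (rule assms(1))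
qed (rule assms)

lemma pabs_coeff_hermite_wr_0:
  "pabs p (coeff (hermite_wr M M') 0) = pabs p (even_coeff M 0) * pabs p (odd_coeff M' 0)"
  by (simp add: coeff_hermite_wr_0 pabs_mult[OF prime_p])

text \<open>A double factorial in the denominator costs more than the expected power of
  \<open>p\<close> only if the last digit of the index exceeds that of \<open>M\<close> or
  \<open>M'\<close>, and then Lucas puts a compensating \<open>p\<close> into the binomial
  coefficient.\<close>

lemma pabs_coeff_hermite_wr_even_quotient:
  assumes bounds: "2 * M \<le> p ^ 2" "2 * M' + 2 \<le> p ^ 2" and M: "M mod p \<le> h" and M': "M' mod p < h"
  shows "pabs p (coeff (hermite_wr M M') (2 * i)) \<le> pabs p (coeff (hermite_wr M M') 0) * 2 ^ (i div p)"
proof (rule pabs_coeff_hermite_wr_le)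
  have half: "pabs p (int (N choose l)) * 2 ^ Suc q \<le> 2 ^ q" if "N mod p < l mod p" for N l q
  proof -
    have "pabs p (int (N choose l)) \<le> 1 / 2"
      using prime_dvd_binomial_of_mod_less[OF prime_p that] by (simp only: pabs_le_half_iff[OF prime_p] int_dvd_int_iff)
    from mult_right_mono[OF this, of "2 ^ Suc q"] show ?thesis by simp
  qed
  have one: "pabs p (int (N choose l)) * 2 ^ q \<le> 2 ^ q" for N l q
    by (simp add: mult_left_le_one_le)
  have E: "pabs p (even_coeff M l) \<le> pabs p (even_coeff M 0) * 2 ^ (l div p)" for l
  proof -
    have "pabs p (int (M choose l)) * 2 ^ ((l + h) div p) \<le> 2 ^ (l div p)"
      using div_add_carry[of h l] half[of M l "l div p"] one[of M l] M h_pos p_eq by (auto split: if_splits)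
    from mult_left_mono[OF this, of "pabs p (even_coeff M 0)"] show ?thesis
      unfolding pabs_even_coeff[OF bounds(1), of l] by (simp add: mult_ac)
  qed
  have O: "pabs p (odd_coeff M' l) \<le> pabs p (odd_coeff M' 0) * 2 ^ (l div p)" for l
  proof -
    have "pabs p (int (M' choose l)) * 2 ^ ((l + 1 + h) div p) \<le> 2 ^ (l div p)"
      using div_add_carry[of "1 + h" l] half[of M' l "l div p"] one[of M' l] M' h_pos p_eq by (auto split: if_splits)
    from mult_left_mono[OF this, of "pabs p (odd_coeff M' 0)"] show ?thesis
      unfolding pabs_odd_coeff[OF bounds(2), of l] by (simp add: mult_ac)
  qed
  fix l j :: nat assume lj: "l + j = i"
  have "pabs p (2 * int j + 1 - 2 * int l) * (pabs p (even_coeff M l) * pabs p (odd_coeff M' j)) \<le>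
      1 * ((pabs p (even_coeff M 0) * 2 ^ (l div p)) * (pabs p (odd_coeff M' 0) * 2 ^ (j div p)))"
    using E O by (intro mult_mono) auto
  also have "\<dots> = pabs p (coeff (hermite_wr M M') 0) * 2 ^ (l div p + j div p)"
    by (simp add: pabs_coeff_hermite_wr_0 power_add mult_ac)
  also have "\<dots> \<le> pabs p (coeff (hermite_wr M M') 0) * 2 ^ (i div p)"
    using div_add_div_le[of l p j] lj by (intro mult_left_mono power_increasing) auto
  finally show "pabs p (2 * int j + 1 - 2 * int l) * (pabs p (even_coeff M l) * pabs p (odd_coeff M' j)) \<le>
    pabs p (coeff (hermite_wr M M') 0) * 2 ^ (i div p)" .
qed simp

lemma pabs_hermite_wr_term_le:
  assumes bounds: "2 * M \<le> p ^ 2" "2 * M' + 2 \<le> p ^ 2"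
  shows "pabs p (even_coeff M l) * pabs p (odd_coeff M' j) \<le>
    pabs p (coeff (hermite_wr M M') 0) * 2 ^ ((l + h) div p + (j + 1 + h) div p)"
proof -
  have "pabs p (even_coeff M l) \<le> 1 * pabs p (even_coeff M 0) * 2 ^ ((l + h) div p)"
    unfolding pabs_even_coeff[OF bounds(1), of l] by (intro mult_right_mono) auto
  moreover have "pabs p (odd_coeff M' j) \<le> 1 * pabs p (odd_coeff M' 0) * 2 ^ ((j + 1 + h) div p)"
    unfolding pabs_odd_coeff[OF bounds(2), of j] by (intro mult_right_mono) auto
  ultimately have "pabs p (even_coeff M l) * pabs p (odd_coeff M' j) \<le>
     (1 * pabs p (even_coeff M 0) * 2 ^ ((l + h) div p)) * (1 * pabs p (odd_coeff M' 0) * 2 ^ ((j + 1 + h) div p))"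
    by (intro mult_mono) auto
  thus ?thesis by (simp add: pabs_coeff_hermite_wr_0 power_add mult_ac)
qed

text \<open>Without digit conditions the two double factorials may cost one further factor
  \<open>p\<close>, because the two shifted indices l + h and j + 1 + h add up to i + p.\<close>

lemma pabs_coeff_hermite_wr_odd_quotient:
  assumes bounds: "2 * M \<le> p ^ 2" "2 * M' + 2 \<le> p ^ 2"
  shows "pabs p (coeff (hermite_wr M M') (2 * i)) \<le> pabs p (coeff (hermite_wr M M') 0) * 2 ^ (1 + i div p)"
proof (rule pabs_coeff_hermite_wr_le)
  fix l j :: nat assume lj: "l + j = i"
  have p: "p > 0" using p_eq by simp
  have "(l + h) div p + (j + 1 + h) div p \<le> (l + h + (j + 1 + h)) div p"
    by (rule div_add_div_le)
  also have "l + h + (j + 1 + h) = i + p" using lj p_eq by simp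
  also have "(i + p) div p = 1 + i div p" using p by simp
  finally have exp_le: "(l + h) div p + (j + 1 + h) div p \<le> 1 + i div p" .
  have "pabs p (2 * int j + 1 - 2 * int l) * (pabs p (even_coeff M l) * pabs p (odd_coeff M' j)) \<le>
      1 * (pabs p (coeff (hermite_wr M M') 0) * 2 ^ ((l + h) div p + (j + 1 + h) div p))"
    by (intro mult_mono pabs_hermite_wr_term_le bounds) auto
  also have "\<dots> \<le> 1 * (pabs p (coeff (hermite_wr M M') 0) * 2 ^ (1 + i div p))"
    using exp_le by (intro mult_left_mono power_increasing) auto
  finally show "pabs p (2 * int j + 1 - 2 * int l) * (pabs p (even_coeff M l) * pabs p (odd_coeff M' j)) \<le>
    pabs p (coeff (hermite_wr M M') 0) * 2 ^ (1 + i div p)" by simp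
qed simp

text \<open>The only loss occurs for l = 0, j = h, where (2j + 1)!! contains \<open>p\<close>; the
  weight 2j + 1 - 2l of that term is \<open>p\<close> itself and restores it.\<close>

lemma pabs_coeff_hermite_wr_low:
  assumes bounds: "2 * M \<le> p ^ 2" "2 * M' + 2 \<le> p ^ 2" and i: "i \<le> h"
  shows "pabs p (coeff (hermite_wr M M') (2 * i)) \<le> pabs p (coeff (hermite_wr M M') 0)"
proof (rule pabs_coeff_hermite_wr_le)
  fix l j :: nat assume lj: "l + j = i"
  show "pabs p (2 * int j + 1 - 2 * int l) * (pabs p (even_coeff M l) * pabs p (odd_coeff M' j)) \<le>
    pabs p (coeff (hermite_wr M M') 0)"
  proof (cases "j = h")
    case True
    hence "2 * int j + 1 - 2 * int l = int p" using lj i p_eq by simp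
    hence half: "pabs p (2 * int j + 1 - 2 * int l) = 1 / 2" using pabs_p[OF prime_p] by simp
    have "(l + h) div p = 0" using True lj i p_eq by auto
    moreover have "j + 1 + h = p" using True p_eq by simp
    hence "(j + 1 + h) div p = 1" using p_pos by simp
    ultimately have "pabs p (even_coeff M l) * pabs p (odd_coeff M' j) \<le> pabs p (coeff (hermite_wr M M') 0) * 2"
      using pabs_hermite_wr_term_le[OF bounds, of l j] by simp
    thus ?thesis unfolding half by simp
  next
    case False
    have "(l + h) div p = 0" "(j + 1 + h) div p = 0" using False lj i p_eq by auto
    hence "pabs p (even_coeff M l) * pabs p (odd_coeff M' j) \<le> pabs p (coeff (hermite_wr M M') 0)"
      using pabs_hermite_wr_term_le[OF bounds, of l j] by simp
    hence "pabs p (2 * int j + 1 - 2 * int l) * (pabs p (even_coeff M l) * pabs p (odd_coeff M' j)) \<le>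
        1 * pabs p (coeff (hermite_wr M M') 0)"
      by (intro mult_mono) auto
    thus ?thesis by simp
  qed
qed simp

text \<open>The term l = h + 1, j = h is the only one for which both (2l - 1)!! and (2j + 1)!!
  contain \<open>p\<close>. Its weight is -1 and the digit conditions make its binomial coefficients
  units, so it dominates all others.\<close>

lemma pabs_coeff_hermite_wr_2p:
  assumes bounds: "2 * M \<le> p ^ 2" "2 * M' + 2 \<le> p ^ 2" and M: "h + 1 \<le> M mod p" and M': "h \<le> M' mod p"
  shows "pabs p (coeff (hermite_wr M M') (2 * p)) = 4 * pabs p (coeff (hermite_wr M M') 0)"
proof -
  let ?t = "\<lambda>l. (2 * int p + 1 - 4 * int l) * (even_coeff M l * odd_coeff M' (p - l))"
  let ?c = "pabs p (coeff (hermite_wr M M') 0)"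
  have c: "?c > 0" by (simp add: coeff_hermite_wr_0)
  have idx: "2 * int p + 1 - 4 * int (h + 1) = - 1" "p - (h + 1) = h" using p_eq by auto
  have "?t (h + 1) = - (even_coeff M (h + 1) * odd_coeff M' h)" unfolding idx by simp
  hence "pabs p (?t (h + 1)) = pabs p (even_coeff M (h + 1)) * pabs p (odd_coeff M' h)"
    by (simp only: pabs_uminus pabs_mult[OF prime_p])
  moreover have "pabs p (int (M choose (h + 1))) = 1"
    using prime_not_dvd_binomial[OF prime_p M]
    by (simp only: pabs_eq_1_iff[OF prime_p] int_dvd_int_iff not_False_eq_True)
  moreover have "pabs p (int (M' choose h)) = 1"
    using prime_not_dvd_binomial[OF prime_p M']
    by (simp only: pabs_eq_1_iff[OF prime_p] int_dvd_int_iff not_False_eq_True)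
  moreover have "h + 1 + h = p" using p_eq by simp
  hence "(h + 1 + h) div p = 1" using p_pos by simp
  ultimately have main: "pabs p (?t (h + 1)) = 4 * ?c"
    using pabs_even_coeff[OF bounds(1), of "h + 1"] pabs_odd_coeff[OF bounds(2), of h]
    by (simp only: pabs_coeff_hermite_wr_0) simp
  have other: "pabs p (?t l) < pabs p (?t (h + 1))" if l: "l \<in> {..p}" "l \<noteq> h + 1" for l
  proof -
    have "(l + h) div p + (p - l + 1 + h) div p \<le> 1"
    proof (cases "l \<le> h")
      case True
      hence "(l + h) div p = 0" "(p - l + 1 + h) div p < 2"
        using p_eq h_pos by (auto simp: div_less_iff_less_mult)
      thus ?thesis by simp
    next
      case False
      hence "(l + h) div p < 2" "(p - l + 1 + h) div p = 0"
        using p_eq l by (auto simp: div_less_iff_less_mult)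
      thus ?thesis by simp
    qed
    hence "?c * 2 ^ ((l + h) div p + (p - l + 1 + h) div p) \<le> ?c * 2 ^ 1"
      by (intro mult_left_mono power_increasing) auto
    hence "pabs p (even_coeff M l) * pabs p (odd_coeff M' (p - l)) \<le> 2 * ?c"
      using pabs_hermite_wr_term_le[OF bounds, of l "p - l"] by simp
    hence "pabs p (?t l) \<le> 1 * (2 * ?c)"
      unfolding pabs_hermite_wr_term by (rule mult_mono[OF pabs_le_1]) simp_all
    thus ?thesis using main c by linarith
  qed
  have "pabs p (sum ?t {..p}) = pabs p (?t (h + 1))"
    using other p_eq by (intro pabs_sum_eq_term[OF prime_p]) auto
  thus ?thesis unfolding coeff_hermite_wr_even main .
qed

lemma pabs_coeff_hermite_wr_fact:
  "pabs p (coeff (hermite_wr M M') (2 * i)) * pabs p (fact (2 * i)) \<le> pabs p (coeff (hermite_wr M M') 0)"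
proof -
  let ?c = "pabs p (coeff (hermite_wr M M') 0)"
  have le1: "pabs p (a * b) \<le> pabs p b" for a b
    by (simp add: pabs_mult[OF prime_p] mult_left_le_one_le)
  have E: "pabs p (even_coeff M l) * pabs p (fact (2 * l)) \<le> pabs p (even_coeff M 0)" for l
  proof -
    have "pabs p (even_coeff M l) * pabs p (fact (2 * l)) \<le> pabs p (even_coeff M l) * pabs p (odd_prod 0 l)"
      by (intro mult_left_mono pabs_dvd_le[OF prime_p] odd_prod_dvd_fact) auto
    also have "\<dots> \<le> pabs p (even_coeff M 0)"
      unfolding pabs_even_coeff_odd_prod by (simp add: mult_left_le_one_le)
    finally show ?thesis .
  qed
  have O: "pabs p (odd_coeff M' j) * pabs p (fact (2 * j + 1)) \<le> pabs p (odd_coeff M' 0)" for j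
  proof -
    have "pabs p (odd_coeff M' j) * pabs p (fact (2 * j + 1)) \<le> pabs p (odd_coeff M' j) * pabs p (odd_prod 0 (Suc j))"
      by (intro mult_left_mono pabs_dvd_le[OF prime_p] odd_prod_dvd_fact) auto
    also have "\<dots> \<le> pabs p (odd_coeff M' 0)"
      unfolding pabs_odd_coeff_odd_prod by (simp add: mult_left_le_one_le)
    finally show ?thesis .
  qed
  \<comment> \<open>With i = l + j the quotient is the difference of the binomial coefficients 2i
    over 2l and 2i over 2l - 1. The Wronskian weight is thus what makes the factorial of 2i suffice
    where that of 2i + 1 would be expected.\<close>
  have key: "fact (2 * l) * fact (2 * j + 1) dvd fact (2 * (l + j)) * (2 * int j + 1 - 2 * int l)" for l j
  proof -
    have "fact (2 * l) * fact (2 * j) * ((2 * (l + j)) choose (2 * l)) = (fact (2 * (l + j)) :: nat)"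
      using binomial_fact_lemma[of "2 * l" "2 * (l + j)"] by (simp add: algebra_simps)
    hence "int (fact (2 * l) * fact (2 * j) * ((2 * (l + j)) choose (2 * l))) = int (fact (2 * (l + j)))"
      by (simp only:)
    hence "(fact (2 * l) * fact (2 * j + 1)) * int ((2 * (l + j)) choose (2 * l)) = fact (2 * (l + j)) * (2 * int j + 1)"
      by (simp add: algebra_simps)
    hence 1: "(fact (2 * l) * fact (2 * j + 1)) dvd fact (2 * (l + j)) * (2 * int j + 1)"
      by (metis dvd_triv_left)
    have 2: "(fact (2 * l) * fact (2 * j + 1)) dvd fact (2 * (l + j)) * (2 * int l)"
    proof (cases l)
      case (Suc l')
      have "fact (2 * l' + 1) * fact (2 * j + 1) * ((2 * (l + j)) choose (2 * l' + 1)) = (fact (2 * (l + j)) :: nat)"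
        using binomial_fact_lemma[of "2 * l' + 1" "2 * (l + j)"] Suc by (simp add: algebra_simps del: fact_Suc)
      hence "int (fact (2 * l' + 1) * fact (2 * j + 1) * ((2 * (l + j)) choose (2 * l' + 1))) = int (fact (2 * (l + j)))"
        by (simp only:)
      moreover have "(fact (2 * l) :: int) = (2 * int l) * fact (2 * l' + 1)" unfolding Suc by simp
      ultimately have "(fact (2 * l) * fact (2 * j + 1)) * int ((2 * (l + j)) choose (2 * l' + 1)) = fact (2 * (l + j)) * (2 * int l)"
        by (simp add: mult_ac del: fact_Suc)
      thus ?thesis by (metis dvd_triv_left)
    qed simp
    show ?thesis using dvd_diff[OF 1 2] by (simp add: algebra_simps)
  qed
  have "pabs p (\<Sum>l\<le>i. (2 * int i + 1 - 4 * int l) * (even_coeff M l * odd_coeff M' (i - l)) * fact (2 * i)) \<le> ?c"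
  proof (rule pabs_sum_le[OF prime_p])
    fix l assume l: "l \<in> {..i}"
    define j where "j = i - l"
    have w: "2 * int i + 1 - 4 * int l = 2 * int j + 1 - 2 * int l" and i: "i = l + j"
      using l by (auto simp: j_def of_nat_diff)
    have "pabs p ((2 * int i + 1 - 4 * int l) * (even_coeff M l * odd_coeff M' (i - l)) * fact (2 * i)) =
        pabs p (even_coeff M l * odd_coeff M' j) * pabs p (fact (2 * (l + j)) * (2 * int j + 1 - 2 * int l))"
      unfolding w unfolding i by (simp add: pabs_mult[OF prime_p] mult_ac)
    also have "\<dots> \<le> pabs p (even_coeff M l * odd_coeff M' j) * pabs p (fact (2 * l) * fact (2 * j + 1))"
      by (intro mult_left_mono pabs_dvd_le[OF prime_p] key) auto
    also have "\<dots> = (pabs p (even_coeff M l) * pabs p (fact (2 * l))) * (pabs p (odd_coeff M' j) * pabs p (fact (2 * j + 1)))"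
      by (simp only: pabs_mult[OF prime_p] mult_ac)
    also have "\<dots> \<le> pabs p (even_coeff M 0) * pabs p (odd_coeff M' 0)"
      by (intro mult_mono E O) auto
    finally show "pabs p ((2 * int i + 1 - 4 * int l) * (even_coeff M l * odd_coeff M' (i - l)) * fact (2 * i)) \<le> ?c"
      unfolding pabs_coeff_hermite_wr_0 .
  qed simp
  thus ?thesis
    unfolding coeff_hermite_wr_even sum_distrib_right[symmetric] pabs_mult[OF prime_p] .
qed

text \<open>This reflects the congruence of He_(Kp+r) and x^(Kp) He_r modulo p. Either an odd
  multiple of \<open>p\<close>, namely Kp or (K-1)p, is a factor of \<open>odd_prod l M\<close>, or
  the last digit of \<open>l\<close> exceeds that of \<open>M\<close> and Lucas applies.\<close>

lemma dvd_even_coeff: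
  assumes K: "K \<ge> 1" and M: "2 * M = K * p + r" "r < p" and l: "2 * l < K * p"
  shows "int p dvd even_coeff M l"
proof -
  have "p dvd (M choose l) \<or> int p dvd odd_prod l M"
  proof (cases "even K")
    case False
    have "odd (K * p)" using False p_eq by simp
    then obtain i where i: "K * p = 2 * i + 1" by (rule oddE)
    have "r \<noteq> 0" using M(1) i by presburger
    hence "l \<le> i" "i < M" using i l M by auto
    moreover have "int p dvd int (2 * i + 1)" unfolding i[symmetric] by simp
    ultimately show ?thesis by (blast intro: dvd_odd_prod)
  next
    case True
    then obtain K' where K': "K = 2 * K'" by auto
    show ?thesis
    proof (cases "2 * l + 1 \<le> (K - 1) * p")
      case True
      have "odd ((K - 1) * p)" using K K' p_eq by simp
      then obtain i where i: "(K - 1) * p = 2 * i + 1" by (rule oddE)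
      have "(K - 1) * p \<le> K * p" by (rule mult_le_mono1) simp
      hence "l \<le> i" "i < M" using i True M by linarith+
      moreover have "int p dvd int (2 * i + 1)" unfolding i[symmetric] by simp
      ultimately show ?thesis by (blast intro: dvd_odd_prod)
    next
      case False
      obtain s where s: "r = 2 * s" using M(1) K' by (metis dvd_add_right_iff dvd_triv_left evenE mult.assoc)
      have MK: "M = K' * p + s" using M(1) K' s by simp
      have "s < p" using M(2) s by simp
      hence "M mod p = s" unfolding MK by simp
      obtain K'' where K'': "K' = Suc K''" using K K' by (cases K') auto
      define y where "y = l - K'' * p"
      have "(K - 1) * p = 2 * (K'' * p) + p" unfolding K' K'' by (simp add: algebra_simps)
      hence "2 * l \<ge> 2 * (K'' * p) + p" using False by linarith
      hence y: "l = K'' * p + y" "2 * y \<ge> p" by (auto simp: y_def)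
      have "2 * y < 2 * p" using l unfolding y(1) K' K'' by (simp add: algebra_simps)
      hence "l mod p = y" unfolding y(1) by simp
      moreover have "s < y" using M(2) s y(2) by linarith
      ultimately have "M mod p < l mod p" using \<open>M mod p = s\<close> by simp
      thus ?thesis using prime_dvd_binomial_of_mod_less[OF prime_p] by blast
    qed
  qed
  thus ?thesis unfolding even_coeff_def by (auto intro: dvd_mult dvd_mult2)
qed

lemma dvd_odd_coeff:
  assumes K: "K \<ge> 1" and M: "2 * M + 1 = K * p + r" "r < p" and l: "2 * l + 1 < K * p"
  shows "int p dvd odd_coeff M l"
proof -
  have "p dvd (M choose l) \<or> int p dvd odd_prod (Suc l) (Suc M)"
  proof (cases "even K")
    case False
    have "odd (K * p)" using False p_eq by simp
    then obtain i where i: "K * p = 2 * i + 1" by (rule oddE)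
    have "Suc l \<le> i" "i < Suc M" using i l M by auto
    moreover have "int p dvd int (2 * i + 1)" unfolding i[symmetric] by simp
    ultimately show ?thesis by (blast intro: dvd_odd_prod)
  next
    case True
    then obtain K' where K': "K = 2 * K'" by auto
    show ?thesis
    proof (cases "2 * l + 3 \<le> (K - 1) * p")
      case True
      have "odd ((K - 1) * p)" using K K' p_eq by simp
      then obtain i where i: "(K - 1) * p = 2 * i + 1" by (rule oddE)
      have "(K - 1) * p \<le> K * p" by (rule mult_le_mono1) simp
      hence "Suc l \<le> i" "i < Suc M" using i True M by linarith+
      moreover have "int p dvd int (2 * i + 1)" unfolding i[symmetric] by simp
      ultimately show ?thesis by (blast intro: dvd_odd_prod)
    next
      case False
      have "odd r" using M(1) K' by (metis even_plus_one_iff even_add dvd_mult2 dvd_triv_left)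
      then obtain s where s: "r = 2 * s + 1" by (auto elim: oddE)
      have MK: "M = K' * p + s" using M(1) K' s by simp
      have "s < p" using M(2) s by simp
      hence "M mod p = s" unfolding MK by simp
      obtain K'' where K'': "K' = Suc K''" using K K' by (cases K') auto
      define y where "y = l - K'' * p"
      have "(K - 1) * p = 2 * (K'' * p) + p" unfolding K' K'' by (simp add: algebra_simps)
      hence ge: "2 * l + 2 \<ge> 2 * (K'' * p) + p" using False by linarith
      moreover have "p \<ge> 2" using prime_p prime_ge_2_nat by blast
      ultimately have y: "l = K'' * p + y" by (simp add: y_def)
      have y2: "2 * y + 2 \<ge> p" using ge unfolding y by simp
      have "2 * y < 2 * p" using l unfolding y(1) K' K'' by (simp add: algebra_simps)
      hence "l mod p = y" unfolding y(1) by simp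
      moreover have "s < y" using M(2) s y2 p_eq by arith
      ultimately have "M mod p < l mod p" using \<open>M mod p = s\<close> by simp
      thus ?thesis using prime_dvd_binomial_of_mod_less[OF prime_p] by blast
    qed
  qed
  thus ?thesis unfolding odd_coeff_def by (auto intro: dvd_mult dvd_mult2)
qed

lemma dvd_coeff_hermite_wr:
  assumes K: "K \<ge> 1" and M: "2 * M = K * p + r" "r < p" and M': "2 * M' + 1 = K * p + r'" "r' < p"
    and i: "i < 2 * (K * p)"
  shows "int p dvd coeff (hermite_wr M M') i"
proof (cases "even i")
  case False
  thus ?thesis by (simp add: coeff_hermite_wr_odd)
next
  case True
  then obtain m where m: "i = 2 * m" by auto
  show ?thesis unfolding m coeff_hermite_wr_even
  proof (rule dvd_sum, rule dvd_mult)
    fix l assume "l \<in> {..m}"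
    hence "2 * l < K * p \<or> 2 * (m - l) + 1 < K * p" using i m by auto
    thus "int p dvd even_coeff M l * odd_coeff M' (m - l)"
      using dvd_even_coeff[OF K M] dvd_odd_coeff[OF K M'] by auto
  qed
qed

end

lemma multiplicity_of_nat_int: "multiplicity (int p) (int m) = multiplicity p m"
proof -
  have "{n. int p ^ n dvd int m} = {n. p ^ n dvd m}"
    by (simp flip: of_nat_power)
  thus ?thesis by (simp add: multiplicity_def)
qed

section \<open>The Wronskian of two consecutive Hermite polynomials\<close>

definition wr :: "nat \<Rightarrow> int poly" where
  "wr n = hermiteHe n * pderiv (hermiteHe (Suc n)) - pderiv (hermiteHe n) * hermiteHe (Suc n)"

lemma wr_even: "wr (2 * M) = hermite_wr M M"
  by (simp add: wr_def hermite_wr_def)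

lemma wr_odd: "wr (2 * M + 1) = - hermite_wr (Suc M) M"
  by (simp add: wr_def hermite_wr_def mult.commute)

lemma coeff_wr_odd: "odd i \<Longrightarrow> coeff (wr n) i = 0"
  by (cases "even n") (auto elim!: evenE oddE simp: wr_even wr_odd[unfolded Suc_eq_plus1[symmetric]] coeff_hermite_wr_odd simp del: hermiteHe.simps)

lemma coeff_wr_0_pos: "coeff (wr n) 0 > 0"
proof (cases "even n")
  case True
  then obtain M where M: "n = 2 * M" by (rule evenE)
  have "coeff (wr n) 0 = (-1) ^ (2 * M) * (odd_prod 0 M * odd_prod (Suc 0) (Suc M))"
    unfolding M wr_even coeff_hermite_wr_0 even_coeff_def odd_coeff_def by (simp add: power_add[symmetric] mult_2 mult_ac)
  thus ?thesis by simp
next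
  case False
  then obtain M where M: "n = 2 * M + 1" by (rule oddE)
  have "coeff (wr n) 0 = (-1) ^ (2 * M) * (odd_prod 0 (Suc M) * odd_prod (Suc 0) (Suc M))"
    unfolding M wr_odd coeff_minus coeff_hermite_wr_0 even_coeff_def odd_coeff_def by (simp add: power_add[symmetric] mult_2 mult_ac)
  thus ?thesis by simp
qed

lemma coeff_hermiteHe_beyond_and_lead:
  "(\<forall>a>n. coeff (hermiteHe n) a = 0) \<and> coeff (hermiteHe n) n = 1"
proof (induction n rule: hermiteHe.induct)
  case (3 k)
  have "coeff (hermiteHe (Suc (Suc k))) (Suc a) = (if a = Suc k then 1 else 0)" if "a \<ge> Suc k" for a
    using 3 that by (simp add: coeff_hermiteHe_Suc_Suc_Suc del: hermiteHe.simps)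
  note key = this
  show ?case
  proof (intro conjI allI impI)
    fix a assume "a > Suc (Suc k)"
    then obtain b where "a = Suc b" "b > Suc k" by (cases a) auto
    thus "coeff (hermiteHe (Suc (Suc k))) a = 0" using key[of b] by (simp del: hermiteHe.simps)
  qed (use key[of "Suc k"] in \<open>simp del: hermiteHe.simps\<close>)
qed (auto simp: coeff_pCons split: nat.splits)

lemma degree_wr: "degree (wr n) = 2 * n" and lead_coeff_wr: "lead_coeff (wr n) = 1"
proof -
  note beyond = conjunct1[OF coeff_hermiteHe_beyond_and_lead, rule_format]
    and lead = conjunct2[OF coeff_hermiteHe_beyond_and_lead]
  have top: "coeff (wr n) m = (if m = 2 * n then 1 else 0)" if m: "m \<ge> 2 * n" for m
  proof -
    let ?t = "\<lambda>a. (int (Suc m) - 2 * int a) * (coeff (hermiteHe n) a * coeff (hermiteHe (Suc n)) (Suc m - a))"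
    have zero: "?t a = 0" if "a \<noteq> n \<or> m > 2 * n" for a
    proof -
      have "a > n \<or> Suc m - a > Suc n" using that m by auto
      thus ?thesis using beyond by auto
    qed
    have "coeff (wr n) m = sum ?t {..Suc m}"
      unfolding wr_def coeff_wronskian ..
    also have "\<dots> = sum ?t {n}"
      using zero m by (intro sum.mono_neutral_right) auto
    also have "\<dots> = (if m = 2 * n then 1 else 0)"
    proof (cases "m = 2 * n")
      case True
      hence "Suc m - n = Suc n" by simp
      thus ?thesis using True lead[of n] lead[of "Suc n"] by simp
    next
      case False
      thus ?thesis using zero[of n] m by simp
    qed
    finally show ?thesis .
  qed
  show deg: "degree (wr n) = 2 * n"
    using top by (intro antisym degree_le le_degree) auto
  show "lead_coeff (wr n) = 1" unfolding deg using top by simp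
qed

section \<open>From the general definitions to the partition (n, n)\<close>

lemma det_2x2: "det (mat 2 2 f) = f (0, 0) * f (1, 1) - f (0, 1) * (f (1, 0) :: 'a :: comm_ring_1)"
proof -
  have "det (mat 2 2 f) = (\<Sum>i<2. mat 2 2 f $$ (i, 0) * cofactor (mat 2 2 f) i 0)"
    by (rule laplace_expansion_column) auto
  also have "\<dots> = f (0, 0) * f (1, 1) - f (1, 0) * f (0, 1)"
    by (simp add: numeral_2_eq_2 cofactor_def mat_delete_def det_single)
  finally show ?thesis by (simp add: mult.commute)
qed

lemma wronskianHe_n_n: "wronskianHe [n, n] = wr n"
proof -
  have deg: "degseq [n, n] = [n, Suc n]"
    by (simp add: degseq_def numeral_2_eq_2)
  have "vandermonde [n, Suc n] = 1"
    by (simp add: vandermonde_def numeral_2_eq_2 lessThan_Suc)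
  moreover have "wronskian (map hermiteHe [n, Suc n]) = wr n"
    unfolding wronskian_def wr_def
    by (simp add: numeral_2_eq_2[symmetric] det_2x2 mult.commute del: hermiteHe.simps)
  ultimately show ?thesis
    unfolding wronskianHe_def deg by (simp add: Let_def map_poly_id' del: hermiteHe.simps)
qed

text \<open>Removing a 2-hook preserves parities, so the degree set always consists of one even and
  one odd number. The only such set without a removable hook is {0, 1}; it is reached because every
  removal lowers the sum.\<close>

lemma core2_size_n_n: "core2_size [n, n] = 0"
proof -
  have deg: "set (degseq [n, n]) = {n, Suc n}"
    by (simp add: degseq_def numeral_2_eq_2)
  define I where "I = (\<lambda>S :: nat set. \<exists>a b. S = {a, b} \<and> even a \<and> odd b)"
  have I_step: "I T" if IS: "I S" and RS: "remove_2hook S T" for S T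
  proof -
    obtain a b where ab: "S = {a, b}" "even a" "odd b" using IS unfolding I_def by blast
    obtain c where c: "c \<in> S" "2 \<le> c" "T = insert (c - 2) (S - {c})"
      using RS unfolding remove_2hook_def by blast
    have "a \<noteq> b" using ab by auto
    have "c = a \<or> c = b" using c ab by simp
    thus ?thesis
    proof
      assume "c = a"
      hence "T = {a - 2, b}" using c(3) ab(1) \<open>a \<noteq> b\<close> by auto
      moreover have "even (a - 2)" using ab(2) by simp
      ultimately show ?thesis unfolding I_def using ab(3) by blast
    next
      assume "c = b"
      hence "T = {a, b - 2}" using c(3) ab(1) \<open>a \<noteq> b\<close> by auto
      moreover have "odd (b - 2)" using ab(3) c(2) \<open>c = b\<close> by simp
      ultimately show ?thesis unfolding I_def using ab(2) by blast
    qed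
  qed
  have I_reach: "I T" if "remove_2hook\<^sup>*\<^sup>* {n, Suc n} T" for T
    using that
  proof (induction rule: rtranclp_induct)
    case base
    show ?case
    proof (cases "even n")
      case True
      thus ?thesis unfolding I_def by (intro exI[of _ n] exI[of _ "Suc n"] conjI) simp_all
    next
      case False
      thus ?thesis
        unfolding I_def by (intro exI[of _ "Suc n"] exI[of _ n] conjI insert_commute) simp_all
    qed
  qed (use I_step in blast)
  have terminal: "T = {0, 1}" if IT: "I T" and final: "\<nexists>U. remove_2hook T U" for T
  proof -
    obtain a b where ab: "T = {a, b}" "even a" "odd b" using IT unfolding I_def by blast
    have "a < 2"
    proof (rule ccontr)
      assume "\<not> a < 2"
      have "even (a - 2)" using ab(2) by simp
      hence "a - 2 \<noteq> b" using ab(3) by blast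
      hence "a - 2 \<notin> T" using ab(1) \<open>\<not> a < 2\<close> by simp
      moreover have "a \<in> T" "2 \<le> a" using ab(1) \<open>\<not> a < 2\<close> by simp_all
      ultimately have "remove_2hook T (insert (a - 2) (T - {a}))"
        unfolding remove_2hook_def by blast
      thus False using final by blast
    qed
    moreover have "b < 2"
    proof (rule ccontr)
      assume "\<not> b < 2"
      have "odd (b - 2)" using ab(3) \<open>\<not> b < 2\<close> by simp
      hence "b - 2 \<noteq> a" using ab(2) by blast
      hence "b - 2 \<notin> T" using ab(1) \<open>\<not> b < 2\<close> by simp
      moreover have "b \<in> T" "2 \<le> b" using ab(1) \<open>\<not> b < 2\<close> by simp_all
      ultimately have "remove_2hook T (insert (b - 2) (T - {b}))"
        unfolding remove_2hook_def by blast
      thus False using final by blast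
    qed
    ultimately have "a = 0" "b = 1" using ab(2,3) less_2_cases[of a] less_2_cases[of b] by auto
    thus ?thesis using ab by simp
  qed
  have exists: "\<exists>T. remove_2hook\<^sup>*\<^sup>* S T \<and> (\<nexists>U. remove_2hook T U)" if "I S" for S
    using that
  proof (induction "\<Sum>S" arbitrary: S rule: less_induct)
    case less
    show ?case
    proof (cases "\<exists>U. remove_2hook S U")
      case True
      then obtain U where U: "remove_2hook S U" by blast
      then obtain a where a: "a \<in> S" "2 \<le> a" "a - 2 \<notin> S" "U = insert (a - 2) (S - {a})"
        unfolding remove_2hook_def by blast
      have fin: "finite S" using less.prems unfolding I_def by auto
      have "\<Sum>U = (a - 2) + \<Sum>(S - {a})" using fin a by simp
      also have "\<dots> < a + \<Sum>(S - {a})" using a by simp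
      also have "\<dots> = \<Sum>S" by (rule sum.remove[OF fin a(1), symmetric])
      finally have "\<exists>T. remove_2hook\<^sup>*\<^sup>* U T \<and> (\<nexists>V. remove_2hook T V)"
        using less.prems U I_step by (intro less.hyps) auto
      thus ?thesis using U by (meson converse_rtranclp_into_rtranclp)
    qed blast
  qed
  have size: "size_of_degset {0, 1} = 0" by (simp add: size_of_degset_def)
  have "I {n, Suc n}" by (rule I_reach) simp
  then obtain T where T: "remove_2hook\<^sup>*\<^sup>* {n, Suc n} T" "\<nexists>U. remove_2hook T U" using exists by blast
  have "T = {0, 1}" using terminal[OF I_reach[OF T(1)] T(2)] .
  show ?thesis
    unfolding core2_size_def deg
  proof (rule the_equality)
    show "\<exists>T. remove_2hook\<^sup>*\<^sup>* {n, Suc n} T \<and> (\<nexists>U. remove_2hook T U) \<and> 0 = size_of_degset T"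
    proof (intro exI conjI)
      show "0 = size_of_degset T" unfolding \<open>T = {0, 1}\<close> size ..
    qed (rule T)+
  next
    fix k assume "\<exists>T. remove_2hook\<^sup>*\<^sup>* {n, Suc n} T \<and> (\<nexists>U. remove_2hook T U) \<and> k = size_of_degset T"
    then obtain T' where T': "remove_2hook\<^sup>*\<^sup>* {n, Suc n} T'" "\<nexists>U. remove_2hook T' U"
      and k: "k = size_of_degset T'" by (elim exE conjE)
    have "T' = {0, 1}" by (rule terminal[OF I_reach[OF T'(1)] T'(2)])
    thus "k = 0" unfolding k by (simp only: size)
  qed
qed

lemma remainderR_n_n: "remainderR [n, n] = wr n"
  by (simp add: remainderR_def wronskianHe_n_n core2_size_n_n flip: one_poly_eq_simps)

text \<open>Converts valuation drops into comparisons of \<open>gauss_term\<close>: coefficient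
  \<open>i\<close> is at most \<open>d\<close> below the valuation of the reference
  \<open>c\<close>, coefficient \<open>i'\<close> exactly \<open>d'\<close> below, and only the
  exponents N d + i' and N d' + i matter.\<close>

lemma weighted_power_less:
  fixes c :: real
  assumes "0 < c" "N * d + i' < N * d' + i" "x \<le> c * 2 ^ d" "0 \<le> x"
  shows "x ^ N * (1 / 2) ^ i < (c * 2 ^ d') ^ N * (1 / 2) ^ i'"
proof -
  have "(2::real) ^ (N * d + i') < 2 ^ (N * d' + i)" using assms(2) by simp
  hence "((2::real) ^ d) ^ N * 2 ^ i' < (2 ^ d') ^ N * 2 ^ i"
    by (simp only: power_add power_mult[symmetric] mult.commute[of N])
  hence *: "((2::real) ^ d) ^ N * (1 / 2) ^ i < (2 ^ d') ^ N * (1 / 2) ^ i'"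
    by (simp add: power_divide field_simps)
  have "x ^ N * (1 / 2) ^ i \<le> (c * 2 ^ d) ^ N * (1 / 2) ^ i"
    using assms by (intro mult_right_mono power_mono) auto
  also have "\<dots> = c ^ N * ((2 ^ d) ^ N * (1 / 2) ^ i)" by (simp add: power_mult_distrib)
  also have "\<dots> < c ^ N * ((2 ^ d') ^ N * (1 / 2) ^ i')"
    using * assms(1) by (intro mult_strict_left_mono) auto
  finally show ?thesis by (simp add: power_mult_distrib)
qed

lemma weighted_power_le:
  fixes c :: real
  assumes "0 < c" "N * d \<le> i" "x \<le> c * 2 ^ d" "0 \<le> x"
  shows "x ^ N * (1 / 2) ^ i \<le> c ^ N"
proof -
  have "(2::real) ^ (N * d) \<le> 2 ^ i" using assms(2) by simp
  hence "((2::real) ^ d) ^ N \<le> 2 ^ i"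
    by (simp only: power_mult[symmetric] mult.commute[of N])
  hence *: "((2::real) ^ d) ^ N * (1 / 2) ^ i \<le> 1"
    by (simp add: power_divide field_simps)
  have "x ^ N * (1 / 2) ^ i \<le> (c * 2 ^ d) ^ N * (1 / 2) ^ i"
    using assms by (intro mult_right_mono power_mono) auto
  also have "\<dots> = c ^ N * ((2 ^ d) ^ N * (1 / 2) ^ i)" by (simp add: power_mult_distrib)
  also have "\<dots> \<le> c ^ N * 1"
    using * assms(1) by (intro mult_left_mono) auto
  finally show ?thesis by simp
qed

section \<open>Factors of the Wronskian\<close>

lemma wr_eq_hermite_wr:
  obtains M M' where "{2 * M, 2 * M' + 1} = {n, Suc n}"
    "\<And>p i. pabs p (coeff (wr n) i) = pabs p (coeff (hermite_wr M M') i)"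
    "\<And>q i. q dvd coeff (wr n) i \<longleftrightarrow> q dvd coeff (hermite_wr M M') i"
proof (cases "even n")
  case True
  then obtain M where "n = 2 * M" by (rule evenE)
  thus ?thesis by (intro that[of M M]) (auto simp: wr_even)
next
  case False
  then obtain M where "n = 2 * M + 1" by (rule oddE)
  thus ?thesis by (intro that[of "Suc M" M]) (auto simp: wr_odd[unfolded Suc_eq_plus1[symmetric]])
qed

lemma good_prime_no_even_factor:
  assumes good: "good_prime n k p" and k: "k \<ge> 1"
    and AB: "wr n = A * B" and A: "lead_coeff A = 1" "degree A = 2 * k" and B: "lead_coeff B = 1"
    and even: "\<And>i. odd i \<Longrightarrow> coeff A i = 0"
  shows False
proof -
  have p: "prime p" "3 \<le> p" "n mod p < k" "2 * k < p \<or> k < p \<and> n < p ^ 2"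
    using good unfolding good_prime_def by auto
  have kp: "k < p" using p(4) by auto
  have "odd p" using p(1,2) prime_odd_nat by auto
  then obtain h where h: "p = 2 * h + 1" by (rule oddE)
  have h0: "h \<ge> 1" using h p(2) by simp
  define K where "K = n div p"
  define s where "s = n mod p"
  have n: "n = K * p + s" by (simp add: K_def s_def)
  have s: "s < k" using p(3) by (simp add: s_def)
  have A0: "A \<noteq> 0" and B0: "B \<noteq> 0" using A(1) B by auto
  have "degree A + degree B = 2 * n"
    using degree_mult_eq[OF A0 B0] degree_wr[of n] AB by simp
  hence degB: "degree B = 2 * n - 2 * k" "k \<le> n" using A(2) by auto
  have K: "K \<ge> 1"
  proof (rule ccontr)
    assume "\<not> K \<ge> 1"
    hence "n = s" using n by simp
    thus False using s degB(2) by simp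
  qed
  obtain M M' where MM': "{2 * M, 2 * M' + 1} = {n, Suc n}"
    and pabs_wr: "\<And>p i. pabs p (coeff (wr n) i) = pabs p (coeff (hermite_wr M M') i)"
    and dvd_wr: "\<And>q i. q dvd coeff (wr n) i \<longleftrightarrow> q dvd coeff (hermite_wr M M') i"
    using wr_eq_hermite_wr by blast
  define r where "r = 2 * M - K * p"
  define r' where "r' = 2 * M' + 1 - K * p"
  have cases: "2 * M = n \<and> 2 * M' + 1 = Suc n \<or> 2 * M = Suc n \<and> 2 * M' + 1 = n"
    using MM' by (auto simp: doubleton_eq_iff)
  have r: "2 * M = K * p + r" "r < p" and r': "2 * M' + 1 = K * p + r'" "r' < p"
    using cases n s kp by (auto simp: r_def r'_def)
  have c0: "pabs p (coeff (wr n) 0) > 0" using coeff_wr_0_pos[of n] by simp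
  have odd0: "gauss_term p N (wr n) i = 0" if "odd i" "N > 0" for i N
    using that coeff_wr_odd by (simp add: gauss_term_def[OF p(1)] zero_power)
  have gt: "gauss_term p N (wr n) i = pabs p (coeff (wr n) i) ^ N * (1 / 2) ^ i" for N i
    by (rule gauss_term_def[OF p(1)])
  have gt_pos: "0 < gauss_term p N (wr n) i" if "coeff (wr n) i \<noteq> 0" for N i
    using that by (rule gauss_term_pos[OF p(1)])
  have pA: "int p dvd coeff A 0"
  proof (rule dvd_coeff_0_of_low_coeffs[OF p(1) _ B])
    show "int p dvd coeff (A * B) i" if "i < 2 * (K * p)" for i
      using dvd_coeff_hermite_wr[OF p(1) h K r r' that] unfolding AB[symmetric] dvd_wr .
    show "degree B < 2 * (K * p)" using degB s n by simp
  qed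
  have AB0: "coeff (A * B) 0 \<noteq> 0" unfolding AB[symmetric] using coeff_wr_0_pos[of n] by simp
  have dA: "degree A > 0" using A(2) k by simp
  note unique = no_small_factor_unique_max_at_0[OF p(1) AB0 _ _ A(1) dA pA, unfolded AB[symmetric]]
  consider "2 * k < p" | "n < p ^ 2" using p(4) by blast
  thus False
  proof cases
    case 1
    have "p - 1 < degree A"
    proof (rule unique)
      fix i :: nat assume i: "i \<noteq> 0"
      show "gauss_term p (p - 1) (wr n) i < gauss_term p (p - 1) (wr n) 0"
      proof (cases "odd i")
        case True
        thus ?thesis using odd0[of i "p - 1"] gt_pos[of 0] c0 p(2) by simp
      next
        case False
        then obtain j where j: "i = 2 * j" by auto
        let ?v = "multiplicity p (fact (2 * j))"
        have v: "(p - 1) * ?v < 2 * j" using i j by (intro multiplicity_fact_less p) auto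
        have "(fact (2 * j) :: int) = int (fact (2 * j))" by simp
        hence "pabs p (fact (2 * j)) = (1 / 2) ^ ?v"
          unfolding pabs_def by (simp only: multiplicity_of_nat_int) simp
        hence "pabs p (coeff (wr n) i) * (1 / 2) ^ ?v \<le> pabs p (coeff (wr n) 0)"
          using pabs_coeff_hermite_wr_fact[OF p(1) h, of M M' j] unfolding pabs_wr j by simp
        hence le: "pabs p (coeff (wr n) i) \<le> pabs p (coeff (wr n) 0) * 2 ^ ?v"
          by (simp add: power_divide field_simps)
        show ?thesis
          unfolding gt using weighted_power_less[OF c0 _ le, of "p - 1" 0 0 i] v j by simp
      qed
    qed (use p(2) in simp)
    thus False using 1 A(2) by simp
  next
    case 2
    have "K < p"
    proof (rule ccontr)
      assume "\<not> K < p"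
      hence "p ^ 2 \<le> K * p" unfolding power2_eq_square by (intro mult_le_mono1) simp
      thus False using 2 n by linarith
    qed
    hence "(K + 1) * p \<le> p * p" by (intro mult_le_mono1) simp
    \<comment> \<open>From s < k < p follows s <= p - 2, which provides the two units needed for
      both bounds.\<close>
    hence "n + 2 \<le> p ^ 2" using n s kp by (simp add: power2_eq_square)
    hence bounds: "2 * M \<le> p ^ 2" "2 * M' + 2 \<le> p ^ 2" using cases by auto
    let ?N = "2 * (p - 1)"
    have N: "?N > 0" using p(2) by simp
    show False
    \<comment> \<open>For even K the last digits of M and M' are about half the remainders and stay
      below p/2, so every slope is flat. For odd K the extra p/2 lifts them to the upper half, and
      the steep edge up to 2p appears.\<close>
    proof (cases "even K")
      case True
      then obtain K' where K': "K = 2 * K'" by (rule evenE)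
      have "even r" using r(1) K' by (metis dvd_add_right_iff dvd_mult2 dvd_triv_left)
      then obtain t where t: "r = 2 * t" by (rule evenE)
      have "M = K' * p + t" using r(1) t K' by simp
      moreover have "t < p" using t r(2) by simp
      ultimately have "M mod p = t" by simp
      hence M: "M mod p \<le> h" using t r(2) h by simp
      have "odd r'" using r'(1) K' by (metis dvd_mult2 dvd_triv_left even_add odd_one)
      then obtain t' where t': "r' = 2 * t' + 1" by (rule oddE)
      have "M' = K' * p + t'" using r'(1) t' K' by simp
      moreover have "t' < p" using t' r'(2) by simp
      ultimately have "M' mod p = t'" by simp
      hence M': "M' mod p < h" using t' r'(2) h by simp
      have "?N < degree A"
      proof (rule unique[OF N])
        fix i :: nat assume i: "i \<noteq> 0"
        show "gauss_term p ?N (wr n) i < gauss_term p ?N (wr n) 0"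
        proof (cases "odd i")
          case True
          thus ?thesis using odd0[OF _ N] gt_pos[of 0] c0 by simp
        next
          case False
          then obtain j where j: "i = 2 * j" by auto
          have le: "pabs p (coeff (wr n) i) \<le> pabs p (coeff (wr n) 0) * 2 ^ (j div p)"
            unfolding pabs_wr j by (rule pabs_coeff_hermite_wr_even_quotient[OF p(1) h bounds M M'])
          have "(p - 1) * (j div p) < j"
          proof (cases "j div p = 0")
            case False
            have "(p - 1) * (j div p) < p * (j div p)" using False p(2) by simp
            also have "\<dots> \<le> j" by simp
            finally show ?thesis .
          qed (use i j in simp)
          hence "?N * (j div p) + 0 < ?N * 0 + i" unfolding j by simp
          from weighted_power_less[OF c0 this le] show ?thesis unfolding gt by simp
        qed
      qed
      thus False using kp A(2) by simp
    next
      case False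
      then obtain K' where K': "K = 2 * K' + 1" by (rule oddE)
      have "odd (K * p)" using False \<open>odd p\<close> by simp
      have "odd r" using r(1) \<open>odd (K * p)\<close> by (metis dvd_triv_left even_add)
      then obtain t where t: "r = 2 * t + 1" by (rule oddE)
      have "2 * M = 2 * (K' * p + (h + 1 + t))" using r(1) unfolding K' t by (simp add: algebra_simps h)
      hence "M = K' * p + (h + 1 + t)" by simp
      moreover have "h + 1 + t < p" using t r(2) h by simp
      ultimately have M: "h + 1 \<le> M mod p" by simp
      have "even r'" using r'(1) \<open>odd (K * p)\<close> by (metis dvd_triv_left even_add odd_one)
      then obtain t' where t': "r' = 2 * t'" by (rule evenE)
      have "2 * M' + 1 = 2 * (K' * p + (h + t')) + 1" using r'(1) unfolding K' t' by (simp add: algebra_simps h)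
      hence "M' = K' * p + (h + t')" by simp
      moreover have "h + t' < p" using t' r'(2) h by simp
      ultimately have M': "h \<le> M' mod p" by simp
      have low: "pabs p (coeff (wr n) (2 * j)) \<le> pabs p (coeff (wr n) 0) * 2 ^ 0" if "j \<le> h" for j
        unfolding pabs_wr using pabs_coeff_hermite_wr_low[OF p(1) h bounds that] by simp
      have gen: "pabs p (coeff (wr n) (2 * j)) \<le> pabs p (coeff (wr n) 0) * 2 ^ (1 + j div p)" for j
        unfolding pabs_wr by (rule pabs_coeff_hermite_wr_odd_quotient[OF p(1) h bounds])
      have height: "pabs p (coeff (wr n) (2 * p)) = 4 * pabs p (coeff (wr n) 0)"
        unfolding pabs_wr by (rule pabs_coeff_hermite_wr_2p[OF p(1) h bounds M M'])
      have "2 * p \<le> degree A"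
      proof (rule no_small_factor_first_edge_2p[OF p(1) AB0 \<open>odd p\<close> _ _ _ A(1) dA pA even, unfolded AB[symmetric]])
        fix i :: nat
        show "gauss_term p p (wr n) i \<le> gauss_term p p (wr n) 0"
        proof (cases "odd i")
          case True
          thus ?thesis using odd0[of i p] gt_pos[of 0 p] c0 p(2) by simp
        next
          case False
          then obtain j where j: "i = 2 * j" by auto
          show ?thesis
          proof (cases "j \<le> h")
            case True
            from weighted_power_le[OF c0 _ low[OF this], of p i] show ?thesis unfolding gt j by simp
          next
            case False
            have "p * (1 + j div p) \<le> 2 * j"
            proof (cases "j < p")
              case True
              thus ?thesis using False h by simp
            next
              case False
              have "p * (j div p) \<le> j" by simp
              moreover have "p * (1 + j div p) = p + p * (j div p)" by (simp add: algebra_simps)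
              ultimately show ?thesis using False by linarith
            qed
            from weighted_power_le[OF c0 this gen] show ?thesis unfolding gt j by simp
          qed
        qed
      next
        fix i :: nat assume i: "i \<noteq> 2 * p"
        have rhs: "gauss_term p ?N (wr n) (2 * p) = (pabs p (coeff (wr n) 0) * 2 ^ 2) ^ ?N * (1 / 2) ^ (2 * p)"
          unfolding gt height by (simp add: mult.commute)
        show "gauss_term p ?N (wr n) i < gauss_term p ?N (wr n) (2 * p)"
        proof (cases "odd i")
          case True
          have "0 < gauss_term p ?N (wr n) (2 * p)"
            unfolding rhs using c0 by simp
          thus ?thesis using odd0[OF True N] by simp
        next
          case False
          then obtain j where j: "i = 2 * j" by auto
          have jp: "j \<noteq> p" using i j by simp
          show ?thesis
          proof (cases "j \<le> h")
            case True
            have "?N * 0 + 2 * p < ?N * 2 + i" using p(2) by simp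
            from weighted_power_less[OF c0 this low[OF True, folded j]] show ?thesis unfolding rhs by (simp only: gt pabs_nonneg)
          next
            case False
            have "?N * (1 + j div p) + 2 * p < ?N * 2 + i"
            proof (cases "j < p")
              case True
              thus ?thesis using False h0 h j p(2) by simp
            next
              case False
              define d where "d = j - p"
              have d: "j = p + d" "d > 0" using False jp by (auto simp: d_def)
              have aux: "a + 2 * x + 2 * p < a + 2 * (p + d)" if "x < d" for a x
                using that by simp
              have "j div p = 1 + d div p" unfolding d(1) using p(2) by simp
              moreover have "(p - 1) * (d div p) < d"
              proof (cases "d div p = 0")
                case False
                have "(p - 1) * (d div p) < p * (d div p)" using False p(2) by simp
                also have "\<dots> \<le> d" by simp
                finally show ?thesis .
              qed (use d in simp)
              moreover have "2 * P * (1 + (1 + y)) = 2 * P * 2 + 2 * (P * y)" for P y :: nat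
                by (simp add: algebra_simps)
              hence "?N * (1 + (1 + d div p)) = ?N * 2 + 2 * ((p - 1) * (d div p))" .
              ultimately show ?thesis unfolding j d(1) by (simp only:) (rule aux)
            qed
            from weighted_power_less[OF c0 this gen[of j, folded j]] show ?thesis unfolding rhs by (simp only: gt pabs_nonneg)
          qed
        qed
      next
        show "pabs p (coeff (wr n) (2 * p)) = 4 * pabs p (coeff (wr n) 0)" by (rule height)
      qed
      thus False using kp A(2) by simp
    qed
  qed
qed

section \<open>The substitution x -> -x and factors of even polynomials\<close>

definition refl_poly :: "int poly \<Rightarrow> int poly" where
  "refl_poly g = pcompose g [:0, -1:]"

lemma coeff_refl_poly: "coeff (refl_poly g) i = (-1) ^ i * coeff g i"
  unfolding refl_poly_def by (simp add: coeff_pcompose_linear)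

lemma refl_poly_mult: "refl_poly (a * b) = refl_poly a * refl_poly b"
  by (simp add: refl_poly_def pcompose_mult)

lemma refl_poly_refl_poly [simp]: "refl_poly (refl_poly g) = g"
  by (rule poly_eqI) (simp add: coeff_refl_poly flip: mult.assoc power_mult_distrib)

lemma refl_poly_eq_iff: "refl_poly g = g \<longleftrightarrow> (\<forall>i. odd i \<longrightarrow> coeff g i = 0)"
  by (auto simp: poly_eq_iff coeff_refl_poly minus_one_power_iff)

lemma degree_refl_poly [simp]: "degree (refl_poly g) = degree g"
  by (simp add: refl_poly_def degree_pcompose)

lemma refl_poly_dvd_iff: "refl_poly a dvd refl_poly b \<longleftrightarrow> a dvd b"
  by (metis dvdE dvd_triv_left refl_poly_mult refl_poly_refl_poly)

lemma refl_poly_prime_elem: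
  assumes "prime_elem g"
  shows "prime_elem (refl_poly g)"
proof (rule prime_elemI)
  show "refl_poly g \<noteq> 0"
  proof
    assume "refl_poly g = 0"
    hence "refl_poly (refl_poly g) = refl_poly 0" by simp
    thus False using assms by (simp add: refl_poly_def[of 0])
  qed
  show "\<not> refl_poly g dvd 1"
    using assms refl_poly_dvd_iff[of g 1] prime_elem_not_unit by (auto simp: refl_poly_def[of 1])
  show "refl_poly g dvd a \<or> refl_poly g dvd b" if "refl_poly g dvd a * b" for a b
  proof -
    have "g dvd refl_poly a * refl_poly b"
      using that by (metis refl_poly_dvd_iff refl_poly_mult refl_poly_refl_poly)
    thus ?thesis using assms by (metis prime_elem_dvd_mult_iff refl_poly_dvd_iff refl_poly_refl_poly)
  qed
qed

lemma int_mult_eq_1: "(a :: int) * b = 1 \<Longrightarrow> a = 1 \<and> b = 1 \<or> a = -1 \<and> b = -1"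
  by (auto simp: zmult_eq_1_iff)

lemma int_poly_degree_0_lead_1: "degree (h :: int poly) = 0 \<Longrightarrow> lead_coeff h = 1 \<Longrightarrow> h = 1"
  by (metis degree_eq_zeroE lead_coeff_pCons(2) one_pCons)

lemma monic_factor_signs:
  fixes f :: "int poly"
  assumes "f = a * b" "lead_coeff f = 1"
  obtains a' b' where "f = a' * b'" "lead_coeff a' = 1" "lead_coeff b' = 1" "a' = a \<or> a' = - a" "b' = b \<or> b' = - b"
proof -
  have "lead_coeff a * lead_coeff b = 1" using assms lead_coeff_mult[of a b] by simp
  from int_mult_eq_1[OF this] show ?thesis
  proof
    assume "lead_coeff a = 1 \<and> lead_coeff b = 1"
    thus ?thesis using assms by (intro that[of a b]) auto
  next
    assume "lead_coeff a = - 1 \<and> lead_coeff b = - 1"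
    thus ?thesis using assms by (intro that[of "- a" "- b"]) auto
  qed
qed

text \<open>An irreducible factor \<open>g(x)\<close> of an even polynomial is even, or else the coprime polynomial
  \<open>g(-x)\<close> divides it as well.\<close>
lemma reducible_even_poly_cases:
  fixes f :: "int poly"
  assumes lead: "lead_coeff f = 1" and deg: "degree f > 0" and f0: "coeff f 0 \<noteq> 0"
    and even: "refl_poly f = f" and red: "\<not> irreducible f"
  shows "(\<exists>A B. f = A * B \<and> lead_coeff A = 1 \<and> lead_coeff B = 1 \<and> refl_poly A = A \<and> refl_poly B = B \<and>
            degree A > 0 \<and> degree B > 0) \<or>
         (\<exists>g. lead_coeff g = 1 \<and> (f = g * refl_poly g \<or> f = - (g * refl_poly g)))"
proof -
  have f_nz: "f \<noteq> 0" and "\<not> is_unit f" using deg by (auto simp: is_unit_poly_iff)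
  then obtain g' where g': "g' dvd f" "prime g'" using prime_divisor_exists by blast
  obtain h' where h': "f = g' * h'" using g'(1) by (rule dvdE)
  obtain g h where gh: "f = g * h" "lead_coeff g = 1" "lead_coeff h = 1" "g = g' \<or> g = - g'"
    using monic_factor_signs[OF h' lead] by metis
  have "prime_elem g'" using g'(2) by simp
  moreover from this have "prime_elem (- g')"
    by (intro prime_elemI) (auto simp: prime_elem_dvd_mult_iff)
  ultimately have prime: "prime_elem g" using gh(4) by blast
  have h0: "h \<noteq> 0" and g0: "g \<noteq> 0" using gh(2,3) by auto
  have degg: "degree g > 0"
    using prime int_poly_degree_0_lead_1[OF _ gh(2)] by (cases "degree g = 0") auto
  show ?thesis
  proof (cases "refl_poly g = g")
    case True
    have "g * refl_poly h = g * h" using even True unfolding gh(1) refl_poly_mult by simp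
    hence "refl_poly h = h" using g0 by simp
    moreover have "degree h \<noteq> 0"
    proof
      assume "degree h = 0"
      hence "f = g" using int_poly_degree_0_lead_1[OF _ gh(3)] gh(1) by simp
      thus False using red prime prime_elem_imp_irreducible by blast
    qed
    ultimately show ?thesis using gh True degg by blast
  next
    case False
    have "refl_poly g dvd g * h"
      using even unfolding gh(1) by (metis dvd_triv_left refl_poly_mult)
    hence "refl_poly g dvd g \<or> refl_poly g dvd h"
      using refl_poly_prime_elem[OF prime] by (simp add: prime_elem_dvd_mult_iff)
    \<comment> \<open>The quotient would be a constant, equal to 1 by the nonzero constant
      coefficients, and g would be even.\<close>
    moreover have "\<not> refl_poly g dvd g"
    proof
      assume "refl_poly g dvd g"
      then obtain c where c: "g = refl_poly g * c" by (rule dvdE)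
      hence "c \<noteq> 0" using g0 by auto
      hence "degree g = degree g + degree c"
        using degree_mult_eq[of "refl_poly g" c] c g0 by (metis degree_refl_poly mult_zero_left)
      hence "degree c = 0" by simp
      then obtain c0 where c0: "c = [:c0:]" by (rule degree_eq_zeroE)
      have coeffs: "coeff g i = c0 * ((-1) ^ i * coeff g i)" for i
        using arg_cong[OF c, of "\<lambda>q. coeff q i"] unfolding c0 coeff_refl_poly[symmetric] by simp
      have "coeff g 0 \<noteq> 0" using f0 unfolding gh(1) by (auto simp: coeff_mult_0)
      hence "c0 = 1" using coeffs[of 0] by simp
      thus False using False c c0 by (simp add: one_pCons[symmetric])
    qed
    ultimately obtain e where e: "h = refl_poly g * e" by (auto elim: dvdE)
    define G where "G = g * refl_poly g"
    have fG: "f = G * e" unfolding G_def using gh(1) e by (simp add: mult.assoc)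
    have G_refl: "refl_poly G = G" by (simp add: G_def refl_poly_mult mult.commute)
    have "G \<noteq> 0" using f_nz fG by auto
    moreover have "G * refl_poly e = G * e" using even G_refl unfolding fG refl_poly_mult by simp
    ultimately have e_refl: "refl_poly e = e" by simp
    obtain A B where AB: "f = A * B" "lead_coeff A = 1" "lead_coeff B = 1" "A = G \<or> A = - G" "B = e \<or> B = - e"
      using monic_factor_signs[OF fG lead] by metis
    have "refl_poly (- q) = - refl_poly q" for q
      by (rule poly_eqI) (simp add: coeff_refl_poly)
    hence "refl_poly A = A" "refl_poly B = B" using AB(4,5) G_refl e_refl by auto
    moreover have "degree G = degree g + degree g"
      unfolding G_def using \<open>G \<noteq> 0\<close> by (subst degree_mult_eq) (auto simp: G_def)
    hence "degree A > 0" using AB(4) degg by auto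
    ultimately show ?thesis
    proof (cases "degree B = 0")
      case True
      hence "f = A" using int_poly_degree_0_lead_1[OF _ AB(3)] AB(1) by simp
      thus ?thesis using AB(4) gh(2) unfolding G_def by blast
    qed (use AB in blast)
  qed
qed

section \<open>Primes congruent to 3 modulo 4 and factorisations g(x) g(-x)\<close>

lemma prime_3_mod_4_divisor:
  fixes x :: nat
  assumes "x mod 4 = 3"
  shows "\<exists>q. prime q \<and> q mod 4 = 3 \<and> q dvd x"
  using assms
proof (induction x rule: less_induct)
  case (less x)
  have "x \<noteq> 1" using less.prems by auto
  then obtain p where p: "prime p" "p dvd x" using prime_factor_nat by blast
  then obtain y where y: "x = p * y" by (auto elim: dvdE)
  have "odd x" using less.prems by presburger
  hence "odd p" using y by simp
  hence "p mod 4 = 1 \<or> p mod 4 = 3" by presburger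
  thus ?case
  proof
    assume p1: "p mod 4 = 1"
    have "x mod 4 = ((p mod 4) * y) mod 4" unfolding y by (simp add: mod_mult_left_eq)
    hence "y mod 4 = 3" using p1 less.prems by simp
    moreover have "p > 1" using p(1) prime_gt_1_nat by blast
    moreover have "y > 0" using \<open>y mod 4 = 3\<close> by (intro Nat.gr0I) simp
    ultimately have "\<exists>q. prime q \<and> q mod 4 = 3 \<and> q dvd y"
      using y by (intro less.IH) auto
    thus ?thesis unfolding y by auto
  qed (use p in blast)
qed

text \<open>Descent: a divisor \<open>q\<close> of \<open>z\<^sup>2 + 1\<close> with \<open>z\<close> even and below \<open>q\<close> has a cofactor that is again
  \<open>3\<close> modulo \<open>4\<close> and smaller than \<open>q\<close>.\<close>
lemma not_dvd_square_plus_1_nat: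
  fixes q x :: nat
  assumes "prime q" "q mod 4 = 3"
  shows "\<not> q dvd x * x + 1"
  using assms
proof (induction q arbitrary: x rule: less_induct)
  case (less q)
  show ?case
  proof
    assume dvd: "q dvd x * x + 1"
    have q0: "q > 0" and qodd: "odd q" using less.prems(2) by presburger+
    define y where "y = x mod q"
    have y: "y < q" using q0 by (simp add: y_def)
    have "(y * y + 1) mod q = (x * x + 1) mod q"
      unfolding y_def by (metis mod_add_left_eq mod_mult_eq)
    hence dvd_y: "q dvd y * y + 1" using dvd by (simp add: dvd_eq_mod_eq_0)
    have "\<exists>z. even z \<and> z < q \<and> q dvd z * z + 1"
    proof (cases "even y")
      case True
      thus ?thesis using y dvd_y by blast
    next
      case False
      have "y > 0" using False by (intro Nat.gr0I) simp
      define z where "z = q - y"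
      have qz: "q = z + y" using y by (simp add: z_def)
      have "q dvd (y * y + 1) + q * q" by (rule dvd_add[OF dvd_y]) simp
      also have "(y * y + 1) + q * q = (z * z + 1) + q * (2 * y)"
        unfolding qz by (simp add: algebra_simps)
      finally have "q dvd (z * z + 1) + q * (2 * y)" .
      hence "q dvd z * z + 1" by (subst (asm) dvd_add_left_iff) simp_all
      moreover have "even z" using qz qodd False by simp
      moreover have "z < q" using qz \<open>y > 0\<close> by simp
      ultimately show ?thesis by blast
    qed
    then obtain z where z: "even z" "z < q" "q dvd z * z + 1" by blast
    obtain m where m: "z * z + 1 = q * m" using z(3) by (rule dvdE)
    obtain t where t: "z = 2 * t" using z(1) by (rule evenE)
    have "z * z + 1 < q * q"
    proof -
      have "z * z \<le> z * (q - 1)" using z(2) by (intro mult_le_mono2) simp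
      also have "\<dots> \<le> (q - 1) * (q - 1)" using z(2) by (intro mult_le_mono1) simp
      finally have "z * z \<le> (q - 1) * (q - 1)" .
      moreover obtain q' where "q = Suc q'" "q' \<ge> 2" using less.prems(2) by (cases q) auto
      ultimately show ?thesis by simp
    qed
    hence mq: "m < q" unfolding m by simp
    have "(z * z + 1) mod 4 = 1" unfolding t by (simp add: mod_Suc)
    hence "((q mod 4) * (m mod 4)) mod 4 = 1" unfolding m by (simp add: mod_mult_eq)
    moreover have "m mod 4 = 0 \<or> m mod 4 = 1 \<or> m mod 4 = 2 \<or> m mod 4 = 3" by linarith
    ultimately have "m mod 4 = 3" using less.prems(2) by auto
    then obtain q' where q': "prime q'" "q' mod 4 = 3" "q' dvd m" using prime_3_mod_4_divisor by blast
    have "m > 0" using \<open>m mod 4 = 3\<close> by (intro Nat.gr0I) simp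
    hence "q' \<le> m" using q'(3) by (intro dvd_imp_le)
    hence "q' < q" using mq by simp
    moreover have "q' dvd z * z + 1" unfolding m using q'(3) by simp
    ultimately show False using less.IH q'(1,2) by blast
  qed
qed

lemma not_dvd_square_plus_1:
  fixes q :: nat and x :: int
  assumes "prime q" "q mod 4 = 3"
  shows "\<not> int q dvd x ^ 2 + 1"
proof -
  have "x ^ 2 + 1 = int (nat \<bar>x\<bar> * nat \<bar>x\<bar> + 1)"
    by (simp add: power2_eq_square)
  thus ?thesis using not_dvd_square_plus_1_nat[OF assms] by (simp only: int_dvd_int_iff not_False_eq_True)
qed

text \<open>If \<open>q\<close> divides \<open>n - 1\<close> then the Wronskian reduces to \<open>x\<^sup>2\<^sup>n + x\<^sup>2\<^sup>n\<^sup>-\<^sup>2\<close> modulo \<open>q\<close>, and a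
  factorisation \<open>g(x) g(-x)\<close> would make \<open>-1\<close> a square modulo \<open>q\<close>.\<close>
lemma wr_ne_mult_refl_poly:
  assumes n: "n mod 4 = 0" "n > 0" and g: "lead_coeff g = 1"
  shows "wr n \<noteq> g * refl_poly g"
proof
  assume fg: "wr n = g * refl_poly g"
  obtain t where t: "n = 4 * t" using n(1) by (metis dvdE mod_0_imp_dvd)
  then obtain t' where "t = Suc t'" using n(2) by (cases t) auto
  hence "n - 1 = 3 + 4 * t'" using t by simp
  hence "(n - 1) mod 4 = 3 mod 4" by (simp only: mod_mult_self2)
  hence "(n - 1) mod 4 = 3" by simp
  then obtain q where q: "prime q" "q mod 4 = 3" "q dvd n - 1" using prime_3_mod_4_divisor by blast
  have qi: "prime (int q)" using q(1) by simp
  have "even n" using t by simp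
  then obtain M where M: "n = 2 * M" by (rule evenE)
  have M1: "M \<ge> 1" using n M by simp
  have q': "int q dvd int (2 * (M - 1) + 1)"
  proof -
    have "2 * (M - 1) + 1 = n - 1" using M M1 by simp
    thus ?thesis using q(3) by (simp only: int_dvd_int_iff)
  qed
  have e: "int q dvd even_coeff M l" if "l \<noteq> M" for l
  proof (cases "l < M")
    case True
    have "int q dvd odd_prod l M" by (rule dvd_odd_prod[OF _ _ q']) (use True in linarith)+
    thus ?thesis by (simp add: even_coeff_def)
  qed (use that in \<open>simp add: even_coeff_def binomial_eq_0\<close>)
  have o: "int q dvd odd_coeff M l" if "Suc l < M" for l
  proof -
    have "int q dvd odd_prod (Suc l) (Suc M)" by (rule dvd_odd_prod[OF _ _ q']) (use that in linarith)+
    thus ?thesis by (simp add: odd_coeff_def)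
  qed
  have low: "int q dvd coeff (wr n) i" if "i < 2 * (n - 1)" for i
  proof (cases "even i")
    case True
    then obtain m where m: "i = 2 * m" by auto
    show ?thesis unfolding M wr_even m coeff_hermite_wr_even
    proof (rule dvd_sum, rule dvd_mult)
      fix l assume l: "l \<in> {..m}"
      show "int q dvd even_coeff M l * odd_coeff M (m - l)"
      proof (cases "l = M")
        case True
        hence "Suc (m - l) < M" using l that m M by auto
        thus ?thesis using o by simp
      next
        case False
        thus ?thesis using e by simp
      qed
    qed
  qed (simp add: coeff_wr_odd)
  \<comment> \<open>Modulo q only the term l = M survives, with value M(2M + 1); twice its
    difference from 1 is (2M - 1)(2M + 2), and 2M - 1 = n - 1.\<close>
  have top: "int q dvd coeff (wr n) (2 * (n - 1)) - 1"
  proof -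
    let ?t = "\<lambda>l. (2 * int (n - 1) + 1 - 4 * int l) * (even_coeff M l * odd_coeff M (n - 1 - l))"
    have "coeff (wr n) (2 * (n - 1)) = sum ?t {..n - 1}"
      unfolding M wr_even coeff_hermite_wr_even ..
    also have "\<dots> = ?t M + sum ?t ({..n - 1} - {M})"
      using M M1 by (intro sum.remove) auto
    finally have eq: "coeff (wr n) (2 * (n - 1)) = \<dots>" .
    have rest: "int q dvd sum ?t ({..n - 1} - {M})"
      by (rule dvd_sum, rule dvd_mult, rule dvd_mult2, rule e) auto
    obtain M0 where M0: "M = Suc M0" using M1 by (cases M) auto
    have "n - 1 - M = M0" using M M0 by simp
    have o1: "odd_coeff M M0 = - (int M * (2 * int M + 1))"
      by (simp add: odd_coeff_def M0 odd_prod_def algebra_simps)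
    have e1: "even_coeff M M = 1" by (simp add: even_coeff_def flip: mult_2)
    have w1: "2 * int (n - 1) + 1 - 4 * int M = - 1" using M M1 by (simp add: of_nat_diff)
    have tM: "?t M = int M * (2 * int M + 1)" unfolding \<open>n - 1 - M = M0\<close> o1 e1 w1 by simp
    have eq2: "2 * (?t M - 1) = int (2 * (M - 1) + 1) * (2 * int M + 2)"
      unfolding tM using M1 by (simp add: of_nat_diff algebra_simps)
    have "int q dvd 2 * (?t M - 1)" unfolding eq2 by (rule dvd_mult2[OF q'])
    moreover have "\<not> int q dvd 2"
    proof
      assume "int q dvd 2"
      hence "q dvd 2" by presburger
      hence "q \<le> 2" by (rule dvd_imp_le) simp
      thus False using q(2) by auto
    qed
    ultimately have "int q dvd ?t M - 1" using prime_dvd_multD[OF qi] by blast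
    hence "int q dvd (?t M - 1) + sum ?t ({..n - 1} - {M})" using rest by (rule dvd_add)
    thus ?thesis unfolding eq by (simp add: algebra_simps)
  qed
  have "\<not> int q dvd coeff g (degree g)" using g qi not_prime_unit by auto
  \<comment> \<open>The lowest term of \<open>g\<close> modulo q, of index j, gives the lowest term
    of the product, at 2j with coefficient (-1)^j times a square. Matching it with x^(2n-2) forces
    the odd value j = n - 1.\<close>
  define j where "j = (LEAST j. \<not> int q dvd coeff g j)"
  have j: "\<not> int q dvd coeff g j" unfolding j_def
    using \<open>\<not> int q dvd coeff g (degree g)\<close> by (rule LeastI)
  have below: "int q dvd coeff g i" if "i < j" for i
    using that not_less_Least unfolding j_def by blast
  have split_at: "int q dvd coeff (wr n) i - (if i = 2 * j then (-1) ^ j * coeff g j ^ 2 else 0)" if "i \<le> 2 * j" for i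
  proof -
    let ?u = "\<lambda>a. coeff g a * ((-1) ^ (i - a) * coeff g (i - a))"
    have coeff_eq: "coeff (wr n) i = sum ?u {..i}"
      unfolding fg coeff_mult coeff_refl_poly ..
    have dv: "int q dvd ?u a" if "a \<noteq> j \<or> i \<noteq> 2 * j" "a \<le> i" for a
    proof -
      have "a < j \<or> i - a < j" using that \<open>i \<le> 2 * j\<close> by auto
      thus ?thesis using below by auto
    qed
    show ?thesis
    proof (cases "i = 2 * j")
      case True
      have "coeff (wr n) i = ?u j + sum ?u ({..i} - {j})"
        unfolding coeff_eq using True by (intro sum.remove) auto
      moreover have "int q dvd sum ?u ({..i} - {j})"
        by (rule dvd_sum, rule dv) auto
      moreover have "?u j = (-1) ^ j * coeff g j ^ 2" using True by (simp add: power2_eq_square mult_ac)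
      ultimately have "int q dvd coeff (wr n) i - (-1) ^ j * coeff g j ^ 2" by simp
      thus ?thesis using True by simp
    next
      case False
      have "int q dvd sum ?u {..i}" using False by (intro dvd_sum dv) auto
      thus ?thesis using False coeff_eq by simp
    qed
  qed
  have j2: "\<not> int q dvd (-1) ^ j * coeff g j ^ 2"
  proof -
    have "\<not> int q dvd coeff g j ^ 2" using j prime_dvd_power[OF qi] by blast
    thus ?thesis by (cases "even j") simp_all
  qed
  have "\<not> 2 * j < 2 * (n - 1)"
  proof
    assume lt: "2 * j < 2 * (n - 1)"
    have "int q dvd coeff (wr n) (2 * j) - (-1) ^ j * coeff g j ^ 2" using split_at[of "2 * j"] by simp
    from dvd_diff[OF low[OF lt] this] have "int q dvd (-1) ^ j * coeff g j ^ 2" by simp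
    thus False using j2 by contradiction
  qed
  moreover have "\<not> 2 * (n - 1) < 2 * j"
  proof
    assume "2 * (n - 1) < 2 * j"
    hence "int q dvd coeff (wr n) (2 * (n - 1))" using split_at[of "2 * (n - 1)"] by simp
    from dvd_diff[OF this top] have "int q dvd 1" by simp
    thus False using qi not_prime_unit by blast
  qed
  ultimately have jn: "j = n - 1" by simp
  have "odd j" unfolding jn using \<open>even n\<close> n(2) by simp
  hence "int q dvd coeff (wr n) (2 * (n - 1)) + coeff g j ^ 2"
    using split_at[of "2 * j"] jn by simp
  hence "int q dvd (coeff (wr n) (2 * (n - 1)) + coeff g j ^ 2) - (coeff (wr n) (2 * (n - 1)) - 1)"
    using top by (rule dvd_diff)
  hence "int q dvd coeff g j ^ 2 + 1" by (simp add: algebra_simps)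
  thus False using not_dvd_square_plus_1[OF q(1,2)] by blast
qed

section \<open>The exceptional pair n = 8, k = 1\<close>

lemma wr_8: "wr 8 = [:99225, 0, 0, 0, 132300, 0, -105840, 0, 43470, 0, -8736, 0, 924, 0, -48, 0, 1:]"
proof -
  have h2: "hermiteHe 2 = [:-1, 0, 1:]"
    using hermiteHe.simps(3)[of 0]  by (simp add: numeral_2_eq_2)
  have h3: "hermiteHe 3 = [:0, -3, 0, 1:]"
    using hermiteHe.simps(3)[of "Suc 0"] h2 by (simp add: numeral_2_eq_2 numeral_3_eq_3)
  have h4: "hermiteHe 4 = [:3, 0, -6, 0, 1:]"
    using hermiteHe.simps(3)[of 2] h2 h3 by simp
  have h5: "hermiteHe 5 = [:0, 15, 0, -10, 0, 1:]"
    using hermiteHe.simps(3)[of 3] h3 h4 by simp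
  have h6: "hermiteHe 6 = [:-15, 0, 45, 0, -15, 0, 1:]"
    using hermiteHe.simps(3)[of 4] h4 h5 by simp
  have h7: "hermiteHe 7 = [:0, -105, 0, 105, 0, -21, 0, 1:]"
    using hermiteHe.simps(3)[of 5] h5 h6 by simp
  have h8: "hermiteHe 8 = [:105, 0, -420, 0, 210, 0, -28, 0, 1:]"
    using hermiteHe.simps(3)[of 6] h6 h7 by simp
  have h9: "hermiteHe 9 = [:0, 945, 0, -1260, 0, 378, 0, -36, 0, 1:]"
    using hermiteHe.simps(3)[of 7] h7 h8 by simp
  show ?thesis by (simp add: wr_def h8 h9 pderiv_pCons)
qed

text \<open>The substitution \<open>x\<^sup>2 = -c\<close> turns a factor \<open>x\<^sup>2 + c\<close> into a root modulo \<open>13\<close>, and there is none.\<close>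
lemma wr_8_no_quadratic_factor:
  assumes AB: "wr 8 = A * B" and A: "lead_coeff A = 1" "degree A = 2" and even: "coeff A 1 = 0"
  shows False
proof -
  define c where "c = coeff A 0"
  have "coeff A 2 = 1" using A by simp
  have B0: "B \<noteq> 0" using AB wr_8 by auto
  have "A \<noteq> 0" using A by auto
  have degB: "degree B = 14"
    using degree_mult_eq[OF \<open>A \<noteq> 0\<close> B0] degree_wr[of 8] AB A(2) by simp
  have A_eq: "A = [:c, 0, 1:]"
  proof (rule poly_eqI)
    fix i :: nat
    have "i > 2 \<or> i = 0 \<or> i = 1 \<or> i = 2" by linarith
    thus "coeff A i = coeff [:c, 0, 1:] i"
      using \<open>coeff A 2 = 1\<close> even A(2)
      by (auto simp: c_def coeff_eq_0 coeff_pCons numeral_2_eq_2 split: nat.splits)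
  qed
  have coeff_eq: "coeff (wr 8) 0 = c * coeff B 0"
    "coeff (wr 8) (Suc (Suc i)) = c * coeff B (Suc (Suc i)) + coeff B i" for i
    unfolding AB A_eq by (simp_all add: coeff_mult_0 coeff_pCons)
  have vals: "coeff (wr 8) 0 = 99225" "coeff (wr 8) 2 = 0" "coeff (wr 8) 4 = 132300"
    "coeff (wr 8) 6 = - 105840" "coeff (wr 8) 8 = 43470" "coeff (wr 8) 10 = - 8736"
    "coeff (wr 8) 12 = 924" "coeff (wr 8) 14 = - 48" "coeff (wr 8) 16 = 1"
    unfolding wr_8 by (simp_all add: numeral_eq_Suc)
  have "coeff B 16 = 0" using degB by (simp add: coeff_eq_0)
  \<comment> \<open>Division by x^2 + c from the top produces the coefficients of B as Horner
    iterates; the last relation says that the polynomial vanishes at x^2 = -c.\<close>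
  hence b14: "coeff B 14 = 1" using coeff_eq(2)[of 14] vals(9) by simp
  have b12: "coeff B 12 = - 48 - c * 1" using coeff_eq(2)[of 12] vals(8) b14 by simp
  have b10: "coeff B 10 = 924 - c * coeff B 12" using coeff_eq(2)[of 10] vals(7) by simp
  have b8: "coeff B 8 = - 8736 - c * coeff B 10" using coeff_eq(2)[of 8] vals(6) by simp
  have b6: "coeff B 6 = 43470 - c * coeff B 8" using coeff_eq(2)[of 6] vals(5) by simp
  have b4: "coeff B 4 = - 105840 - c * coeff B 6" using coeff_eq(2)[of 4] vals(4) by simp
  have b2: "coeff B 2 = 132300 - c * coeff B 4" using coeff_eq(2)[of 2] vals(3) by simp
  have b0: "coeff B 0 = 0 - c * coeff B 2" using coeff_eq(2)[of 0] vals(2) by (simp add: numeral_2_eq_2)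
  have "99225 - c * coeff B 0 = 0" using coeff_eq(1) vals(1) by simp
  hence "99225 - c * (0 - c * (132300 - c * (-105840 - c * (43470 - c * (-8736 - c * (924 - c * (-48 - c * (1)))))))) = 0"
    unfolding b0 b2 b4 b6 b8 b10 b12 .
  hence "[99225 - c * (0 - c * (132300 - c * (-105840 - c * (43470 - c * (-8736 - c * (924 - c * (-48 - c * (1)))))))) = 0] (mod 13)" by simp
  moreover define d where "d = c mod 13"
  have cd: "[c = d] (mod 13)" by (simp add: d_def cong_def)
  hence "[99225 - c * (0 - c * (132300 - c * (-105840 - c * (43470 - c * (-8736 - c * (924 - c * (-48 - c * (1)))))))) = 99225 - d * (0 - d * (132300 - d * (-105840 - d * (43470 - d * (-8736 - d * (924 - d * (-48 - d * (1))))))))] (mod 13)"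
    by (intro cong_diff cong_mult cong_refl cd)
  ultimately have "[99225 - d * (0 - d * (132300 - d * (-105840 - d * (43470 - d * (-8736 - d * (924 - d * (-48 - d * (1)))))))) = 0] (mod 13)"
    using cong_trans[OF cong_sym] by blast
  moreover have "d \<in> {0..<13}" by (simp add: d_def)
  hence "d = 0 \<or> d = 1 \<or> d = 2 \<or> d = 3 \<or> d = 4 \<or> d = 5 \<or> d = 6 \<or> d = 7 \<or> d = 8 \<or> d = 9 \<or>
      d = 10 \<or> d = 11 \<or> d = 12"
    unfolding atLeastLessThan_iff by presburger
  ultimately show False by (auto simp: cong_def)
qed

lemma even_degree_of_refl_poly:
  assumes "refl_poly g = g" "lead_coeff g = 1"
  shows "even (degree g)"
  using assms by (auto simp: refl_poly_eq_iff)

theorem wr_irreducible: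
  assumes n: "n \<ge> 1" and m: "n + 1 = m ^ 2"
  shows "irreducible (wr n)"
proof (rule ccontr)
  assume red: "\<not> irreducible (wr n)"
  have lead: "lead_coeff (wr n) = 1" by (rule lead_coeff_wr)
  have deg: "degree (wr n) > 0" using n by (simp add: degree_wr)
  have pos: "coeff (wr n) 0 > 0" by (rule coeff_wr_0_pos)
  have even: "refl_poly (wr n) = wr n" by (simp add: refl_poly_eq_iff coeff_wr_odd)
  have no_even_factor: False
    if AB: "wr n = A * B" and lA: "lead_coeff A = 1" and lB: "lead_coeff B = 1"
      and rA: "refl_poly A = A" and dA: "degree A > 0" and le: "degree A \<le> degree B" for A B
  proof -
    obtain k where k: "degree A = 2 * k" using even_degree_of_refl_poly[OF rA lA] by (rule evenE)
    have "A \<noteq> 0" "B \<noteq> 0" using lA lB by auto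
    hence "degree A + degree B = 2 * n" using degree_mult_eq[of A B] degree_wr[of n] AB by simp
    hence k_le: "2 * k \<le> n" "k \<ge> 1" using k le dA by auto
    have odd0: "coeff A i = 0" if "odd i" for i using rA that by (simp add: refl_poly_eq_iff)
    show False
    proof (cases "n = 8 \<and> k = 1")
      case True
      thus False using wr_8_no_quadratic_factor[of A B] AB lA k odd0[of 1] by simp
    next
      case False
      then obtain p where "good_prime n k p" using exists_good_prime[OF m k_le(2,1)] by blast
      thus False using good_prime_no_even_factor[OF _ k_le(2) AB lA k lB odd0] by blast
    qed
  qed
  from reducible_even_poly_cases[OF lead deg _ even red] pos
  consider A B where "wr n = A * B" "lead_coeff A = 1" "lead_coeff B = 1" "refl_poly A = A" "refl_poly B = B"
      "degree A > 0" "degree B > 0"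
    | g where "lead_coeff g = 1" "wr n = g * refl_poly g \<or> wr n = - (g * refl_poly g)"
    by auto
  thus False
  proof cases
    case 1
    show False
    proof (cases "degree A \<le> degree B")
      case True
      thus False using no_even_factor 1 by blast
    next
      case False
      have "wr n = B * A" using 1(1) by (simp add: mult.commute)
      thus False using no_even_factor[of B A] 1 False by simp
    qed
  next
    case 2
    have g0: "coeff (g * refl_poly g) 0 = coeff g 0 ^ 2"
      by (simp add: coeff_mult_0 coeff_refl_poly power2_eq_square)
    have fg: "wr n = g * refl_poly g"
    proof (rule ccontr)
      assume "wr n \<noteq> g * refl_poly g"
      hence "coeff (wr n) 0 = - (coeff g 0 ^ 2)" using 2(2) g0 by simp
      thus False using pos by simp
    qed
    have "g \<noteq> 0" "refl_poly g \<noteq> 0" using fg lead by auto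
    hence "2 * n = degree g + degree g"
      using degree_mult_eq[of g "refl_poly g"] degree_wr[of n] unfolding fg by simp
    hence dg: "degree g = n" by simp
    have "1 = lead_coeff g * lead_coeff (refl_poly g)"
      using lead unfolding fg by (simp only: lead_coeff_mult)
    hence "(-1 :: int) ^ n = 1" using 2(1) by (simp add: coeff_refl_poly dg)
    hence "even n" by (simp add: minus_one_power_iff split: if_splits)
    have "odd m"
    proof
      assume "even m"
      hence "even (n + 1)" unfolding m by simp
      thus False using \<open>even n\<close> by simp
    qed
    then obtain j where j: "m = 2 * j + 1" by (rule oddE)
    have "n = 4 * (j * (j + 1))" using m unfolding j by (simp add: power2_eq_square algebra_simps)
    hence "n mod 4 = 0" by simp
    thus False using wr_ne_mult_refl_poly[OF _ _ 2(1)] n fg by simp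
  qed
qed

theorem mainTheorem1:
  fixes n :: nat
  assumes "n \<ge> 1" and "\<exists>m::nat. n + 1 = m ^ 2"
  shows "irreducible (remainderR [n, n])"
  using assms wr_irreducible by (auto simp only: remainderR_n_n)

end
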